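(* Let $k\ge2$ be an integer, $r\in\{k-1,k,k+1\}$, and let $K$ be a tetrahedron. Then the degrees of freedom (1)-(4) listed in the context are unisolvent for $W_h^{r-1,k}(K)$; that is, the number of (linearly independent) degrees of freedom equals $\dim W_h^{r-1,k}(K)$, and a function $\bm u\in W_h^{r-1,k}(K)$ for which all of the degrees of freedom vanish is $\bm u=0$.
   Context: $P_m(D)$ is the space of polynomials of degree at most $m$ on $D$ ($\{0\}$ if $m<0$), $\bm P_m=(P_m)^3$, $\tilde{\bm P}_m$ is the space of vector fields with homogeneous polynomial components of degree $m$, $\mathcal S_r=\{\bm p\in\tilde{\bm P}_r:\bm x\cdot\bm p=0\}$ and $\mathcal R_r=\bm P_{r-1}\oplus\mathcal S_r$. Reference map: $\hat K$ is the tetrahedron with vertices $(0,0,0),(1,0,0),(0,1,0),(0,0,1)$, and $F_K(\hat{\bm x})=B_K\hat{\bm x}+\bm b_K$ is the affine map of $\hat K$ onto $K$. Local spaces on a tetrahedron $K$: $V_h^r(K)=\mathcal R_r(K)$; $\Sigma_h^{+,k-1}(K)=P_{k-1}(K)$ if $k\ge5$ and $\Sigma_h^{+,k-1}(K)=P_{k-1}(K)\oplus\operatorname{span}\{\lambda_1\lambda_2\lambda_3\lambda_4\}$ if $k=2,3,4$, where $\lambda_i$ are the barycentric coordinates of $K$; and $W_h^{r-1,k}(K)=\nabla\times V_h^r(K)\oplus\mathfrak p\,\Sigma_h^{+,k-1}(K)$, where $\mathfrak p u(\bm x)=\int_0^1 t^2\,\bm x\,u(t\bm x)\,dt$. Degrees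 of freedom (DOFs) of $W_h^{r-1,k}(K)$ for a vector field $\bm u$ (the test functions $q$, $\bm q$ run over bases of the indicated spaces when counting): (1) vertex: $(\nabla\cdot\bm u)(v_i)$ at the 4 vertices $v_i$ of $K$; (2) edge: $\frac{1}{\operatorname{length}(e_i)}\int_{e_i}(\nabla\cdot\bm u)\,q\,ds$ for all $q\in P_{k-3}(e_i)$ and all 6 edges $e_i$; (3) face: $\frac{1}{\operatorname{area}(f_i)}\int_{f_i}(\nabla\cdot\bm u)\,q\,dA$ for all $q\in P_{k-4}(f_i)$, and $\int_{f_i}\bm u\cdot\bm n_i\,q\,dA$ for all $q\in P_{r-1}(f_i)$, for all 4 faces $f_i$ with unit normal $\bm n_i$; (4) interior: $\int_K\bm u\cdot\bm q\,dV$ for all $\bm q=B_K^{-T}\hat{\bm q}$, $\hat{\bm q}\in\mathcal D$, where $\mathcal D=\nabla P_{k-5}(\hat K)\oplus[\bm P_{r-2}(\hat K)/\nabla P_{r-1}(\hat K)]$ if $k\ge5$; $\mathcal D=[\bm P_{r-2}(\hat K)/\nabla P_{r-1}(\hat K)]$ if $k<5$ and $r\ge2$; $\mathcal D=\emptyset$ if $k<5$ and $r<2$. Here $[\bm P_{r-2}/\nabla P_{r-1}]$ is understood as a complement of $\nabla P_{r-1}$ in $\bm P_{r-2}$. *)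

theory Defs
  imports "HOL-Analysis.Analysis" "HOL-Library.Function_Algebras"
begin

section \<open>Functions as a real vector space\<close>

text \<open>With this instance the library notions \<^const>\<open>span\<close>, \<^const>\<open>independent\<close>,
  \<^const>\<open>subspace\<close> and \<^const>\<open>dim\<close> apply to spaces of functions.\<close>

instantiation "fun" :: (type, real_vector) real_vector
begin

definition scaleR_fun_def: "c *\<^sub>R f = (\<lambda>x. c *\<^sub>R f x)"

instance
  by standard (simp_all add: scaleR_fun_def fun_eq_iff scaleR_add_right scaleR_add_left)

end

definition set_sum :: "'a::real_vector set \<Rightarrow> 'a set \<Rightarrow> 'a set" (infixl "\<oplus>\<^sub>s" 65) where
  "A \<oplus>\<^sub>s B = {a + b | a b. a \<in> A \<and> b \<in> B}"

definition is_basis :: "'a::real_vector set \<Rightarrow> 'a set \<Rightarrow> bool" where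
  "is_basis Q S \<longleftrightarrow> Q \<subseteq> S \<and> independent Q \<and> S \<subseteq> span Q"

definition is_complement :: "'a::real_vector set \<Rightarrow> 'a set \<Rightarrow> 'a set \<Rightarrow> bool" where
  "is_complement C A S \<longleftrightarrow> subspace C \<and> C \<inter> A = {0} \<and> C \<oplus>\<^sub>s A = S"


section \<open>Polynomial spaces\<close>

text \<open>Degrees are integers, so that the spaces of negative degree are \<open>{0}\<close>.  On a tetrahedron,
  which has nonempty interior, a polynomial is identified with the polynomial function it defines
  on the whole space; on edges and faces, where this identification fails, \<open>poly_on\<close> consists of
  genuine restrictions (extended by zero, so that they form a vector space).\<close>

type_synonym scalar_field = "real^3 \<Rightarrow> real"
type_synonym vector_field = "real^3 \<Rightarrow> real^3"

definition monomial :: "(3 \<Rightarrow> nat) \<Rightarrow> scalar_field" where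
  "monomial \<alpha> = (\<lambda>x. \<Prod>i\<in>UNIV. (x $ i) ^ \<alpha> i)"

definition poly_space :: "int \<Rightarrow> scalar_field set" where
  "poly_space m = span {monomial \<alpha> | \<alpha>. int (\<Sum>i\<in>UNIV. \<alpha> i) \<le> m}"

definition hom_poly_space :: "int \<Rightarrow> scalar_field set" where
  "hom_poly_space m = span {monomial \<alpha> | \<alpha>. int (\<Sum>i\<in>UNIV. \<alpha> i) = m}"

definition vec_poly_space :: "int \<Rightarrow> vector_field set" where
  "vec_poly_space m = {p. \<forall>i. (\<lambda>x. p x $ i) \<in> poly_space m}"

definition vec_hom_poly_space :: "int \<Rightarrow> vector_field set" where
  "vec_hom_poly_space m = {p. \<forall>i. (\<lambda>x. p x $ i) \<in> hom_poly_space m}"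

definition poly_on :: "int \<Rightarrow> (real^3) set \<Rightarrow> scalar_field set" where
  "poly_on m D = (\<lambda>p x. if x \<in> D then p x else 0) ` poly_space m"

definition S_space :: "int \<Rightarrow> vector_field set" where
  "S_space r = {p \<in> vec_hom_poly_space r. \<forall>x. x \<bullet> p x = 0}"

definition R_space :: "int \<Rightarrow> vector_field set" where
  "R_space r = vec_poly_space (r - 1) \<oplus>\<^sub>s S_space r"


section \<open>Differential operators and the Poincare operator\<close>

definition grad :: "scalar_field \<Rightarrow> vector_field" where
  "grad p = (\<lambda>x. \<chi> i. frechet_derivative p (at x) (axis i 1))"

definition divergence :: "vector_field \<Rightarrow> scalar_field" where
  "divergence u = (\<lambda>x. trace (jacobian u (at x)))"

definition curl :: "vector_field \<Rightarrow> vector_field" where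
  "curl u = (\<lambda>x. let J = jacobian u (at x) in
     vector [J $ 3 $ 2 - J $ 2 $ 3, J $ 1 $ 3 - J $ 3 $ 1, J $ 2 $ 1 - J $ 1 $ 2])"

definition poincare :: "scalar_field \<Rightarrow> vector_field" where
  "poincare u = (\<lambda>x. integral {0..1} (\<lambda>t. (t\<^sup>2 * u (t *\<^sub>R x)) *\<^sub>R x))"


section \<open>Tetrahedra\<close>

text \<open>A tetrahedron is given by its vertices \<open>v 0, v 1, v 2, v 3\<close>; other values of \<open>v\<close> are
  irrelevant.\<close>

definition tetrahedron_vertices :: "(nat \<Rightarrow> real^3) \<Rightarrow> bool" where
  "tetrahedron_vertices v \<longleftrightarrow> inj_on v {..<4} \<and> \<not> affine_dependent (v ` {..<4})"

definition tetra :: "(nat \<Rightarrow> real^3) \<Rightarrow> (real^3) set" where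
  "tetra v = convex hull (v ` {..<4})"

definition ref_vertex :: "nat \<Rightarrow> real^3" where
  "ref_vertex i = [vector [0,0,0], vector [1,0,0], vector [0,1,0], vector [0,0,1]] ! i"

definition reference_map :: "(nat \<Rightarrow> real^3) \<Rightarrow> real^3^3 \<Rightarrow> real^3 \<Rightarrow> bool" where
  "reference_map v B b \<longleftrightarrow> (\<lambda>x. B *v x + b) ` tetra ref_vertex = tetra v"

definition barycentric :: "(nat \<Rightarrow> real^3) \<Rightarrow> nat \<Rightarrow> scalar_field" where
  "barycentric v i =
     (THE l. l \<in> poly_space 1 \<and> (\<forall>j<4. l (v j) = (if j = i then 1 else 0)))"

definition tetra_edges :: "(nat \<times> nat) set" where
  "tetra_edges = {(a, b). a < b \<and> b < 4}"

definition tetra_faces :: "(nat \<times> nat \<times> nat) set" where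
  "tetra_faces = {(a, b, c). a < b \<and> b < c \<and> c < 4}"

definition edge_set :: "(nat \<Rightarrow> real^3) \<Rightarrow> nat \<times> nat \<Rightarrow> (real^3) set" where
  "edge_set v = (\<lambda>(a, b). convex hull {v a, v b})"

definition face_set :: "(nat \<Rightarrow> real^3) \<Rightarrow> nat \<times> nat \<times> nat \<Rightarrow> (real^3) set" where
  "face_set v = (\<lambda>(a, b, c). convex hull {v a, v b, v c})"

text \<open>Integrals with respect to arc length and surface area, by affine parametrization over the
  unit interval and the unit triangle.\<close>

definition edge_integral :: "(nat \<Rightarrow> real^3) \<Rightarrow> nat \<times> nat \<Rightarrow> scalar_field \<Rightarrow> real" where
  "edge_integral v = (\<lambda>(a, b) g.
     integral {0..1} (\<lambda>s. g (v a + s *\<^sub>R (v b - v a)) * norm (v b - v a)))"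

definition face_integral :: "(nat \<Rightarrow> real^3) \<Rightarrow> nat \<times> nat \<times> nat \<Rightarrow> scalar_field \<Rightarrow> real" where
  "face_integral v = (\<lambda>(a, b, c) g.
     integral {(s, t). 0 \<le> s \<and> 0 \<le> t \<and> s + t \<le> 1}
       (\<lambda>(s, t). g (v a + s *\<^sub>R (v b - v a) + t *\<^sub>R (v c - v a))
                   * norm (cross3 (v b - v a) (v c - v a))))"

definition edge_length :: "(nat \<Rightarrow> real^3) \<Rightarrow> nat \<times> nat \<Rightarrow> real" where
  "edge_length v e = edge_integral v e (\<lambda>_. 1)"

definition face_area :: "(nat \<Rightarrow> real^3) \<Rightarrow> nat \<times> nat \<times> nat \<Rightarrow> real" where
  "face_area v f = face_integral v f (\<lambda>_. 1)"

definition unit_normal :: "(nat \<Rightarrow> real^3) \<Rightarrow> nat \<times> nat \<times> nat \<Rightarrow> real^3 \<Rightarrow> bool" where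
  "unit_normal v = (\<lambda>(a, b, c) n.
     norm n = 1 \<and> n \<bullet> (v b - v a) = 0 \<and> n \<bullet> (v c - v a) = 0)"


section \<open>Local spaces\<close>

definition V_space :: "int \<Rightarrow> vector_field set" where
  "V_space r = R_space r"

text \<open>Only used for \<open>k \<ge> 2\<close>.\<close>

definition Sigma_space :: "int \<Rightarrow> (nat \<Rightarrow> real^3) \<Rightarrow> scalar_field set" where
  "Sigma_space k v =
     (if k \<ge> 5 then poly_space (k - 1)
      else poly_space (k - 1) \<oplus>\<^sub>s span {\<lambda>x. \<Prod>i<4. barycentric v i x})"

definition W_space :: "int \<Rightarrow> int \<Rightarrow> (nat \<Rightarrow> real^3) \<Rightarrow> vector_field set" where
  "W_space r k v = curl ` V_space r \<oplus>\<^sub>s poincare ` Sigma_space k v"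


section \<open>Degrees of freedom\<close>

text \<open>\<open>C\<close> is the chosen complement of the gradients of \<open>poly_space (r - 1)\<close> in
  \<open>vec_poly_space (r - 2)\<close>.\<close>

definition D_space :: "int \<Rightarrow> int \<Rightarrow> vector_field set \<Rightarrow> vector_field set" where
  "D_space k r C =
     (if k \<ge> 5 then grad ` poly_space (k - 5) \<oplus>\<^sub>s C
      else if r \<ge> 2 then C
      else {})"

text \<open>The inverse transpose of \<open>B\<close> applied to a field \<open>q\<close> on the reference tetrahedron, which is
  transported to the tetrahedron by the inverse of \<open>x \<mapsto> B *v x + b\<close>.\<close>

definition push_forward :: "real^3^3 \<Rightarrow> real^3 \<Rightarrow> vector_field \<Rightarrow> vector_field" where
  "push_forward B b q = (\<lambda>x. transpose (matrix_inv B) *v q (matrix_inv B *v (x - b)))"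

datatype dof =
    Vertex nat
  | Edge "nat \<times> nat" scalar_field
  | Face_div "nat \<times> nat \<times> nat" scalar_field
  | Face_normal "nat \<times> nat \<times> nat" scalar_field
  | Interior vector_field

fun dof_value :: "(nat \<Rightarrow> real^3) \<Rightarrow> real^3^3 \<Rightarrow> real^3 \<Rightarrow> (nat \<times> nat \<times> nat \<Rightarrow> real^3)
    \<Rightarrow> dof \<Rightarrow> vector_field \<Rightarrow> real" where
  "dof_value v B b n (Vertex i) u = divergence u (v i)"
| "dof_value v B b n (Edge e q) u =
     edge_integral v e (\<lambda>x. divergence u x * q x) / edge_length v e"
| "dof_value v B b n (Face_div f q) u =
     face_integral v f (\<lambda>x. divergence u x * q x) / face_area v f"
| "dof_value v B b n (Face_normal f q) u = face_integral v f (\<lambda>x. (u x \<bullet> n f) * q x)"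
| "dof_value v B b n (Interior q) u = integral (tetra v) (\<lambda>x. u x \<bullet> push_forward B b q x)"

definition dofs :: "(nat \<times> nat \<Rightarrow> scalar_field set) \<Rightarrow> (nat \<times> nat \<times> nat \<Rightarrow> scalar_field set)
    \<Rightarrow> (nat \<times> nat \<times> nat \<Rightarrow> scalar_field set) \<Rightarrow> vector_field set \<Rightarrow> dof set" where
  "dofs QE QF QN QI =
     Vertex ` {..<4}
     \<union> {Edge e q | e q. e \<in> tetra_edges \<and> q \<in> QE e}
     \<union> {Face_div f q | f q. f \<in> tetra_faces \<and> q \<in> QF f}
     \<union> {Face_normal f q | f q. f \<in> tetra_faces \<and> q \<in> QN f}
     \<union> Interior ` QI"

text \<open>The number of functionals, their linear independence on \<open>W\<close>, and unisolvence proper.\<close>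

definition unisolvent :: "('i \<Rightarrow> 'a::real_vector \<Rightarrow> real) \<Rightarrow> 'i set \<Rightarrow> 'a set \<Rightarrow> bool" where
  "unisolvent N I W \<longleftrightarrow>
     finite I \<and> card I = dim W
     \<and> (\<forall>c. (\<forall>u\<in>W. (\<Sum>i\<in>I. c i * N i u) = 0) \<longrightarrow> (\<forall>i\<in>I. c i = 0))
     \<and> (\<forall>u\<in>W. (\<forall>i\<in>I. N i u = 0) \<longrightarrow> u = 0)"

end

theory Submission
  imports Defs "HOL-Computational_Algebra.Polynomial"
begin

text \<open>
  The space is the direct sum of the divergence-free polynomial fields of degree \<open>r - 1\<close>, which are
  exactly the curls of \<open>R_space r\<close>, and of a space that the divergence maps bijectively onto \<open>\<Sigma>\<close>.
  If all degrees of freedom of \<open>u\<close> vanish, then \<open>div u\<close> vanishes successively at the vertices, on the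
  edges and on the faces, each time by testing with the cofactor of the product of the barycentric
  coordinates; hence \<open>div u = bubble * Q\<close>, and Green's formula with the test function \<open>Q\<close> gives
  \<open>div u = 0\<close>.  Then \<open>u\<close> has vanishing normal components on the faces, so \<open>u \<bullet> \<nabla>\<lambda>\<^sub>i = \<lambda>\<^sub>i q\<^sub>i\<close>, and
  testing with \<open>q\<^sub>i \<nabla>\<lambda>\<^sub>i\<close> gives \<open>u = 0\<close>.  The dimensions of the polynomial spaces on a simplex and its
  faces satisfy Pascal's recursion, because restriction to a facet is onto with kernel generated by
  one barycentric coordinate.  The two counts then agree, and independence follows from injectivity.
\<close>

text \<open>The count hinges on constants, which the gradient kills: a complement of the gradients
  is larger by one than the plain difference of dimensions, and the gradients of
  \<open>poly_space (k - 5)\<close> are one fewer than that space. For k \<ge> 5 these corrections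
  cancel. For k < 5 the second one is absent, and the bubble supplies the missing dimension: the
  boundary values already determine a polynomial of degree k - 1 < 4, while the normal moments with
  constant test function prescribe the mean of the divergence in addition. The Green step works
  because the cofactor \<open>Q\<close> of the bubble has degree at most k - 5 or is constant, so
  that r \<ge> k - 1 and r \<ge> 1 make it a legitimate test function for the normal moments on the
  faces. Polynomials are plain functions without a canonical degree. Degree bounds are therefore
  carried through inductions over membership in \<open>poly_space m\<close>, and uniqueness is
  proved by restriction to a line, where univariate polynomials have finitely many roots.\<close>

section \<open>Linear maps on finite-dimensional subspaces\<close>

text \<open>The differential operators are linear only on spaces of differentiable fields, so linearity is
  always relative to a subspace.\<close>

definition linear_on_space :: "'a::real_vector set \<Rightarrow> ('a \<Rightarrow> 'b::real_vector) \<Rightarrow> bool" where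
  "linear_on_space S f \<longleftrightarrow> (\<forall>x\<in>S. \<forall>y\<in>S. f (x + y) = f x + f y) \<and> (\<forall>c. \<forall>x\<in>S. f (c *\<^sub>R x) = c *\<^sub>R f x)"

definition fin_dim :: "'a::real_vector set \<Rightarrow> bool" where
  "fin_dim S \<longleftrightarrow> (\<exists>B. finite B \<and> S \<subseteq> span B)"

lemma fin_dim_subset: "fin_dim T \<Longrightarrow> S \<subseteq> T \<Longrightarrow> fin_dim S"
  unfolding fin_dim_def by (meson order_trans)

lemma fin_dim_span: "finite B \<Longrightarrow> fin_dim (span B)"
  unfolding fin_dim_def by blast

lemma fin_dim_finite_independent: "fin_dim S \<Longrightarrow> B \<subseteq> S \<Longrightarrow> independent B \<Longrightarrow> finite B"
  unfolding fin_dim_def by (meson independent_span_bound order_trans)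

text \<open>A map that is linear only relative to \<open>S\<close> agrees there with a globally
  linear one, fixed by its values on a basis of \<open>S\<close>. This makes the general facts on
  images of spans and of independent sets applicable.\<close>

lemma linear_on_space_extend:
  assumes "subspace S" "linear_on_space S f"
  obtains g where "linear g" "\<And>x. x \<in> S \<Longrightarrow> g x = f x"
proof -
  obtain B where B: "B \<subseteq> S" "independent B" "S \<subseteq> span B"
    using basis_exists by metis
  obtain g where g: "linear g" "\<forall>x\<in>B. g x = f x"
    using linear_independent_extend[OF B(2)] by metis
  have "x \<in> S \<and> g x = f x" if "x \<in> span B" for x
    using that
  proof (induction rule: span_induct_alt)
    case base
    have "f (0 *\<^sub>R 0) = 0 *\<^sub>R f 0"
      using assms subspace_0 unfolding linear_on_space_def by blast
    then show ?case using g assms by (simp add: linear_0 subspace_0)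
  next
    case (step c x y)
    have "x \<in> S" using B step by auto
    then have "c *\<^sub>R x \<in> S" using assms subspace_scale by blast
    moreover have "f (c *\<^sub>R x + y) = c *\<^sub>R f x + f y"
      using assms(2) \<open>x \<in> S\<close> \<open>c *\<^sub>R x \<in> S\<close> step(2) unfolding linear_on_space_def by auto
    ultimately show ?case
      using g step assms by (auto simp: linear_add linear_scale subspace_add)
  qed
  then show ?thesis using that g B by blast
qed

lemma linear_on_space_0: "linear_on_space S f \<Longrightarrow> subspace S \<Longrightarrow> f 0 = 0"
  by (metis linear_on_space_extend linear_0 subspace_0)

lemma subspace_linear_on_space_image:
  assumes "subspace S" "linear_on_space S f"
  shows "subspace (f ` S)"
  by (metis assms image_cong linear_on_space_extend linear_subspace_image)

lemma subspace_linear_on_space_kernel: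
  assumes "subspace S" "linear_on_space S f"
  shows "subspace {x\<in>S. f x = 0}"
  using assms linear_on_space_0[OF assms(2,1)]
  by (auto simp: subspace_def linear_on_space_def)

lemma fin_dim_image:
  assumes "subspace S" "linear_on_space S f" "fin_dim S"
  shows "fin_dim (f ` S)"
proof -
  obtain g where g: "linear g" "\<And>x. x \<in> S \<Longrightarrow> g x = f x"
    using linear_on_space_extend assms by metis
  obtain B where "finite B" "S \<subseteq> span B" using assms fin_dim_def by auto
  then have "f ` S \<subseteq> span (g ` B)"
    using g by (force simp: linear_span_image)
  then show ?thesis using \<open>finite B\<close> fin_dim_def by blast
qed

lemma fin_dim_basis:
  assumes "fin_dim S" "subspace S"
  obtains B where "finite B" "B \<subseteq> S" "independent B" "span B = S" "card B = dim S"
proof -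
  obtain B where B: "B \<subseteq> S" "independent B" "S \<subseteq> span B" "card B = dim S"
    using basis_exists by metis
  have "finite B" using fin_dim_finite_independent assms B by blast
  moreover have "span B = S" using B assms by (metis span_subspace)
  ultimately show ?thesis using B that by blast
qed

text \<open>A basis \<open>A\<close> of the kernel is extended to a basis \<open>B\<close> of
  \<open>S\<close>. The vectors of \<open>E = B - A\<close> have independent images, and these span
  the image because those of \<open>A\<close> vanish.\<close>

lemma dim_rank_nullity:
  assumes S: "subspace S" "fin_dim S" and f: "linear_on_space S f"
  shows "dim S = dim (f ` S) + dim {x\<in>S. f x = 0}"
proof -
  define K where "K = {x\<in>S. f x = 0}"
  obtain g where g: "linear g" "\<And>x. x \<in> S \<Longrightarrow> g x = f x"
    using linear_on_space_extend S f by metis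
  have K: "subspace K" "K \<subseteq> S"
    using subspace_linear_on_space_kernel[OF S(1) f] unfolding K_def by auto
  obtain A where A: "finite A" "A \<subseteq> K" "independent A" "span A = K" "card A = dim K"
    using fin_dim_basis K S fin_dim_subset by metis
  obtain B where B: "A \<subseteq> B" "B \<subseteq> S" "independent B" "S \<subseteq> span B"
    using maximal_independent_subset_extend[of A S] A K by (metis order_trans)
  have finB: "finite B" using fin_dim_finite_independent S B by blast
  have spB: "span B = S" using B S by (metis span_subspace)
  then have dS: "dim S = card B" using B by (metis dim_span_eq_card_independent)
  define E where "E = B - A"
  have E: "finite E" "E \<subseteq> S" "independent E" "B = A \<union> E" "A \<inter> E = {}"
    using finB B independent_mono[of B E] by (auto simp: E_def)
  have spE: "span E \<subseteq> S" using E S by (metis span_minimal)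
  have inj: "inj_on g (span E)"
  proof (rule inj_onI)
    fix x y assume xy: "x \<in> span E" "y \<in> span E" "g x = g y"
    have "x - y \<in> span E" using xy span_diff by blast
    moreover have "x - y \<in> K" 
      using xy spE g S unfolding K_def
      by (auto simp: linear_diff subspace_diff subset_iff simp flip: g(2))
    ultimately have z: "x - y \<in> span A" "x - y \<in> span E" 
      by (simp_all only: A(4))
    \<comment> \<open>\<open>h\<close> kills \<open>A\<close> and fixes the other basis vectors, so
      a vector in both spans equals its own image under \<open>h\<close>, which is zero.\<close>
    obtain h :: "'a \<Rightarrow> 'a" where h: "linear h" "\<forall>u\<in>B. h u = (if u \<in> A then 0 else u)"
      using linear_independent_extend[OF B(3), where f = "\<lambda>u. if u \<in> A then 0 else u"] by blast
    have "h (x - y) = 0"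
      using z(1) B(1) h(2) by (intro linear_eq_0_on_span[OF h(1) _ z(1)]) auto
    moreover have "h (x - y) = id (x - y)"
      using h(2) by (intro linear_eq_on_span[OF h(1) linear_id _ z(2)]) (auto simp: E_def)
    ultimately show "x = y" by simp
  qed
  have ig: "independent (g ` E)"
    using linear_independent_injective_image[OF g(1) E(3) inj] .
  have "f ` S = span (g ` E)"
  proof -
    have "f ` S = g ` span B" using g(2) spB by auto
    also have "\<dots> = span (g ` B)" using g by (simp add: linear_span_image)
    also have "\<dots> = span (g ` E)"
    proof
      have "g x \<in> span (g ` E)" if "x \<in> B" for x
      proof (cases "x \<in> E")
        case False
        then have "g x = 0" using that E A K g unfolding K_def by auto
        then show ?thesis using span_0 by metis
      qed (simp add: span_base)
      then show "span (g ` B) \<subseteq> span (g ` E)" by (simp add: image_subset_iff span_minimal)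
      show "span (g ` E) \<subseteq> span (g ` B)" using E by (simp add: image_mono span_mono)
    qed
    finally show ?thesis .
  qed
  then have "dim (f ` S) = card (g ` E)" using ig dim_span_eq_card_independent by metis
  also have "\<dots> = card E"
    using inj by (meson card_image inj_on_subset span_superset)
  finally show ?thesis
    using dS E A by (simp add: card_Un_disjoint flip: K_def)
qed

lemma dim_inj_image:
  fixes f :: "'a::real_vector \<Rightarrow> 'b::real_vector"
  assumes "subspace S" "fin_dim S" "linear_on_space S f" "\<And>x. x \<in> S \<Longrightarrow> f x = 0 \<Longrightarrow> x = 0"
  shows "dim (f ` S) = dim S"
proof -
  have "{x\<in>S. f x = 0} = {0}"
    using assms linear_on_space_0 subspace_0 by blast
  then show ?thesis using dim_rank_nullity[OF assms(1-3)]
      dim_span_eq_card_independent[of "{} :: 'a set"] by (simp add: independent_empty)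
qed

text \<open>The first projection maps onto \<open>A\<close> and its kernel is a copy of
  \<open>B\<close>, so rank-nullity adds the dimensions.\<close>

lemma dim_Times_real_vector:
  fixes A :: "'a::real_vector set" and B :: "'b::real_vector set"
  assumes "subspace A" "subspace B" "fin_dim A" "fin_dim B"
  shows "dim (A \<times> B) = dim A + dim B" "fin_dim (A \<times> B)"
proof -
  obtain BA BB where b: "finite BA" "A \<subseteq> span BA" "finite BB" "B \<subseteq> span BB"
    using assms unfolding fin_dim_def by auto
  let ?G = "(\<lambda>a. (a, 0)) ` BA \<union> (\<lambda>b. (0, b)) ` BB"
  have l: "linear (\<lambda>a::'a. (a, 0::'b))" "linear (\<lambda>b::'b. (0::'a, b))"
    by (auto intro!: linearI)
  have "A \<times> B \<subseteq> span ?G"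
  proof
    fix z assume "z \<in> A \<times> B"
    then obtain x y where z: "z = (x, 0) + (0, y)" "x \<in> span BA" "y \<in> span BB"
      using b by auto
    have "(x, 0) \<in> span ((\<lambda>a. (a, 0::'b)) ` BA)"
      using z l by (metis imageI linear_span_image)
    moreover have "(0, y) \<in> span ((\<lambda>b. (0::'a, b)) ` BB)"
      using z l by (metis imageI linear_span_image)
    ultimately show "z \<in> span ?G"
      unfolding z(1) by (meson Un_upper1 Un_upper2 span_add span_mono subsetD)
  qed
  then show fd: "fin_dim (A \<times> B)" using b unfolding fin_dim_def
    by (meson finite_Un finite_imageI)
  have s: "subspace (A \<times> B)" by (rule subspace_Times[OF assms(1,2)])
  have 1: "dim (A \<times> B) = dim (fst ` (A \<times> B)) + dim {x\<in>A \<times> B. fst x = 0}"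
    using s fd by (rule dim_rank_nullity) (auto simp: linear_on_space_def)
  have "{x\<in>A \<times> B. fst x = 0} = (\<lambda>b. (0, b)) ` B"
    using subspace_0[OF assms(1)] by force
  moreover have "dim ((\<lambda>b. (0::'a, b)) ` B) = dim B"
    using assms by (intro dim_inj_image) (auto simp: linear_on_space_def zero_prod_def)
  moreover have "fst ` (A \<times> B) = A" using subspace_0[OF assms(2)] by force
  ultimately show "dim (A \<times> B) = dim A + dim B" using 1 by simp
qed

section \<open>Sums of subspaces\<close>

lemma subspace_set_sum: "subspace A \<Longrightarrow> subspace B \<Longrightarrow> subspace (A \<oplus>\<^sub>s B)"
  using subspace_sums[of A B] by (simp add: set_sum_def)

lemma set_sum_conv_image: "A \<oplus>\<^sub>s B = (\<lambda>z. fst z + snd z) ` (A \<times> B)"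
  by (force simp: set_sum_def)

text \<open>Addition maps the product injectively onto the sum: if the entries of a pair add up to
  zero, both lie in the intersection.\<close>

lemma dim_set_sum:
  fixes A B :: "'a::real_vector set"
  assumes "subspace A" "subspace B" "fin_dim A" "fin_dim B" "A \<inter> B \<subseteq> {0}"
  shows "dim (A \<oplus>\<^sub>s B) = dim A + dim B"
proof -
  have "dim ((\<lambda>z. fst z + snd z) ` (A \<times> B)) = dim (A \<times> B)"
  proof (rule dim_inj_image)
    fix x assume "x \<in> A \<times> B" "fst x + snd x = 0"
    then have *: "fst x = - snd x" "fst x \<in> A" "snd x \<in> B"
      by (auto simp: eq_neg_iff_add_eq_0)
    then have "fst x \<in> B" using subspace_neg[OF assms(2)] by metis
    then have "fst x = 0" using * assms(5) by blast
    then show "x = 0" using * by (simp add: prod_eq_iff)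
  qed (use assms in \<open>simp_all add: dim_Times_real_vector subspace_Times linear_on_space_def scaleR_add_right\<close>)
  then show ?thesis using assms by (simp add: set_sum_conv_image dim_Times_real_vector)
qed

lemma fin_dim_set_sum:
  fixes A B :: "'a::real_vector set"
  assumes "subspace A" "subspace B" "fin_dim A" "fin_dim B"
  shows "fin_dim (A \<oplus>\<^sub>s B)"
  unfolding set_sum_conv_image
  by (rule fin_dim_image)
    (use assms in \<open>simp_all add: dim_Times_real_vector subspace_Times linear_on_space_def scaleR_add_right\<close>)

text \<open>Collecting the values of all functionals embeds \<open>W\<close> into the functions
  supported on \<open>J\<close>, which are spanned by one indicator function for each index.\<close>

lemma dim_le_card_functionals:
  fixes N :: "'i \<Rightarrow> 'a::real_vector \<Rightarrow> real"
  assumes W: "subspace W" "fin_dim W" and "finite J"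
    and lin: "\<And>i. i \<in> J \<Longrightarrow> linear_on_space W (N i)"
    and inj: "\<And>u. u \<in> W \<Longrightarrow> (\<And>i. i \<in> J \<Longrightarrow> N i u = 0) \<Longrightarrow> u = 0"
  shows "dim W \<le> card J"
proof -
  define \<Phi> where "\<Phi> u = (\<lambda>i. if i \<in> J then N i u else 0)" for u
  define E where "E = (\<lambda>i j. if j = i then 1 else 0 :: real) ` J"
  have lin\<Phi>: "linear_on_space W \<Phi>"
    using lin unfolding linear_on_space_def \<Phi>_def by (simp add: fun_eq_iff scaleR_fun_def)
  have "\<Phi> u \<in> span E" for u
  proof -
    have "\<Phi> u = (\<Sum>i\<in>J. N i u *\<^sub>R (\<lambda>j. if j = i then 1 else 0))"
    proof
      fix j
      have "(\<Sum>i\<in>J. N i u *\<^sub>R (\<lambda>j. if j = i then 1 else 0)) j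
          = (\<Sum>i\<in>J. N i u * (if j = i then 1 else 0))"
        by (induction rule: infinite_finite_induct) (auto simp: scaleR_fun_def)
      then show "\<Phi> u j = (\<Sum>i\<in>J. N i u *\<^sub>R (\<lambda>j. if j = i then 1 else 0)) j"
        using \<open>finite J\<close> by (simp add: \<Phi>_def if_distrib cong: if_cong)
    qed
    then show ?thesis unfolding E_def
      by (simp add: span_sum span_scale span_base)
  qed
  moreover have "dim (\<Phi> ` W) = dim W"
  proof (rule dim_inj_image[OF W lin\<Phi>])
    fix u assume u: "u \<in> W" "\<Phi> u = 0"
    have "N i u = 0" if "i \<in> J" for i
      using fun_cong[OF u(2), of i] that by (simp add: \<Phi>_def)
    then show "u = 0" using inj u(1) by blast
  qed
  moreover obtain B where "B \<subseteq> \<Phi> ` W" "independent B" "card B = dim (\<Phi> ` W)"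
    using basis_exists by metis
  moreover have "finite E" "card E \<le> card J" using \<open>finite J\<close> by (auto simp: E_def card_image_le)
  ultimately show ?thesis
    by (smt (verit, best) image_subset_iff independent_span_bound le_trans subset_iff)
qed

text \<open>If the functionals were dependent, one of them could be dropped without losing joint
  injectivity, contradicting the count.\<close>

lemma unisolventI:
  fixes N :: "'i \<Rightarrow> 'a::real_vector \<Rightarrow> real"
  assumes W: "subspace W" "fin_dim W" and J: "finite J" "card J = dim W"
    and lin: "\<And>i. i \<in> J \<Longrightarrow> linear_on_space W (N i)"
    and inj: "\<And>u. u \<in> W \<Longrightarrow> (\<And>i. i \<in> J \<Longrightarrow> N i u = 0) \<Longrightarrow> u = 0"
  shows "unisolvent N J W"
  unfolding unisolvent_def
proof (intro conjI allI impI ballI)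
  fix c j assume c: "\<forall>u\<in>W. (\<Sum>i\<in>J. c i * N i u) = 0" and j: "j \<in> J"
  show "c j = 0"
  proof (rule ccontr)
    assume "c j \<noteq> 0"
    have "dim W \<le> card (J - {j})"
    proof (rule dim_le_card_functionals[OF W])
      fix u assume u: "u \<in> W" "\<And>i. i \<in> J - {j} \<Longrightarrow> N i u = 0"
      have "(\<Sum>i\<in>J. c i * N i u) = c j * N j u + (\<Sum>i\<in>J - {j}. c i * N i u)"
        using J j by (simp add: sum.remove)
      then have "N j u = 0" using c u \<open>c j \<noteq> 0\<close> by simp
      then show "u = 0" using inj u by blast
    qed (use J lin in auto)
    then show False using J j by (metis card_Diff1_less not_less)
  qed
qed (use J inj in auto)

section \<open>Polynomials in three variables\<close>

lemma scaleR_fun_apply [simp]: "(c *\<^sub>R f) x = c *\<^sub>R f x"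
  by (simp add: scaleR_fun_def)

lemma sum_fun_apply: "sum f A x = (\<Sum>i\<in>A. f i x)"
  by (induction A rule: infinite_finite_induct) auto

lemma monomial_zero: "monomial (\<lambda>_. 0) = (\<lambda>_. 1)"
  by (simp add: monomial_def)

lemma monomial_mult_coordinate:
  "monomial (\<lambda>j. \<alpha> j + (if j = i then 1 else 0)) = (\<lambda>x. x $ i * monomial \<alpha> x)"
proof -
  have "(\<Prod>j\<in>UNIV. (x $ j) ^ (if j = i then 1 else 0)) = (\<Prod>j\<in>UNIV. if j = i then x $ j else 1)" for x :: "real^3"
    by (rule prod.cong) auto
  then show ?thesis
    by (simp add: monomial_def power_add prod.distrib mult.commute del: power_Suc)
qed

text \<open>The degree \<open>m\<close> at which the constant monomial starts is a parameter: spaces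
  of bounded degree admit it with any slack, homogeneous ones only in degree zero.\<close>

lemma monomial_induct:
  assumes one: "Q m (\<lambda>_. 1)" and mult: "\<And>m p i. Q m p \<Longrightarrow> Q (m + 1) (\<lambda>x. x $ i * p x)"
  shows "Q (m + int (\<Sum>i\<in>UNIV. \<alpha> i)) (monomial \<alpha>)"
proof (induction "\<Sum>i\<in>UNIV. \<alpha> i" arbitrary: \<alpha>)
  case 0
  then have "\<alpha> = (\<lambda>_. 0)" by auto
  then show ?case using one by (simp add: monomial_zero)
next
  case (Suc n)
  then obtain i where i: "\<alpha> i > 0"
    by (metis Zero_not_Suc gr0I sum.neutral)
  \<comment> \<open>Lowers the exponent of a variable that occurs, which peels off one coordinate
    factor.\<close>
  define \<beta> where "\<beta> j = (if j = i then \<alpha> j - 1 else \<alpha> j)" for j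
  have \<alpha>: "\<alpha> = (\<lambda>j. \<beta> j + (if j = i then 1 else 0))"
    using i by (auto simp: \<beta>_def fun_eq_iff)
  have s: "(\<Sum>i\<in>UNIV. \<alpha> i) = (\<Sum>i\<in>UNIV. \<beta> i) + 1"
    unfolding \<alpha> by (simp add: sum.distrib)
  have "Q (m + int (\<Sum>i\<in>UNIV. \<beta> i)) (monomial \<beta>)"
    using Suc s by (intro Suc(1)) simp
  from mult[OF this, of i] show ?case
    by (subst \<alpha>) (simp add: monomial_mult_coordinate s algebra_simps)
qed

lemma subspace_poly_space: "subspace (poly_space m)"
  unfolding poly_space_def by (rule subspace_span)

lemma subspace_hom_poly_space: "subspace (hom_poly_space m)"
  unfolding hom_poly_space_def by (rule subspace_span)

lemma poly_space_mono: "m \<le> n \<Longrightarrow> poly_space m \<subseteq> poly_space n"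
  unfolding poly_space_def by (rule span_mono) auto

lemma hom_poly_space_subset: "hom_poly_space m \<subseteq> poly_space m"
  unfolding poly_space_def hom_poly_space_def by (rule span_mono) auto

lemma poly_space_neg: "m < 0 \<Longrightarrow> poly_space m = {0}"
proof -
  assume "m < 0"
  then have "{monomial \<alpha> |\<alpha>. int (\<Sum>i\<in>UNIV. \<alpha> i) \<le> m} = {}"
    by (auto simp del: of_nat_sum)
  then show ?thesis unfolding poly_space_def by (simp only: span_empty)
qed

lemma span_coordinate_mult:
  assumes "p \<in> span A" "\<And>a. a \<in> A \<Longrightarrow> (\<lambda>x. x $ i * a x) \<in> S" "subspace S"
  shows "(\<lambda>x. (x::real^3) $ i * p x) \<in> (S :: scalar_field set)"
  using assms(1)
proof (induction rule: span_induct_alt)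
  case base
  then show ?case using subspace_0[OF assms(3)] by (simp add: zero_fun_def)
next
  case (step c p q)
  have "(\<lambda>x. x $ i * (c *\<^sub>R p + q) x) = c *\<^sub>R (\<lambda>x. x $ i * p x) + (\<lambda>x. x $ i * q x)"
    by (auto simp: fun_eq_iff algebra_simps)
  then show ?case using step assms(2,3)
    by (metis (no_types, lifting) subspace_add subspace_scale)
qed

lemma poly_space_coordinate_mult:
  "p \<in> poly_space m \<Longrightarrow> (\<lambda>x. x $ i * p x) \<in> poly_space (m + 1)"
  unfolding poly_space_def
proof (erule span_coordinate_mult, rule span_base)
  fix a assume "a \<in> {monomial \<alpha> |\<alpha>. int (\<Sum>i\<in>UNIV. \<alpha> i) \<le> m}"
  then obtain \<alpha> where "a = monomial \<alpha>" "int (\<Sum>i\<in>UNIV. \<alpha> i) \<le> m" by auto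
  then show "(\<lambda>x. x $ i * a x) \<in> {monomial \<alpha> |\<alpha>. int (\<Sum>i\<in>UNIV. \<alpha> i) \<le> m + 1}"
    by (intro CollectI exI[of _ "\<lambda>j. \<alpha> j + (if j = i then 1 else 0)"])
      (simp add: monomial_mult_coordinate sum.distrib)
qed auto

lemma hom_poly_space_coordinate_mult:
  "p \<in> hom_poly_space m \<Longrightarrow> (\<lambda>x. x $ i * p x) \<in> hom_poly_space (m + 1)"
  unfolding hom_poly_space_def
proof (erule span_coordinate_mult, rule span_base)
  fix a assume "a \<in> {monomial \<alpha> |\<alpha>. int (\<Sum>i\<in>UNIV. \<alpha> i) = m}"
  then obtain \<alpha> where "a = monomial \<alpha>" "int (\<Sum>i\<in>UNIV. \<alpha> i) = m" by auto
  then show "(\<lambda>x. x $ i * a x) \<in> {monomial \<alpha> |\<alpha>. int (\<Sum>i\<in>UNIV. \<alpha> i) = m + 1}"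
    by (intro CollectI exI[of _ "\<lambda>j. \<alpha> j + (if j = i then 1 else 0)"])
      (simp add: monomial_mult_coordinate sum.distrib)
qed auto

lemma poly_space_one: "m \<ge> 0 \<Longrightarrow> (\<lambda>_. 1) \<in> poly_space m"
  unfolding poly_space_def
  by (rule span_base) (auto intro!: exI[of _ "\<lambda>_. 0"] simp: monomial_zero)

lemma hom_poly_space_one: "(\<lambda>_. 1) \<in> hom_poly_space 0"
  unfolding hom_poly_space_def
  by (rule span_base) (auto intro!: exI[of _ "\<lambda>_. 0"] simp: monomial_zero)

text \<open>An element of a span has no canonical expression, so polynomials are generated by
  operations instead. The degree is an argument of \<open>Q\<close>, so that degree bounds can be
  proved along with the property.\<close>

lemma poly_space_induct [consumes 1, case_names zero add scale one mult]:
  assumes "p \<in> poly_space m"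
    and zero: "\<And>m. Q m 0"
    and add: "\<And>m p q. p \<in> poly_space m \<Longrightarrow> q \<in> poly_space m \<Longrightarrow> Q m p \<Longrightarrow> Q m q \<Longrightarrow> Q m (p + q)"
    and scale: "\<And>m c p. p \<in> poly_space m \<Longrightarrow> Q m p \<Longrightarrow> Q m (c *\<^sub>R p)"
    and one: "\<And>m. m \<ge> 0 \<Longrightarrow> Q m (\<lambda>_. 1)"
    and mult: "\<And>m p i. p \<in> poly_space m \<Longrightarrow> Q m p \<Longrightarrow> Q (m + 1) (\<lambda>x. x $ i * p x)"
  shows "Q m p"
proof -
  have "p \<in> poly_space m \<and> Q m p"
    using assms(1) unfolding poly_space_def
  proof (induction rule: span_induct_alt)
    case base
    show ?case by (rule conjI[OF span_0 zero])
  next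
    case (step c a q)
    then obtain \<alpha> where a: "a = monomial \<alpha>" "int (\<Sum>i\<in>UNIV. \<alpha> i) \<le> m" by auto
    \<comment> \<open>The slack between the degree bound and the degree of this monomial.\<close>
    define d where "d = m - int (\<Sum>i\<in>UNIV. \<alpha> i)"
    have "monomial \<alpha> \<in> poly_space (d + int (\<Sum>i\<in>UNIV. \<alpha> i)) \<and> Q (d + int (\<Sum>i\<in>UNIV. \<alpha> i)) (monomial \<alpha>)"
    proof (rule monomial_induct[where Q = "\<lambda>m p. p \<in> poly_space m \<and> Q m p"])
      show "(\<lambda>_. 1) \<in> poly_space d \<and> Q d (\<lambda>_. 1)"
        using a(2) one poly_space_one by (simp add: d_def)
    qed (use mult poly_space_coordinate_mult in blast)
    then have *: "a \<in> poly_space m" "Q m a" unfolding d_def a(1) by simp_all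
    have q: "q \<in> poly_space m" using step unfolding poly_space_def by blast
    have "c *\<^sub>R a \<in> poly_space m" using * subspace_poly_space subspace_scale by blast
    moreover have "Q m (c *\<^sub>R a)" using * scale by blast
    ultimately show ?case
      using q step(2) add subspace_add[OF subspace_poly_space]
      unfolding poly_space_def[symmetric] by blast
  qed
  then show ?thesis ..
qed

lemma hom_poly_space_induct [consumes 1, case_names zero add scale one mult]:
  assumes "p \<in> hom_poly_space m"
    and zero: "\<And>m. Q m 0"
    and add: "\<And>m p q. p \<in> hom_poly_space m \<Longrightarrow> q \<in> hom_poly_space m \<Longrightarrow> Q m p \<Longrightarrow> Q m q \<Longrightarrow> Q m (p + q)"
    and scale: "\<And>m c p. p \<in> hom_poly_space m \<Longrightarrow> Q m p \<Longrightarrow> Q m (c *\<^sub>R p)"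
    and one: "Q 0 (\<lambda>_. 1)"
    and mult: "\<And>m p i. p \<in> hom_poly_space m \<Longrightarrow> Q m p \<Longrightarrow> Q (m + 1) (\<lambda>x. x $ i * p x)"
  shows "Q m p"
proof -
  have "p \<in> hom_poly_space m \<and> Q m p"
    using assms(1) unfolding hom_poly_space_def
  proof (induction rule: span_induct_alt)
    case base
    show ?case by (rule conjI[OF span_0 zero])
  next
    case (step c a q)
    then obtain \<alpha> where a: "a = monomial \<alpha>" "int (\<Sum>i\<in>UNIV. \<alpha> i) = m" by auto
    have "monomial \<alpha> \<in> hom_poly_space (0 + int (\<Sum>i\<in>UNIV. \<alpha> i)) \<and> Q (0 + int (\<Sum>i\<in>UNIV. \<alpha> i)) (monomial \<alpha>)"
    proof (rule monomial_induct[where Q = "\<lambda>m p. p \<in> hom_poly_space m \<and> Q m p"])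
      show "(\<lambda>_. 1) \<in> hom_poly_space 0 \<and> Q 0 (\<lambda>_. 1)"
        using one hom_poly_space_one by simp
    qed (use mult hom_poly_space_coordinate_mult in blast)
    then have *: "a \<in> hom_poly_space m" "Q m a" unfolding a(2) a(1) by simp_all
    have q: "q \<in> hom_poly_space m" using step unfolding hom_poly_space_def by blast
    have "c *\<^sub>R a \<in> hom_poly_space m" using * subspace_hom_poly_space subspace_scale by blast
    moreover have "Q m (c *\<^sub>R a)" using * scale by blast
    ultimately show ?case
      using q step(2) add subspace_add[OF subspace_hom_poly_space]
      unfolding hom_poly_space_def[symmetric] by blast
  qed
  then show ?thesis ..
qed

lemma poly_space_zero: "0 \<in> poly_space m" "(\<lambda>_. 0) \<in> poly_space m"
  using subspace_0[OF subspace_poly_space, of m] by (auto simp: zero_fun_def)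

lemma poly_space_add: "p \<in> poly_space m \<Longrightarrow> q \<in> poly_space m \<Longrightarrow> (\<lambda>x. p x + q x) \<in> poly_space m"
  using subspace_add[OF subspace_poly_space, of p m q] by (simp add: plus_fun_def)

lemma poly_space_cmult: "p \<in> poly_space m \<Longrightarrow> (\<lambda>x. c * p x) \<in> poly_space m"
  using subspace_scale[OF subspace_poly_space, of p m c] by (simp add: scaleR_fun_def)

lemma poly_space_diff: "p \<in> poly_space m \<Longrightarrow> q \<in> poly_space m \<Longrightarrow> (\<lambda>x. p x - q x) \<in> poly_space m"
  using poly_space_add[of p m "\<lambda>x. (-1) * q x"] poly_space_cmult[of q m "-1"] by simp

lemma poly_space_sum: "(\<And>i. i \<in> A \<Longrightarrow> p i \<in> poly_space m) \<Longrightarrow> (\<lambda>x. \<Sum>i\<in>A. p i x) \<in> poly_space m"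
  by (induction A rule: infinite_finite_induct) (simp_all add: poly_space_zero poly_space_add)

lemma poly_space_const: "m \<ge> 0 \<Longrightarrow> (\<lambda>_. c) \<in> poly_space m"
  using poly_space_cmult[OF poly_space_one, of m c] by simp

lemma poly_space_coordinate: "m \<ge> 1 \<Longrightarrow> (\<lambda>x. x $ i) \<in> poly_space m"
  using poly_space_coordinate_mult[OF poly_space_one, of "m - 1" i] by simp

lemma poly_space_mult: "p \<in> poly_space m \<Longrightarrow> q \<in> poly_space n \<Longrightarrow> (\<lambda>x. p x * q x) \<in> poly_space (m + n)"
proof (induction rule: poly_space_induct)
  case (add m p p')
  then show ?case by (simp add: distrib_right poly_space_add)
next
  case (scale m c p)
  then show ?case by (simp add: mult.assoc poly_space_cmult)
next
  case (one m)
  then show ?case using poly_space_mono[of n "m + n"] by auto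
next
  case (mult m p i)
  then show ?case 
    using poly_space_coordinate_mult[of "\<lambda>x. p x * q x" "m + n" i] by (simp add: ac_simps)
qed (simp add: poly_space_zero)

lemma poly_space_compose_affine:
  assumes "p \<in> poly_space m" "\<And>i. (\<lambda>x. A x $ i) \<in> poly_space 1"
  shows "(\<lambda>x. p (A x)) \<in> poly_space m"
  using assms(1)
proof (induction rule: poly_space_induct)
  case (mult m p i)
  then show ?case using poly_space_mult[OF assms(2)[of i] mult(2)] by (simp add: add.commute)
qed (simp_all add: poly_space_zero poly_space_add poly_space_cmult poly_space_one)

lemma poly_space_inner: "(\<lambda>x. a \<bullet> x) \<in> poly_space 1"
  by (simp add: inner_vec_def poly_space_sum poly_space_cmult poly_space_coordinate)

text \<open>When \<open>l\<close> is affine with \<open>l (x + t *\<^sub>R d) = l x + t\<close>, the map \<open>x \<mapsto> x - l x *\<^sub>R d\<close> is a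
  projection onto the zero set of \<open>l\<close>, and \<open>q\<close> is the quotient of a polynomial vanishing there by \<open>l\<close>.\<close>

lemma poly_space_affine_division:
  assumes "p \<in> poly_space m" "l \<in> poly_space 1"
  shows "\<exists>q\<in>poly_space (m - 1). \<forall>x. p x - p (x - l x *\<^sub>R d) = l x * q x"
  using assms(1)
proof (induction rule: poly_space_induct)
  case (zero m)
  then show ?case by (intro bexI[of _ 0]) (auto simp: poly_space_zero)
next
  case (add m p p')
  then obtain q q' where q: "q \<in> poly_space (m - 1)" "q' \<in> poly_space (m - 1)"
    "\<And>x. p x - p (x - l x *\<^sub>R d) = l x * q x" "\<And>x. p' x - p' (x - l x *\<^sub>R d) = l x * q' x" by auto
  have "(p + p') x - (p + p') (x - l x *\<^sub>R d) = l x * (q x + q' x)" for x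
    using q(3,4)[of x] by (simp add: algebra_simps)
  then show ?case using poly_space_add[OF q(1,2)] by (intro bexI[of _ "\<lambda>x. q x + q' x"]) auto
next
  case (scale m c p)
  then obtain q where q: "q \<in> poly_space (m - 1)" "\<And>x. p x - p (x - l x *\<^sub>R d) = l x * q x" by auto
  have "(c *\<^sub>R p) x - (c *\<^sub>R p) (x - l x *\<^sub>R d) = c * (p x - p (x - l x *\<^sub>R d))" for x
    by (simp add: algebra_simps)
  then have "(c *\<^sub>R p) x - (c *\<^sub>R p) (x - l x *\<^sub>R d) = l x * (c * q x)" for x
    by (simp add: q(2))
  then show ?case using poly_space_cmult[OF q(1), of c] by (intro bexI[of _ "\<lambda>x. c * q x"]) auto
next
  case (one m)
  then show ?case by (intro bexI[of _ 0]) (auto simp: poly_space_zero)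
next
  case (mult m p i)
  then obtain q where q: "q \<in> poly_space (m - 1)" "\<And>x. p x - p (x - l x *\<^sub>R d) = l x * q x" by auto
  have "(\<lambda>x. (x - l x *\<^sub>R d) $ j) \<in> poly_space 1" for j
  proof -
    have "(\<lambda>x. x $ j - d $ j * l x) \<in> poly_space 1"
      by (intro poly_space_diff poly_space_cmult assms(2)) (rule poly_space_coordinate, simp)
    then show ?thesis by (simp add: mult.commute[of "d $ j"])
  qed
  then have "(\<lambda>x. p (x - l x *\<^sub>R d)) \<in> poly_space m"
    by (rule poly_space_compose_affine[OF mult(1)])
  \<comment> \<open>The new quotient comes from x_i p(x) - y_i p(y) = x_i (p(x) - p(y)) + (x_i -
    y_i) p(y), where y = x - l(x) d and hence x_i - y_i = l(x) d_i.\<close>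
  then have "(\<lambda>x. x $ i * q x + d $ i * p (x - l x *\<^sub>R d)) \<in> poly_space (m + 1 - 1)"
    using poly_space_add[OF poly_space_coordinate_mult[OF q(1), of i] poly_space_cmult, of _ "d $ i"] by simp
  moreover have "x $ i * p x - (x - l x *\<^sub>R d) $ i * p (x - l x *\<^sub>R d)
      = l x * (x $ i * q x + d $ i * p (x - l x *\<^sub>R d))" for x
  proof -
    have "x $ i * p x - (x - l x *\<^sub>R d) $ i * p (x - l x *\<^sub>R d)
      = x $ i * (p x - p (x - l x *\<^sub>R d)) + l x * (d $ i * p (x - l x *\<^sub>R d))"
      by (simp add: left_diff_distrib right_diff_distrib)
    then show ?thesis unfolding q(2) by (simp add: distrib_left)
  qed
  ultimately show ?case
    by (intro bexI[of _ "\<lambda>x. x $ i * q x + d $ i * p (x - l x *\<^sub>R d)"]) auto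
qed

text \<open>Reduction to univariate polynomials, whose roots can be counted. The guard
  \<open>c \<noteq> 0\<close> concerns the zero polynomial: it occurs for negative \<open>m\<close>,
  but its \<open>degree\<close> is 0.\<close>

lemma poly_space_on_line:
  assumes "p \<in> poly_space m"
  shows "\<exists>c. (\<forall>t. p (a + t *\<^sub>R d) = poly c t) \<and> (c \<noteq> 0 \<longrightarrow> int (degree c) \<le> m)"
  using assms
proof (induction rule: poly_space_induct)
  case (add m p q)
  then obtain c c' where "\<forall>t. p (a + t *\<^sub>R d) = poly c t" "c \<noteq> 0 \<longrightarrow> int (degree c) \<le> m"
    "\<forall>t. q (a + t *\<^sub>R d) = poly c' t" "c' \<noteq> 0 \<longrightarrow> int (degree c') \<le> m" by auto
  moreover have "int (degree (c + c')) \<le> m" if "c + c' \<noteq> 0"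
    using calculation that degree_add_le_max[of c c'] by (cases "c = 0"; cases "c' = 0") auto
  ultimately show ?case by (intro exI[of _ "c + c'"]) auto
next
  case (scale m s p)
  then obtain c where "\<forall>t. p (a + t *\<^sub>R d) = poly c t" "c \<noteq> 0 \<longrightarrow> int (degree c) \<le> m" by auto
  then show ?case by (intro exI[of _ "smult s c"]) auto
next
  case (one m)
  then show ?case by (intro exI[of _ "[:1:]"]) auto
next
  case (mult m p i)
  then obtain c where "\<forall>t. p (a + t *\<^sub>R d) = poly c t" "c \<noteq> 0 \<longrightarrow> int (degree c) \<le> m" by auto
  moreover have "degree ([:a $ i, d $ i:] * c) \<le> 1 + degree c"
    by (rule order_trans[OF degree_mult_le]) simp
  ultimately show ?case 
    by (intro exI[of _ "[:a $ i, d $ i:] * c"]) (auto simp: algebra_simps)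
qed (auto intro: exI[of _ 0])

text \<open>On the line from \<open>x0\<close> to \<open>y\<close> the polynomial vanishes for all
  small positive parameters, hence identically, hence at parameter 1.\<close>

lemma poly_space_eq_0:
  assumes "p \<in> poly_space m" "open U" "x0 \<in> U" "\<And>x. x \<in> U \<Longrightarrow> p x = 0"
  shows "p = 0"
proof
  fix y
  obtain c where c: "\<And>t. p (x0 + t *\<^sub>R (y - x0)) = poly c t"
    using poly_space_on_line[OF assms(1)] by metis
  have "((\<lambda>t. x0 + t *\<^sub>R (y - x0)) \<longlongrightarrow> x0 + 0 *\<^sub>R (y - x0)) (at_right (0::real))"
    by (intro tendsto_intros)
  then have "\<forall>\<^sub>F t in at_right (0::real). x0 + t *\<^sub>R (y - x0) \<in> U"
    using assms(2,3) by (auto intro: topological_tendstoD)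
  then obtain e where e: "e > 0" "\<And>t. 0 < t \<Longrightarrow> t < e \<Longrightarrow> x0 + t *\<^sub>R (y - x0) \<in> U"
    unfolding eventually_at_right_field by auto
  have "{0<..<e} \<subseteq> {t. poly c t = 0}" using e assms(4) c by force
  moreover have "infinite {0<..<e}" using e by simp
  ultimately have "c = 0" using finite_subset poly_roots_finite by blast
  then show "p y = 0 y" using c[of 1] by simp
qed

text \<open>The alternative \<open>p = 0\<close> covers negative degrees, whose homogeneous spaces
  are trivial.\<close>

lemma hom_poly_space_scaling:
  "p \<in> hom_poly_space m \<Longrightarrow> m \<ge> 0 \<and> p (t *\<^sub>R x) = t ^ nat m * p x \<or> p = 0"
proof (induction rule: hom_poly_space_induct)
  case (add m p q)
  then show ?case by (auto simp: algebra_simps)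
next
  case (mult m p i)
  then show ?case by (auto simp: nat_add_distrib fun_eq_iff)
qed auto

text \<open>Along a ray through a point with nonzero value, \<open>p\<close> is a nonzero multiple
  of the \<open>m\<close>-th power of the parameter, so no smaller degree bound can hold.\<close>

lemma hom_poly_space_lower_degree:
  assumes "p \<in> hom_poly_space m" "p \<in> poly_space n" "n < m"
  shows "p = 0"
proof (rule ccontr)
  assume "p \<noteq> 0"
  then obtain x where x: "p x \<noteq> 0" by (auto simp: fun_eq_iff)
  obtain c where c: "\<And>t. p (0 + t *\<^sub>R x) = poly c t" "c \<noteq> 0 \<longrightarrow> int (degree c) \<le> n"
    using poly_space_on_line[OF assms(2)] by metis
  have m: "m \<ge> 0" "\<And>t. p (t *\<^sub>R x) = t ^ nat m * p x"
    using hom_poly_space_scaling[OF assms(1)] \<open>p \<noteq> 0\<close> by blast+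
  have "poly c t = poly (monom (p x) (nat m)) t" for t
    using c(1)[of t] m by (simp add: poly_monom mult.commute)
  then have "c = monom (p x) (nat m)" by (intro iffD1[OF poly_eq_poly_eq_iff] ext)
  then show False using c(2) x m(1) assms(3) by (simp add: degree_monom_eq)
qed

lemma poly_space_decompose:
  assumes "p \<in> poly_space m"
  shows "\<exists>q\<in>poly_space (m - 1). \<exists>h\<in>hom_poly_space m. p = q + h"
proof -
  have "{monomial \<alpha> |\<alpha>. int (\<Sum>i\<in>UNIV. \<alpha> i) \<le> m} =
    {monomial \<alpha> |\<alpha>. int (\<Sum>i\<in>UNIV. \<alpha> i) \<le> m - 1} \<union> {monomial \<alpha> |\<alpha>. int (\<Sum>i\<in>UNIV. \<alpha> i) = m}"
    by (auto simp: le_less)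
  then show ?thesis
    using assms unfolding poly_space_def hom_poly_space_def
    by (auto simp: span_Un)
qed

section \<open>Differentiation of polynomial fields\<close>

text \<open>Forgets the degree: the rules of differentiation and continuity only need that some
  bound exists.\<close>

definition polynomials :: "scalar_field set" where
  "polynomials = (\<Union>m. poly_space m)"

definition vec_polynomials :: "vector_field set" where
  "vec_polynomials = {u. \<forall>i. (\<lambda>x. u x $ i) \<in> polynomials}"

lemma poly_space_polynomials: "p \<in> poly_space m \<Longrightarrow> p \<in> polynomials"
  by (auto simp: polynomials_def)

lemma polynomials_common_degree:
  assumes "p \<in> polynomials" "q \<in> polynomials"
  obtains m where "p \<in> poly_space m" "q \<in> poly_space m"
proof -
  obtain a b where "p \<in> poly_space a" "q \<in> poly_space b" using assms by (auto simp: polynomials_def)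
  then have "p \<in> poly_space (max a b)" "q \<in> poly_space (max a b)"
    using poly_space_mono[of a "max a b"] poly_space_mono[of b "max a b"] by auto
  then show ?thesis using that by blast
qed

lemma polynomials_add: "p \<in> polynomials \<Longrightarrow> q \<in> polynomials \<Longrightarrow> (\<lambda>x. p x + q x) \<in> polynomials"
  by (erule (1) polynomials_common_degree) (rule poly_space_polynomials[OF poly_space_add])

lemma polynomials_diff: "p \<in> polynomials \<Longrightarrow> q \<in> polynomials \<Longrightarrow> (\<lambda>x. p x - q x) \<in> polynomials"
  by (erule (1) polynomials_common_degree) (rule poly_space_polynomials[OF poly_space_diff])

lemma polynomials_mult: "p \<in> polynomials \<Longrightarrow> q \<in> polynomials \<Longrightarrow> (\<lambda>x. p x * q x) \<in> polynomials"
  by (erule (1) polynomials_common_degree) (rule poly_space_polynomials[OF poly_space_mult])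

lemma polynomials_const: "(\<lambda>_. c) \<in> polynomials"
  by (rule poly_space_polynomials[OF poly_space_const[of 0]]) simp

lemma polynomials_coordinate: "(\<lambda>x. x $ i) \<in> polynomials"
  by (rule poly_space_polynomials[OF poly_space_coordinate[of 1]]) simp

lemma polynomials_sum: "(\<And>i. i \<in> A \<Longrightarrow> p i \<in> polynomials) \<Longrightarrow> (\<lambda>x. \<Sum>i\<in>A. p i x) \<in> polynomials"
  by (induction A rule: infinite_finite_induct) (simp_all add: polynomials_const polynomials_add)

lemma vec_poly_space_polynomials: "u \<in> vec_poly_space m \<Longrightarrow> u \<in> vec_polynomials"
  unfolding vec_poly_space_def vec_polynomials_def
  by (intro CollectI allI) (rule poly_space_polynomials, blast)

lemma grad_eqI:
  assumes "(p has_derivative (\<lambda>h. g \<bullet> h)) (at x)"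
  shows "grad p x = g"
  unfolding grad_def frechet_derivative_at[OF assms, symmetric] by (simp add: inner_axis)

text \<open>\<open>grad\<close> is defined by \<open>frechet_derivative\<close>, so
  differentiability must be known before anything can be said about it. The induction produces the
  derivative and its degree bound together.\<close>

lemma poly_space_grad_aux:
  "p \<in> poly_space m \<Longrightarrow>
    \<exists>g. g \<in> vec_poly_space (m - 1) \<and> (\<forall>x. (p has_derivative (\<lambda>h. g x \<bullet> h)) (at x))"
proof (induction rule: poly_space_induct)
  case (zero m)
  then show ?case
    by (intro exI[of _ "\<lambda>_. 0"]) (simp add: vec_poly_space_def poly_space_zero zero_fun_def)
next
  case (add m p q)
  then obtain g h where g: "g \<in> vec_poly_space (m - 1)" "h \<in> vec_poly_space (m - 1)"
    "\<And>x. (p has_derivative (\<lambda>h. g x \<bullet> h)) (at x)" "\<And>x. (q has_derivative (\<lambda>k. h x \<bullet> k)) (at x)" by blast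
  have "((p + q) has_derivative (\<lambda>k. (g x + h x) \<bullet> k)) (at x)" for x
    using has_derivative_add[OF g(3,4)[of x]] by (simp add: plus_fun_def inner_add_left[abs_def])
  then show ?case using g(1,2)
    by (intro exI[of _ "\<lambda>x. g x + h x"] conjI allI) (auto simp add: vec_poly_space_def poly_space_add simp del: plus_fun_apply)
next
  case (scale m c p)
  then obtain g where g: "g \<in> vec_poly_space (m - 1)"
    "\<And>x. (p has_derivative (\<lambda>h. g x \<bullet> h)) (at x)" by blast
  have "((c *\<^sub>R p) has_derivative (\<lambda>k. (c *\<^sub>R g x) \<bullet> k)) (at x)" for x
    using has_derivative_mult_right[OF g(2)[of x], of c] by (simp add: scaleR_fun_def)
  then show ?case using g(1)
    by (intro exI[of _ "\<lambda>x. c *\<^sub>R g x"])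
      (simp add: vec_poly_space_def poly_space_cmult del: scaleR_fun_apply)
next
  case (one m)
  then show ?case
    by (intro exI[of _ "\<lambda>_. 0"]) (simp add: vec_poly_space_def poly_space_zero)
next
  case (mult m p i)
  then obtain g where g: "g \<in> vec_poly_space (m - 1)"
    "\<And>x. (p has_derivative (\<lambda>h. g x \<bullet> h)) (at x)" by blast
  have "((\<lambda>x. x $ i * p x) has_derivative (\<lambda>k. (x $ i *\<^sub>R g x + p x *\<^sub>R axis i 1) \<bullet> k)) (at x)" for x
  proof -
    have "((\<lambda>x. x $ i) has_derivative (\<lambda>k. k $ i)) (at x)"
      by (rule bounded_linear_imp_has_derivative[OF bounded_linear_vec_nth])
    from has_derivative_mult[OF this g(2)[of x]] show ?thesis
      by (simp add: inner_add_left inner_axis' mult.commute)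
  qed
  moreover have "(\<lambda>x. x $ i *\<^sub>R g x + p x *\<^sub>R axis i 1) \<in> vec_poly_space (m + 1 - 1)"
    unfolding vec_poly_space_def
  proof (intro CollectI allI)
    fix j
    have "(\<lambda>x. x $ i * g x $ j) \<in> poly_space m"
      using poly_space_coordinate_mult[of "\<lambda>x. g x $ j" "m - 1" i] g(1) by (simp add: vec_poly_space_def)
    from poly_space_add[OF this poly_space_cmult[OF mult(1), of "axis i 1 $ j"]]
    show "(\<lambda>x. (x $ i *\<^sub>R g x + p x *\<^sub>R axis i 1) $ j) \<in> poly_space (m + 1 - 1)"
      by (simp add: mult.commute)
  qed
  ultimately show ?case by blast
qed

lemma poly_space_grad: "p \<in> poly_space m \<Longrightarrow> grad p \<in> vec_poly_space (m - 1)"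
proof -
  assume "p \<in> poly_space m"
  then obtain g where g: "g \<in> vec_poly_space (m - 1)" "\<And>x. (p has_derivative (\<lambda>h. g x \<bullet> h)) (at x)"
    using poly_space_grad_aux by blast
  then have "grad p = g" by (intro ext grad_eqI)
  then show ?thesis using g by simp
qed

lemma polynomials_has_derivative:
  assumes "p \<in> polynomials"
  shows "(p has_derivative (\<lambda>h. grad p x \<bullet> h)) (at x)"
proof -
  obtain g where "\<And>x. (p has_derivative (\<lambda>h. g x \<bullet> h)) (at x)"
    using poly_space_grad_aux assms unfolding polynomials_def by blast
  then show ?thesis using grad_eqI by metis
qed

lemma polynomials_grad: "p \<in> polynomials \<Longrightarrow> (\<lambda>x. grad p x $ i) \<in> polynomials"
  using poly_space_grad unfolding polynomials_def vec_poly_space_def by blast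

lemma polynomials_continuous: "p \<in> polynomials \<Longrightarrow> continuous_on S p"
  by (meson continuous_at_imp_continuous_on has_derivative_continuous polynomials_has_derivative)

lemma vec_polynomials_continuous: "u \<in> vec_polynomials \<Longrightarrow> continuous_on S u"
  using polynomials_continuous unfolding vec_polynomials_def
  by (subst continuous_on_componentwise) (auto simp: Basis_vec_def inner_axis)

lemma grad_add: "p \<in> polynomials \<Longrightarrow> q \<in> polynomials \<Longrightarrow>
    grad (\<lambda>x. p x + q x) x = grad p x + grad q x"
  using has_derivative_add[OF polynomials_has_derivative[of p x] polynomials_has_derivative[of q x]]
  by (intro grad_eqI) (simp add: inner_add_left)

lemma grad_diff: "p \<in> polynomials \<Longrightarrow> q \<in> polynomials \<Longrightarrow>
    grad (\<lambda>x. p x - q x) x = grad p x - grad q x"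
  using has_derivative_diff[OF polynomials_has_derivative[of p x] polynomials_has_derivative[of q x]]
  by (intro grad_eqI) (simp add: inner_diff_left)

lemma grad_mult: "p \<in> polynomials \<Longrightarrow> q \<in> polynomials \<Longrightarrow>
    grad (\<lambda>x. p x * q x) x = p x *\<^sub>R grad q x + q x *\<^sub>R grad p x"
  using has_derivative_mult[OF polynomials_has_derivative[of p x] polynomials_has_derivative[of q x]]
  by (intro grad_eqI) (simp add: inner_add_left mult.commute)

lemma grad_const: "grad (\<lambda>_. c) x = 0"
  by (intro grad_eqI) simp

lemma grad_cmult: "p \<in> polynomials \<Longrightarrow> grad (\<lambda>x. c * p x) x = c *\<^sub>R grad p x"
  using grad_mult[OF polynomials_const, of p c x] by (simp add: grad_const)

lemma grad_coordinate: "grad (\<lambda>x. x $ i) x = axis i 1"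
  using bounded_linear_imp_has_derivative[OF bounded_linear_vec_nth[of i], of "at x"]
  by (intro grad_eqI) (simp add: inner_axis')

lemma linear_on_space_grad: "linear_on_space (poly_space m) grad"
  unfolding linear_on_space_def
proof (intro conjI ballI allI)
  fix p q c assume "p \<in> poly_space m" "q \<in> poly_space m"
  then have p: "p \<in> polynomials" "q \<in> polynomials" by (auto intro: poly_space_polynomials)
  show "grad (p + q) = grad p + grad q"
    using grad_add[OF p] by (auto simp: plus_fun_def)
next
  fix c p assume "p \<in> poly_space m"
  then have p: "p \<in> polynomials" by (auto intro: poly_space_polynomials)
  show "grad (c *\<^sub>R p) = c *\<^sub>R grad p"
    using grad_cmult[OF p, of c] by (auto simp: scaleR_fun_def)
qed

section \<open>Divergence and curl in components\<close>

lemma jacobian_component: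
  assumes "u \<in> vec_polynomials"
  shows "jacobian u (at x) $ i $ j = grad (\<lambda>x. u x $ i) x $ j"
proof -
  have u: "(\<lambda>x. u x $ i) \<in> polynomials" for i using assms by (simp add: vec_polynomials_def)
  have "(u has_derivative (\<lambda>h. \<chi> i. grad (\<lambda>x. u x $ i) x \<bullet> h)) (at x)"
    using polynomials_has_derivative[OF u]
    by (subst has_derivative_componentwise_within) (auto simp: Basis_vec_def inner_axis)
  then have "frechet_derivative u (at x) = (\<lambda>h. \<chi> i. grad (\<lambda>x. u x $ i) x \<bullet> h)"
    by (rule frechet_derivative_at[symmetric])
  then show ?thesis by (simp add: jacobian_def matrix_def inner_axis)
qed

lemma divergence_eq:
  "u \<in> vec_polynomials \<Longrightarrow> divergence u x = (\<Sum>i\<in>UNIV. grad (\<lambda>x. u x $ i) x $ i)"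
  by (simp add: divergence_def trace_def jacobian_component)

lemma divergence_space:
  assumes "u \<in> vec_poly_space m"
  shows "divergence u \<in> poly_space (m - 1)"
proof -
  have "divergence u = (\<lambda>x. \<Sum>i\<in>UNIV. grad (\<lambda>x. u x $ i) x $ i)"
    using divergence_eq[OF vec_poly_space_polynomials[OF assms]] by blast
  then show ?thesis using assms poly_space_grad
    by (auto simp: vec_poly_space_def intro!: poly_space_sum)
qed

lemma divergence_polynomials: "u \<in> vec_polynomials \<Longrightarrow> divergence u \<in> polynomials"
  using divergence_eq[of u] by (subst ext[of "divergence u"], assumption)
    (simp add: polynomials_sum polynomials_grad vec_polynomials_def)

lemma vec_polynomials_add: "u \<in> vec_polynomials \<Longrightarrow> w \<in> vec_polynomials \<Longrightarrow> (\<lambda>x. u x + w x) \<in> vec_polynomials"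
  by (simp add: vec_polynomials_def polynomials_add)

lemma vec_polynomials_cmult: "u \<in> vec_polynomials \<Longrightarrow> (\<lambda>x. c *\<^sub>R u x) \<in> vec_polynomials"
  by (simp add: vec_polynomials_def polynomials_mult polynomials_const)

lemma vec_polynomials_scale: "q \<in> polynomials \<Longrightarrow> u \<in> vec_polynomials \<Longrightarrow> (\<lambda>x. q x *\<^sub>R u x) \<in> vec_polynomials"
  by (simp add: vec_polynomials_def polynomials_mult)

lemma vec_polynomials_id: "(\<lambda>x. x) \<in> vec_polynomials"
  by (simp add: vec_polynomials_def polynomials_coordinate)

lemma vec_polynomials_const: "(\<lambda>x. c) \<in> vec_polynomials"
  by (simp add: vec_polynomials_def polynomials_const)

lemma divergence_add: "u \<in> vec_polynomials \<Longrightarrow> w \<in> vec_polynomials \<Longrightarrow>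
    divergence (\<lambda>x. u x + w x) x = divergence u x + divergence w x"
  by (simp add: divergence_eq vec_polynomials_add) (simp add: vec_polynomials_def grad_add sum.distrib)

lemma divergence_cmult: "u \<in> vec_polynomials \<Longrightarrow>
    divergence (\<lambda>x. c *\<^sub>R u x) x = c * divergence u x"
  by (simp add: divergence_eq vec_polynomials_cmult)
    (simp add: vec_polynomials_def grad_cmult sum_distrib_left)

lemma divergence_scale: "q \<in> polynomials \<Longrightarrow> u \<in> vec_polynomials \<Longrightarrow>
    divergence (\<lambda>x. q x *\<^sub>R u x) x = q x * divergence u x + u x \<bullet> grad q x"
  by (simp add: divergence_eq vec_polynomials_scale)
    (simp add: vec_polynomials_def grad_mult sum_distrib_left sum.distrib inner_vec_def)

lemma divergence_id: "divergence (\<lambda>x. x) x = 3"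
  by (simp add: divergence_eq vec_polynomials_id grad_coordinate)

lemma divergence_const: "divergence (\<lambda>x. c) x = 0"
  by (simp add: divergence_eq vec_polynomials_const grad_const)

lemma linear_on_space_divergence:
  assumes "S \<subseteq> vec_polynomials"
  shows "linear_on_space S divergence"
  unfolding linear_on_space_def
proof (intro conjI ballI allI)
  fix u w assume "u \<in> S" "w \<in> S"
  then show "divergence (u + w) = divergence u + divergence w"
    using divergence_add[of u w] assms by (auto simp: plus_fun_def)
next
  fix c u assume "u \<in> S"
  then show "divergence (c *\<^sub>R u) = c *\<^sub>R divergence u"
    using divergence_cmult[of u c] assms by (auto simp: scaleR_fun_def)
qed

lemma curl_components:
  assumes "u \<in> vec_polynomials"
  shows "curl u x $ 1 = grad (\<lambda>x. u x $ 3) x $ 2 - grad (\<lambda>x. u x $ 2) x $ 3"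
    "curl u x $ 2 = grad (\<lambda>x. u x $ 1) x $ 3 - grad (\<lambda>x. u x $ 3) x $ 1"
    "curl u x $ 3 = grad (\<lambda>x. u x $ 2) x $ 1 - grad (\<lambda>x. u x $ 1) x $ 2"
  using assms by (simp_all add: curl_def Let_def jacobian_component)

lemma curl_space:
  assumes "u \<in> vec_poly_space m"
  shows "curl u \<in> vec_poly_space (m - 1)"
proof -
  have u: "(\<lambda>x. grad (\<lambda>x. u x $ i) x $ j) \<in> poly_space (m - 1)" for i j
    using assms poly_space_grad by (auto simp: vec_poly_space_def)
  show ?thesis
    unfolding vec_poly_space_def forall_3
    using curl_components[OF vec_poly_space_polynomials[OF assms]]
    by (simp add: u poly_space_diff)
qed

lemma linear_on_space_curl:
  assumes "S \<subseteq> vec_polynomials"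
  shows "linear_on_space S curl"
  unfolding linear_on_space_def
proof (intro conjI ballI allI)
  fix u w assume "u \<in> S" "w \<in> S"
  then have "u \<in> vec_polynomials" "w \<in> vec_polynomials" using assms by auto
  then show "curl (u + w) = curl u + curl w"
    by (auto simp: plus_fun_def fun_eq_iff vec_eq_iff forall_3 curl_components vec_polynomials_add)
      (simp_all add: vec_polynomials_def grad_add)
next
  fix c u assume "u \<in> S"
  then have "u \<in> vec_polynomials" using assms by auto
  then show "curl (c *\<^sub>R u) = c *\<^sub>R curl u"
    by (auto simp: scaleR_fun_def fun_eq_iff vec_eq_iff forall_3 curl_components vec_polynomials_cmult)
      (simp_all add: vec_polynomials_def grad_cmult right_diff_distrib)
qed

text \<open>Symmetry of second derivatives is algebraic for polynomials: by the product rule,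
  multiplication by a coordinate preserves it.\<close>

lemma grad_commute:
  assumes "p \<in> poly_space m"
  shows "grad (\<lambda>x. grad p x $ i) x $ j = grad (\<lambda>x. grad p x $ j) x $ i"
  using assms
proof (induction rule: poly_space_induct)
  case (zero m)
  show ?case by (simp add: grad_const zero_fun_def)
next
  case (add m p q)
  then show ?case
    by (simp add: plus_fun_def grad_add poly_space_polynomials polynomials_grad)
next
  case (scale m c p)
  then show ?case
    by (simp add: scaleR_fun_def grad_cmult poly_space_polynomials polynomials_grad)
next
  case (one m)
  show ?case by (simp add: grad_const)
next
  case (mult m p k)
  then show ?case
    by (simp add: grad_mult grad_add grad_const grad_coordinate poly_space_polynomials polynomials_grad
      polynomials_coordinate polynomials_const polynomials_mult polynomials_add axis_def)
qed

lemma divergence_curl: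
  assumes "u \<in> vec_poly_space m"
  shows "divergence (curl u) = 0"
proof
  fix x
  have u: "u \<in> vec_polynomials" using assms vec_poly_space_polynomials by blast
  have 1: "(\<lambda>x. grad (\<lambda>x. u x $ i) x $ j) \<in> polynomials" for i j
    using u by (simp add: vec_polynomials_def polynomials_grad)
  have "(\<lambda>x. u x $ i) \<in> poly_space m" for i using assms by (simp add: vec_poly_space_def)
  note c = grad_commute[OF this]
  have "curl u \<in> vec_polynomials" using curl_space[OF assms] vec_poly_space_polynomials by blast
  then show "divergence (curl u) x = 0 x"
    by (simp add: divergence_eq sum_3 curl_components[OF u] grad_diff 1)
      (simp add: c[of 3 2 x 1] c[of 1 3 x 2] c[of 2 1 x 3])
qed

section \<open>Homogeneous fields, the curl and the Poincare operator\<close>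

lemma euler_identity:
  "p \<in> hom_poly_space m \<Longrightarrow> x \<bullet> grad p x = of_int m * p x"
proof (induction rule: hom_poly_space_induct)
  case (zero m)
  show ?case by (simp add: grad_const zero_fun_def)
next
  case (add m p q)
  then have "p \<in> polynomials" "q \<in> polynomials"
    using hom_poly_space_subset poly_space_polynomials by blast+
  then show ?case using add by (simp add: plus_fun_def grad_add inner_add_right distrib_left)
next
  case (scale m c p)
  then have "p \<in> polynomials" using hom_poly_space_subset poly_space_polynomials by blast
  then show ?case using scale by (simp add: scaleR_fun_def grad_cmult)
next
  case one
  show ?case by (simp add: grad_const)
next
  case (mult m p i)
  then have "p \<in> polynomials" using hom_poly_space_subset poly_space_polynomials by blast
  then show ?case
    using mult by (simp add: grad_mult polynomials_coordinate grad_coordinate inner_add_right inner_axis algebra_simps)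
qed

lemma subspace_vec_poly_space: "subspace (vec_poly_space m)"
  using subspace_poly_space[of m]
  by (auto simp: subspace_def vec_poly_space_def zero_fun_def plus_fun_def scaleR_fun_def)

lemma subspace_vec_hom_poly_space: "subspace (vec_hom_poly_space m)"
  using subspace_hom_poly_space[of m]
  by (auto simp: subspace_def vec_hom_poly_space_def zero_fun_def plus_fun_def scaleR_fun_def)

lemma vec_poly_space_mono: "m \<le> n \<Longrightarrow> vec_poly_space m \<subseteq> vec_poly_space n"
  using poly_space_mono[of m n] by (auto simp: vec_poly_space_def)

lemma vec_hom_poly_space_subset: "vec_hom_poly_space m \<subseteq> vec_poly_space m"
  using hom_poly_space_subset[of m] by (auto simp: vec_poly_space_def vec_hom_poly_space_def)

lemma vec_poly_space_neg: "m < 0 \<Longrightarrow> vec_poly_space m = {0}"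
  by (auto simp: vec_poly_space_def poly_space_neg fun_eq_iff vec_eq_iff)

lemma S_space_subset: "S_space r \<subseteq> vec_poly_space r"
  using vec_hom_poly_space_subset by (auto simp: S_space_def)

lemma subspace_S_space: "subspace (S_space r)"
  using subspace_vec_hom_poly_space[of r]
  by (auto simp: subspace_def S_space_def inner_add_right)

lemma subspace_R_space: "subspace (R_space r)"
  unfolding R_space_def by (intro subspace_set_sum subspace_vec_poly_space subspace_S_space)

lemma R_space_subset: "R_space r \<subseteq> vec_poly_space r"
proof -
  have "a + b \<in> vec_poly_space r" if "a \<in> vec_poly_space (r - 1)" "b \<in> S_space r" for a b
    using that vec_poly_space_mono[of "r - 1" r] S_space_subset subspace_vec_poly_space
    by (intro subspace_add) auto
  then show ?thesis by (auto simp: R_space_def set_sum_def)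
qed

definition div_free :: "int \<Rightarrow> vector_field set" where
  "div_free m = {u \<in> vec_poly_space m. divergence u = 0}"

lemma vec_poly_space_decompose:
  assumes "u \<in> vec_poly_space m"
  shows "\<exists>q\<in>vec_poly_space (m - 1). \<exists>h\<in>vec_hom_poly_space m. u = q + h"
proof -
  have "\<forall>i. \<exists>q h. q \<in> poly_space (m - 1) \<and> h \<in> hom_poly_space m \<and> (\<lambda>x. u x $ i) = q + h"
    using assms poly_space_decompose unfolding vec_poly_space_def by blast
  then obtain q h where qh: "\<And>i. q i \<in> poly_space (m - 1)" "\<And>i. h i \<in> hom_poly_space m"
    "\<And>i. (\<lambda>x. u x $ i) = q i + h i" by metis
  have "u = (\<lambda>x. \<chi> i. q i x) + (\<lambda>x. \<chi> i. h i x)"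
    using fun_cong[OF qh(3)] by (auto simp: fun_eq_iff vec_eq_iff)
  then show ?thesis using qh(1,2)
    by (intro bexI[of _ "\<lambda>x. \<chi> i. q i x"] bexI[of _ "\<lambda>x. \<chi> i. h i x"])
      (simp_all add: vec_poly_space_def vec_hom_poly_space_def)
qed

lemma hom_grad:
  "p \<in> hom_poly_space m \<Longrightarrow> (\<lambda>x. grad p x $ j) \<in> hom_poly_space (m - 1)"
proof (induction rule: hom_poly_space_induct)
  case (zero m)
  show ?case using subspace_0[OF subspace_hom_poly_space] by (simp add: grad_const zero_fun_def)
next
  case (add m p q)
  then have "p \<in> polynomials" "q \<in> polynomials"
    using hom_poly_space_subset poly_space_polynomials by blast+
  then show ?case using subspace_add[OF subspace_hom_poly_space add(3,4)]
    by (simp add: plus_fun_def grad_add)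
next
  case (scale m c p)
  then have "p \<in> polynomials" using hom_poly_space_subset poly_space_polynomials by blast
  then show ?case using subspace_scale[OF subspace_hom_poly_space scale(2), of c]
    by (simp add: scaleR_fun_def grad_cmult)
next
  case one
  show ?case using subspace_0[OF subspace_hom_poly_space] by (simp add: grad_const zero_fun_def)
next
  case (mult m p i)
  then have "p \<in> polynomials" using hom_poly_space_subset poly_space_polynomials by blast
  then show ?case
    using subspace_add[OF subspace_hom_poly_space hom_poly_space_coordinate_mult[OF mult(2), of i]
        subspace_scale[OF subspace_hom_poly_space, of p _ "axis i 1 $ j"]] mult(1)
    by (simp add: grad_mult polynomials_coordinate grad_coordinate plus_fun_def scaleR_fun_def mult.commute add.commute)
qed

lemma hom_divergence:
  assumes "u \<in> vec_hom_poly_space m"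
  shows "divergence u \<in> hom_poly_space (m - 1)"
proof -
  have "u \<in> vec_polynomials"
    using assms vec_hom_poly_space_subset vec_poly_space_polynomials by blast
  then have "divergence u = (\<Sum>i\<in>UNIV. (\<lambda>x. grad (\<lambda>x. u x $ i) x $ i))"
    by (simp add: fun_eq_iff divergence_eq sum_fun_apply)
  then show ?thesis using assms hom_grad
    by (auto simp: vec_hom_poly_space_def intro!: subspace_sum[OF subspace_hom_poly_space])
qed

text \<open>The cross product with the position vector raises the degree by one and is orthogonal to
  the position. These fields serve as vector potentials in the homogeneous part of
  \<open>R_space\<close>.\<close>

lemma hom_cross_position:
  assumes "w \<in> vec_hom_poly_space m"
  shows "(\<lambda>x. c *\<^sub>R cross3 (w x) x) \<in> S_space (m + 1)"
proof -
  have w: "(\<lambda>x. w x $ i) \<in> hom_poly_space m" for i using assms by (simp add: vec_hom_poly_space_def)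
  have "(\<lambda>x. c * (w x $ i * x $ j - w x $ j * x $ i)) \<in> hom_poly_space (m + 1)" for i j
    using subspace_scale[OF subspace_hom_poly_space subspace_diff[OF subspace_hom_poly_space
        hom_poly_space_coordinate_mult[OF w[of i], of j] hom_poly_space_coordinate_mult[OF w[of j], of i]], of c]
    by (simp add: scaleR_fun_def minus_apply[abs_def] mult.commute fun_diff_def)
  then show ?thesis
    by (simp add: S_space_def vec_hom_poly_space_def forall_3 dot_cross_self) (simp add: cross3_def)
qed

text \<open>The curl of w \<times> x is w div x - x div w + (x . grad) w - (w . grad) x, which for
  \<open>w\<close> homogeneous of degree m equals (3 + m - 1) w - x div w. This is the origin of the
  constant 1 / (m + 2).\<close>

lemma curl_cross_position:
  assumes w: "w \<in> vec_hom_poly_space m" "divergence w = 0" and m: "m \<ge> 0"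
  shows "curl (\<lambda>x. (1 / of_int (m + 2)) *\<^sub>R cross3 (w x) x) = w"
proof
  fix x :: "real^3"
  define c :: real where "c = 1 / of_int (m + 2)"
  have p: "(\<lambda>x. w x $ i) \<in> polynomials" for i
    using w vec_hom_poly_space_subset vec_poly_space_polynomials unfolding vec_polynomials_def by blast
  have u: "(\<lambda>x. c *\<^sub>R cross3 (w x) x) \<in> vec_polynomials"
    using hom_cross_position[OF w(1)] S_space_subset vec_poly_space_polynomials by blast
  have "w \<in> vec_polynomials" using p by (simp add: vec_polynomials_def)
  then have div: "grad (\<lambda>x. w x $ 1) x $ 1 + grad (\<lambda>x. w x $ 2) x $ 2 + grad (\<lambda>x. w x $ 3) x $ 3 = 0"
    using fun_cong[OF w(2), of x] by (simp add: divergence_eq sum_3)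
  have eu: "x $ 1 * grad (\<lambda>x. w x $ i) x $ 1 + x $ 2 * grad (\<lambda>x. w x $ i) x $ 2
      + x $ 3 * grad (\<lambda>x. w x $ i) x $ 3 = of_int m * w x $ i" for i
    using euler_identity[of "\<lambda>x. w x $ i" m x] w(1)
    by (simp add: vec_hom_poly_space_def inner_vec_def sum_3)
  have c: "c * (of_int m + 2) = 1" using m by (simp add: c_def)
  have ax: "(axis i (1::real) :: real^3) $ j = (if j = i then 1 else 0)" for i j
    by (simp add: axis_def)
  have "curl (\<lambda>x. c *\<^sub>R cross3 (w x) x) x $ i = w x $ i" for i
  proof -
    have "\<forall>i. curl (\<lambda>x. c *\<^sub>R cross3 (w x) x) x $ i = c * (2 * w x $ i + of_int m * w x $ i
       - x $ i * (grad (\<lambda>x. w x $ 1) x $ 1 + grad (\<lambda>x. w x $ 2) x $ 2 + grad (\<lambda>x. w x $ 3) x $ 3))"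
      unfolding forall_3 curl_components[OF u]
      by (simp add: cross3_def grad_cmult grad_diff grad_mult p polynomials_mult polynomials_diff
          polynomials_coordinate grad_coordinate ax flip: eu) (simp add: algebra_simps)
    then have "curl (\<lambda>x. c *\<^sub>R cross3 (w x) x) x $ i = c * (of_int m + 2) * w x $ i"
      unfolding div by (simp add: algebra_simps)
    then show ?thesis unfolding c by simp
  qed
  then have "curl (\<lambda>x. c *\<^sub>R cross3 (w x) x) x = w x" by (simp add: vec_eq_iff)
  then show "curl (\<lambda>x. (1 / of_int (m + 2)) *\<^sub>R cross3 (w x) x) x = w x" by (simp add: c_def)
qed

text \<open>Induction on the degree: the top homogeneous part of a divergence-free field is itself
  divergence-free, since its divergence and that of the remainder live in different degrees.\<close>

lemma div_free_subset_curl: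
  "w \<in> div_free m \<Longrightarrow> w \<in> curl ` R_space (m + 1)"
proof (induction "nat (m + 1)" arbitrary: m w rule: less_induct)
  case less
  show ?case
  proof (cases "m < 0")
    case True
    then have "w = 0" using less.prems vec_poly_space_neg by (auto simp: div_free_def)
    moreover have "curl 0 = 0"
      using linear_on_space_0[OF linear_on_space_curl subspace_R_space, of 1] R_space_subset vec_poly_space_polynomials
      by blast
    ultimately show ?thesis using subspace_0[OF subspace_R_space] by (metis image_eqI)
  next
    case False
    obtain q h where qh: "q \<in> vec_poly_space (m - 1)" "h \<in> vec_hom_poly_space m" "w = q + h"
      using vec_poly_space_decompose less.prems unfolding div_free_def by blast
    have vp: "q \<in> vec_polynomials" "h \<in> vec_polynomials"
      using qh vec_hom_poly_space_subset vec_poly_space_polynomials by blast+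
    then have "divergence q + divergence h = 0"
      using less.prems linear_on_space_divergence[of "{q, h}"] unfolding qh(3) div_free_def linear_on_space_def by simp
    then have "divergence h = - divergence q" by (simp add: add_eq_0_iff2)
    moreover have "- divergence q \<in> poly_space (m - 2)"
      using subspace_neg[OF subspace_poly_space divergence_space[OF qh(1)]] by simp
    ultimately have h0: "divergence h = 0"
      using hom_divergence[OF qh(2)] by (intro hom_poly_space_lower_degree[of _ "m - 1" "m - 2"]) auto
    then have "divergence q = 0" using \<open>divergence q + divergence h = 0\<close> by simp
    then have "q \<in> div_free (m - 1)" using qh by (simp add: div_free_def)
    then obtain a where a: "a \<in> R_space m" "q = curl a"
      using less.hyps[of "m - 1" q] False by auto
    define b where "b = (\<lambda>x. (1 / of_int (m + 2)) *\<^sub>R cross3 (h x) x)"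
    have b: "b \<in> S_space (m + 1)" "curl b = h"
      using hom_cross_position[OF qh(2)] curl_cross_position[OF qh(2) h0] False by (auto simp: b_def)
    have "a \<in> vec_poly_space m" using a R_space_subset by blast
    then have "a + b \<in> R_space (m + 1)" using b unfolding R_space_def set_sum_def by auto
    moreover have "curl (a + b) = w"
    proof -
      have "a \<in> vec_polynomials" "b \<in> vec_polynomials"
        using a b R_space_subset S_space_subset vec_poly_space_polynomials by blast+
      then show ?thesis
        using linear_on_space_curl[of "{a, b}"] a b unfolding linear_on_space_def qh(3) by simp
    qed
    ultimately show ?thesis by blast
  qed
qed

lemma curl_V_space: "curl ` V_space r = div_free (r - 1)"
proof
  show "curl ` V_space r \<subseteq> div_free (r - 1)"
    using R_space_subset curl_space divergence_curl unfolding V_space_def div_free_def by blast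
  show "div_free (r - 1) \<subseteq> curl ` V_space r"
    using div_free_subset_curl[of _ "r - 1"] unfolding V_space_def by auto
qed

text \<open>On a homogeneous polynomial p of degree d the operator gives p x / (d + 3), because t^(d
  + 2) has integral 1 / (d + 3) over the unit interval. By Euler's identity the divergence restores
  exactly the factor d + 3, so the operator is a right inverse of the divergence. The factor
  \<open>g\<close> records the degree of the resulting field.\<close>

lemma poincare_space:
  assumes "p \<in> poly_space m"
  shows "\<exists>g\<in>poly_space m. poincare p = (\<lambda>x. g x *\<^sub>R x) \<and> divergence (poincare p) = p"
proof -
  have int: "(\<lambda>t. (t\<^sup>2 * p (t *\<^sub>R x)) *\<^sub>R x) integrable_on {0..1}" if "p \<in> polynomials" for p and x :: "real^3"
    by (intro integrable_continuous_interval continuous_intros continuous_on_compose2[OF polynomials_continuous[OF that]]) auto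
  have hom: "\<exists>g\<in>hom_poly_space d. poincare p = (\<lambda>x. g x *\<^sub>R x) \<and> divergence (poincare p) = p"
    if p: "p \<in> hom_poly_space d" for p d
  proof (cases "p = 0")
    case True
    then have "poincare p = (\<lambda>x. 0 *\<^sub>R x)" by (simp add: poincare_def)
    then show ?thesis using True subspace_0[OF subspace_hom_poly_space]
      by (intro bexI[of _ 0]) (auto simp: divergence_const)
  next
    case False
    then have d: "d \<ge> 0" "\<And>t x. p (t *\<^sub>R x) = t ^ nat d * p x"
      using hom_poly_space_scaling[OF p] by blast+
    define g where "g = (\<lambda>x. (1 / (of_int d + 3)) * p x)"
    have "poincare p x = g x *\<^sub>R x" for x
    proof -
      have "((\<lambda>t. t ^ Suc k / real (Suc k)) has_real_derivative t ^ k) (at t within S)" for k and t :: real and S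
        using DERIV_cdivide[OF DERIV_pow[of "Suc k"], of "real (Suc k)"] by simp
      from fundamental_theorem_of_calculus[OF zero_le_one this[of "nat d + 2", unfolded has_real_derivative_iff_has_vector_derivative]]
      have "((\<lambda>t. t ^ (nat d + 2)) has_integral (1 / (of_int d + 3))) {0..1::real}"
        using d(1) by (simp add: add.commute)
      from has_integral_scaleR_left[OF has_integral_mult_left[OF this, of "p x"], of x]
      show ?thesis unfolding poincare_def g_def
        by (intro integral_unique) (simp add: d(2) power_add power2_eq_square mult_ac)
    qed
    then have g: "poincare p = (\<lambda>x. g x *\<^sub>R x)" by auto
    have pp: "p \<in> polynomials" using p hom_poly_space_subset poly_space_polynomials by blast
    then have gp: "g \<in> polynomials" unfolding g_def by (intro polynomials_mult polynomials_const)
    have "divergence (poincare p) x = p x" for x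
    proof -
      have "real_of_int d + 3 \<noteq> 0" using d(1) by linarith
      have "divergence (poincare p) x = g x * 3 + x \<bullet> grad g x"
        unfolding g by (simp add: divergence_scale gp vec_polynomials_id divergence_id)
      also have "x \<bullet> grad g x = of_int d * g x"
        unfolding g_def grad_cmult[OF pp] by (simp add: euler_identity[OF p])
      also have "g x * 3 + of_int d * g x = (of_int d + 3) * g x" by (simp add: distrib_right)
      also have "\<dots> = p x" using \<open>real_of_int d + 3 \<noteq> 0\<close> by (simp add: g_def)
      finally show ?thesis .
    qed
    moreover have "g \<in> hom_poly_space d"
      unfolding g_def using subspace_scale[OF subspace_hom_poly_space p, of "1 / (of_int d + 3)"] by (simp add: scaleR_fun_def)
    ultimately show ?thesis using g by blast
  qed
  show ?thesis using assms
  proof (induction "nat (m + 1)" arbitrary: m p rule: less_induct)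
    case less
    show ?case
    proof (cases "m < 0")
      case True
      then have "p \<in> hom_poly_space m" using less.prems subspace_0[OF subspace_hom_poly_space]
        by (auto simp: poly_space_neg)
      then show ?thesis using hom hom_poly_space_subset by blast
    next
      case False
      obtain q h where qh: "q \<in> poly_space (m - 1)" "h \<in> hom_poly_space m" "p = q + h"
        using poly_space_decompose less.prems by blast
      obtain a where a: "a \<in> poly_space (m - 1)" "poincare q = (\<lambda>x. a x *\<^sub>R x)" "divergence (poincare q) = q"
        using less.hyps[of "m - 1" q] qh False by auto
      obtain b where b: "b \<in> hom_poly_space m" "poincare h = (\<lambda>x. b x *\<^sub>R x)" "divergence (poincare h) = h"
        using hom[OF qh(2)] by blast
      have pol: "q \<in> polynomials" "h \<in> polynomials" "a \<in> poly_space m" "b \<in> poly_space m"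
        using qh a b poly_space_mono[of "m - 1" m] hom_poly_space_subset[of m] poly_space_polynomials by auto
      have "poincare p x = poincare q x + poincare h x" for x
        unfolding poincare_def qh(3) using integral_add[OF int[OF pol(1)] int[OF pol(2)], of x x]
        by (simp add: algebra_simps)
      then have pq: "poincare p = (\<lambda>x. poincare q x + poincare h x)" by auto
      have "divergence (poincare p) = p"
        unfolding pq using a b pol
        by (auto simp: fun_eq_iff divergence_add vec_polynomials_scale vec_polynomials_id poly_space_polynomials qh(3))
          (simp_all flip: a(2) b(2))
      moreover have "poincare p = (\<lambda>x. (a x + b x) *\<^sub>R x)"
        unfolding pq a b by (simp add: scaleR_add_left)
      ultimately show ?thesis using poly_space_add[OF pol(3,4)]
        by (intro bexI[of _ "\<lambda>x. a x + b x"]) auto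
    qed
  qed
qed

section \<open>Barycentric coordinates\<close>

lemma poly_space_1_affine:
  assumes "p \<in> poly_space 1"
  shows "\<exists>a c. \<forall>x. p x = a \<bullet> x + c"
proof -
  define A where "A = {p :: scalar_field. \<exists>a c. p = (\<lambda>x. a \<bullet> x + c)}"
  \<comment> \<open>The induction passes through all degrees, so the claim is stated for each of
    them: zero below 0, constants at 0, affine functions at 1, and no information above.\<close>
  define B where "B = (\<lambda>m::int. if m < 0 then {0} else if m = 0 then range (\<lambda>c. (\<lambda>_. c)) else if m = 1 then A else UNIV)"
  have A: "0 \<in> A" "\<And>p q. p \<in> A \<Longrightarrow> q \<in> A \<Longrightarrow> p + q \<in> A" "\<And>s p. p \<in> A \<Longrightarrow> s *\<^sub>R p \<in> A"
  proof -
    show "0 \<in> A" unfolding A_def by (rule CollectI, rule exI[of _ 0], rule exI[of _ 0]) (simp add: fun_eq_iff)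
    fix p q s assume "p \<in> A" 
    then obtain a c where p: "p = (\<lambda>x. a \<bullet> x + c)" by (auto simp: A_def)
    show "s *\<^sub>R p \<in> A" unfolding A_def
      by (rule CollectI, rule exI[of _ "s *\<^sub>R a"], rule exI[of _ "s * c"]) (simp add: fun_eq_iff p distrib_left)
    assume "q \<in> A"
    then obtain a' c' where q: "q = (\<lambda>x. a' \<bullet> x + c')" by (auto simp: A_def)
    show "p + q \<in> A" unfolding A_def
      by (rule CollectI, rule exI[of _ "a + a'"], rule exI[of _ "c + c'"]) (simp add: fun_eq_iff p q inner_add_left)
  qed
  have "p \<in> B m" if "p \<in> poly_space m" for m
    using that
  proof (induction rule: poly_space_induct)
    case (zero m)
    show ?case using A(1) by (auto simp: B_def zero_fun_def)
  next
    case (add m p q)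
    then show ?case using A(2) by (auto simp: B_def plus_fun_def split: if_splits)
  next
    case (scale m s p)
    then show ?case using A(3) by (auto simp: B_def scaleR_fun_def split: if_splits)
  next
    case (one m)
    have "(\<lambda>_. 1) \<in> A" unfolding A_def by (rule CollectI, rule exI[of _ 0], rule exI[of _ 1]) simp
    then show ?case using one by (auto simp: B_def)
  next
    case (mult m p i)
    have "(\<lambda>x. x $ i * c) \<in> A" for c
      unfolding A_def by (rule CollectI, rule exI[of _ "axis i c"], rule exI[of _ 0]) (simp add: inner_axis' mult.commute)
    then show ?case using mult(2) by (auto simp: B_def zero_fun_def split: if_splits)
  qed
  from this[OF assms] show ?thesis by (auto simp: B_def A_def)
qed

lemma poly_space_1_combination:
  assumes "p \<in> poly_space 1" "(\<Sum>i\<in>A. c i) = 1"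
  shows "p (\<Sum>i\<in>A. c i *\<^sub>R y i) = (\<Sum>i\<in>A. c i * p (y i))"
proof -
  obtain a b where p: "\<And>x. p x = a \<bullet> x + b" using poly_space_1_affine[OF assms(1)] by blast
  have "(\<Sum>i\<in>A. c i * p (y i)) = (\<Sum>i\<in>A. c i * (a \<bullet> y i)) + (\<Sum>i\<in>A. c i) * b"
    by (simp add: p distrib_left sum.distrib sum_distrib_right)
  then show ?thesis using assms(2) by (simp add: p inner_sum_right)
qed

lemma lessThan_4: "{..<4} = {0, 1, 2, 3 :: nat}"
  by auto

text \<open>Isolates what the geometric arguments use of the barycentric coordinates, so that
  neither the definite description in \<open>barycentric\<close> nor a basis of edge vectors appears
  in them.\<close>

locale tetrahedron =
  fixes v :: "nat \<Rightarrow> real^3" and lam :: "nat \<Rightarrow> scalar_field"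
  assumes lam_poly: "i < 4 \<Longrightarrow> lam i \<in> poly_space 1"
    and lam_sum: "(\<Sum>i<4. lam i x) = 1"
    and lam_point: "(\<Sum>i<4. lam i x *\<^sub>R v i) = x"
    and lam_vertex: "i < 4 \<Longrightarrow> j < 4 \<Longrightarrow> lam i (v j) = (if j = i then 1 else 0)"

text \<open>By affine independence the edge vectors from \<open>v 0\<close> form a basis; the
  coefficients of \<open>x - v 0\<close> in it are three of the coordinates, and the fourth
  completes the sum to one. The definite description is met because an affine function is determined
  by its values at the vertices.\<close>

lemma tetrahedron_barycentric:
  assumes "tetrahedron_vertices v"
  shows "tetrahedron v (barycentric v)"
proof -
  have inj: "inj_on v {..<4}" and aff: "\<not> affine_dependent (v ` {..<4})"
    using assms by (auto simp: tetrahedron_vertices_def)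
  have ne: "v i \<noteq> v j" if "i < 4" "j < 4" "i \<noteq> j" for i j
    using inj that by (auto simp: inj_on_def)
  have v0: "v 0 \<notin> v ` {1, 2, 3}" using ne[of 0 1] ne[of 0 2] ne[of 0 3] by auto
  define D where "D = (\<lambda>x. - v 0 + x) ` v ` {1, 2, 3}"
  have indD: "independent D"
    using aff affine_dependent_iff_dependent[OF v0] by (simp add: lessThan_4 D_def)
  have D: "D = {v 1 - v 0, v 2 - v 0, v 3 - v 0}" by (auto simp: D_def)
  have d: "v 1 - v 0 \<noteq> v 2 - v 0" "v 1 - v 0 \<noteq> v 3 - v 0" "v 2 - v 0 \<noteq> v 3 - v 0"
    using ne[of 1 2] ne[of 1 3] ne[of 2 3] by auto
  then have "card D = 3" by (simp add: D)
  then have spD: "span D = UNIV"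
    using card_ge_dim_independent[of D UNIV] indD by (auto simp: dim_UNIV)
  obtain g :: "real^3 \<Rightarrow> real^3" where g: "linear g"
    "g (v 1 - v 0) = axis 1 1" "g (v 2 - v 0) = axis 2 1" "g (v 3 - v 0) = axis 3 1"
    using linear_independent_extend[OF indD, of "\<lambda>y. if y = v 1 - v 0 then axis 1 1
      else if y = v 2 - v 0 then axis 2 1 else axis 3 1"] d by (auto simp: D)
  \<comment> \<open>\<open>h\<close> inverts \<open>g\<close> on the edge vectors and hence
    everywhere; it turns coordinates back into points.\<close>
  define h where "h y = y $ 1 *\<^sub>R (v 1 - v 0) + y $ 2 *\<^sub>R (v 2 - v 0) + y $ 3 *\<^sub>R (v 3 - v 0)" for y :: "real^3"
  have linh: "linear h" unfolding h_def by (intro linearI) (simp_all add: algebra_simps)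
  have hg: "(h \<circ> g) y = id y" for y
  proof (rule linear_eq_on_span[OF linear_compose[OF g(1) linh] linear_id])
    show "y \<in> span D" using spD by simp
    fix z assume "z \<in> D"
    then show "(h \<circ> g) z = id z" using g(2-4) by (auto simp: D h_def axis_def)
  qed
  define l where "l i x = (if i = 0 then 1 - g (x - v 0) $ 1 - g (x - v 0) $ 2 - g (x - v 0) $ 3
    else if i = 1 then g (x - v 0) $ 1 else if i = 2 then g (x - v 0) $ 2 else g (x - v 0) $ 3)"
    for i :: nat and x
  have gc: "(\<lambda>x. g (x - v 0) $ j) \<in> poly_space 1" for j
  proof -
    \<comment> \<open>The adjoint turns the linear functional into an inner product with a fixed
      vector, which is known to have degree one.\<close>
    have "x \<bullet> adjoint g (axis j 1) = g x $ j" for x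
      using adjoint_works[OF g(1)] by (simp add: inner_axis)
    then have "g (x - v 0) $ j = adjoint g (axis j 1) \<bullet> x - g (v 0) $ j" for x
      by (simp add: linear_diff[OF g(1)] inner_commute[of "adjoint g _"])
    then show ?thesis using poly_space_diff[OF poly_space_inner poly_space_const] by simp
  qed
  have l1: "l i \<in> poly_space 1" for i
    unfolding l_def using gc
    by (cases "i = 0"; cases "i = 1"; cases "i = 2") (auto intro!: poly_space_diff poly_space_const)
  have lsum: "(\<Sum>i<4. l i x) = 1" for x by (simp add: lessThan_4 l_def)
  have lpt: "(\<Sum>i<4. l i x *\<^sub>R v i) = x" for x
  proof -
    have "(\<Sum>i<4. l i x *\<^sub>R v i) = v 0 + h (g (x - v 0))"
      by (simp add: lessThan_4 l_def h_def algebra_simps)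
    then show ?thesis using hg[of "x - v 0"] by simp
  qed
  have lv: "l i (v j) = (if j = i then 1 else 0)" if "i < 4" "j < 4" for i j
    using that g linear_0[OF g(1)]
    by (auto simp: l_def axis_def less_Suc_eq numeral_eq_Suc)
  have "barycentric v i = l i" if "i < 4" for i
    unfolding barycentric_def
  proof (rule the_equality)
    show "l i \<in> poly_space 1 \<and> (\<forall>j<4. l i (v j) = (if j = i then 1 else 0))"
      using l1 lv that by auto
    fix p assume p: "p \<in> poly_space 1 \<and> (\<forall>j<4. p (v j) = (if j = i then 1 else 0))"
    have "p x = l i x" for x
    proof -
      have "p x = (\<Sum>j<4. l j x * p (v j))"
        using poly_space_1_combination[of p "\<lambda>j. l j x" "{..<4}" v] p lsum lpt by simp
      also have "\<dots> = (\<Sum>j<4. if j = i then l i x else 0)"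
        using p by (intro sum.cong) auto
      also have "\<dots> = l i x" using that by simp
      finally show ?thesis .
    qed
    then show "p = l i" by auto
  qed
  then show ?thesis using l1 lsum lpt lv
    by unfold_locales auto
qed

context tetrahedron
begin

lemma lam_combination:
  assumes "i < 4" "(\<Sum>j<4. c j) = 1"
  shows "lam i (\<Sum>j<4. c j *\<^sub>R v j) = c i"
proof -
  have "lam i (\<Sum>j<4. c j *\<^sub>R v j) = (\<Sum>j<4. c j * lam i (v j))"
    using poly_space_1_combination[OF lam_poly[OF assms(1)] assms(2)] .
  also have "\<dots> = (\<Sum>j<4. if j = i then c i else 0)"
    by (intro sum.cong) (auto simp: lam_vertex assms)
  finally show ?thesis using assms by simp
qed

lemma lam_polynomial: "i < 4 \<Longrightarrow> lam i \<in> polynomials"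
  using lam_poly poly_space_polynomials by blast

lemma lam_affine_line: "i < 4 \<Longrightarrow> lam i (x + t *\<^sub>R (y - z)) = lam i x + t * (lam i y - lam i z)"
  using poly_space_1_affine[OF lam_poly[of i]] by (auto simp: algebra_simps)

text \<open>Indexed by the coordinates that vanish rather than by the vertices that span: the empty
  set gives the whole tetrahedron, and inserting an index passes to a facet.\<close>

definition face_simplex :: "nat set \<Rightarrow> (real^3) set" where
  "face_simplex I = {x. (\<forall>i<4. 0 \<le> lam i x) \<and> (\<forall>i\<in>I. lam i x = 0)}"

lemma face_simplex_antimono: "I \<subseteq> J \<Longrightarrow> face_simplex J \<subseteq> face_simplex I"
  by (auto simp: face_simplex_def)

text \<open>A point whose coordinates outside \<open>A\<close> vanish is the convex combination of
  the vertices in \<open>A\<close> with its own coordinates as weights.\<close>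

lemma convex_hull_vertices:
  assumes "A \<subseteq> {..<4}"
  shows "convex hull (v ` A) = face_simplex ({..<4} - A)"
proof
  have line: "lam i (u *\<^sub>R x + w *\<^sub>R y) = u * lam i x + w * lam i y" if "i < 4" "u + w = 1" for i u w x y
  proof -
    have u: "u = 1 - w" using that by simp
    have "u *\<^sub>R x + w *\<^sub>R y = x + w *\<^sub>R (y - x)" by (simp add: u algebra_simps)
    then show ?thesis using lam_affine_line[OF that(1), of x w y x] by (simp add: u algebra_simps)
  qed
  have "convex (face_simplex ({..<4} - A))"
    by (rule convexI) (auto simp: face_simplex_def line)
  moreover have "v ` A \<subseteq> face_simplex ({..<4} - A)"
    using assms by (auto simp: face_simplex_def lam_vertex)
  ultimately show "convex hull (v ` A) \<subseteq> face_simplex ({..<4} - A)"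
    by (simp add: hull_minimal)
  show "face_simplex ({..<4} - A) \<subseteq> convex hull (v ` A)"
  proof
    fix x assume x: "x \<in> face_simplex ({..<4} - A)"
    have fin: "finite A" using assms finite_subset by blast
    have "(\<Sum>i\<in>A. lam i x *\<^sub>R v i) \<in> convex hull (v ` A)"
    proof (rule convex_sum[OF fin convex_convex_hull])
      have "(\<Sum>i\<in>A. lam i x) = (\<Sum>i<4. lam i x)"
        using assms x by (intro sum.mono_neutral_left) (auto simp: face_simplex_def)
      then show "(\<Sum>i\<in>A. lam i x) = 1" by (simp add: lam_sum)
    qed (use x assms in \<open>auto simp: face_simplex_def intro: hull_inc\<close>)
    moreover have "(\<Sum>i\<in>A. lam i x *\<^sub>R v i) = (\<Sum>i<4. lam i x *\<^sub>R v i)"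
      using assms x by (intro sum.mono_neutral_left) (auto simp: face_simplex_def)
    ultimately show "x \<in> convex hull (v ` A)" by (simp add: lam_point)
  qed
qed

lemma tetra_eq: "tetra v = face_simplex {}"
  unfolding tetra_def by (simp add: convex_hull_vertices)

definition barycenter :: "nat set \<Rightarrow> real^3" where
  "barycenter A = (\<Sum>j<4. (if j \<in> A then 1 / card A else 0) *\<^sub>R v j)"

lemma lam_barycenter:
  assumes "A \<subseteq> {..<4}" "A \<noteq> {}" "i < 4"
  shows "lam i (barycenter A) = (if i \<in> A then 1 / card A else 0)"
proof -
  have "finite A" using assms finite_subset by blast
  moreover have "(\<Sum>j<4. if j \<in> A then 1 / real (card A) else 0) = (\<Sum>j\<in>A. 1 / real (card A))"
    using assms by (intro sum.mono_neutral_cong_right) auto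
  ultimately have "(\<Sum>j<4. if j \<in> A then 1 / real (card A) else 0) = 1"
    using assms by (simp add: card_gt_0_iff)
  from lam_combination[OF assms(3) this] show ?thesis unfolding barycenter_def .
qed

text \<open>The coordinates in \<open>J\<close> are positive in the relative interior of the
  simplex, so \<open>q\<close> vanishes there. Boundary points are reached as limits along segments
  from the barycenter of the spanning vertices.\<close>

lemma face_simplex_cancel:
  assumes I: "I \<subseteq> {..<4}" "I \<noteq> {..<4}" and J: "J \<subseteq> {..<4} - I" and q: "q \<in> polynomials"
    and z: "\<And>x. x \<in> face_simplex I \<Longrightarrow> (\<Prod>l\<in>J. lam l x) * q x = 0" and x: "x \<in> face_simplex I"
  shows "q x = 0"
proof -
  define A where "A = {..<4} - I"
  have A: "A \<subseteq> {..<4}" "A \<noteq> {}" "finite A" using I by (auto simp: A_def)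
  then have cA: "card A > 0" by (simp add: card_gt_0_iff)
  define \<gamma> where "\<gamma> t = x + t *\<^sub>R (barycenter A - x)" for t
  have lg: "lam l (\<gamma> t) = (1 - t) * lam l x + t * (if l \<in> A then 1 / card A else 0)" if "l < 4" for l t
    unfolding \<gamma>_def lam_affine_line[OF that] lam_barycenter[OF A(1,2) that] by (simp add: algebra_simps)
  have zero: "q (\<gamma> t) = 0" if t: "t \<in> {0<..<1}" for t
  proof -
    have "\<gamma> t \<in> face_simplex I"
      using x t I A unfolding face_simplex_def by (auto simp: lg A_def)
    moreover have "lam l (\<gamma> t) > 0" if "l \<in> J" for l
      using that x t J A cA unfolding face_simplex_def
      by (auto simp: lg A_def subset_iff intro!: add_nonneg_pos)
    ultimately show ?thesis using z[of "\<gamma> t"] J finite_subset[OF J]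
      by (auto simp: less_le)
  qed
  have "continuous_on (closure {0<..<1}) (\<lambda>t. q (\<gamma> t))"
    unfolding \<gamma>_def
    by (rule continuous_on_compose2[OF polynomials_continuous[OF q, of UNIV]]) (auto intro!: continuous_intros)
  from continuous_constant_on_closure[OF this zero] have "q (\<gamma> 0) = 0" by simp
  then show ?thesis by (simp add: \<gamma>_def)
qed

text \<open>The projection goes along \<open>v j - v k\<close>: it transfers the whole weight of
  vertex \<open>j\<close> to vertex \<open>k\<close>, so the projected point keeps nonnegative
  coordinates and lies in the facet where \<open>lam j\<close> vanishes. This is why a second vertex
  \<open>k\<close> of the simplex is demanded.\<close>

lemma face_simplex_division:
  assumes p: "p \<in> poly_space m" and jk: "j < 4" "k < 4" "j \<noteq> k" "j \<notin> I" "k \<notin> I" "I \<subseteq> {..<4}"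
    and z: "\<And>x. x \<in> face_simplex (insert j I) \<Longrightarrow> p x = 0"
  shows "\<exists>q\<in>poly_space (m - 1). \<forall>x\<in>face_simplex I. p x = lam j x * q x"
proof -
  obtain q where q: "q \<in> poly_space (m - 1)"
    "\<And>x. p x - p (x - lam j x *\<^sub>R (v j - v k)) = lam j x * q x"
    using poly_space_affine_division[OF p lam_poly[OF jk(1)]] by blast
  have "p x = lam j x * q x" if x: "x \<in> face_simplex I" for x
  proof -
    have l: "lam i (x - lam j x *\<^sub>R (v j - v k)) = lam i x - lam j x * ((if j = i then 1 else 0) - (if k = i then 1 else 0))"
      if "i < 4" for i
      using lam_affine_line[OF that, of x "- lam j x" "v j" "v k"] jk that by (simp add: lam_vertex)
    have "- lam j x \<le> lam k x" "lam j x \<ge> 0" using x jk unfolding face_simplex_def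
      by (auto intro: order_trans[of _ 0])
    then have "x - lam j x *\<^sub>R (v j - v k) \<in> face_simplex (insert j I)"
      using x jk unfolding face_simplex_def by (auto simp: l subset_iff)
    then show ?thesis using z q(2)[of x] by simp
  qed
  then show ?thesis using q by blast
qed

text \<open>The coordinates are split off one at a time. Before \<open>lam j\<close> is divided out,
  the factors already found are cancelled on the facet where it vanishes. With at most two
  coordinates zero, this facet still has a vertex \<open>k\<close> towards which the division can
  project.\<close>

lemma face_simplex_bubble_division:
  assumes p: "p \<in> poly_space m" and I: "I \<subseteq> {..<4}" "card I \<le> 2"
    and z: "\<And>j x. j \<in> {..<4} - I \<Longrightarrow> x \<in> face_simplex (insert j I) \<Longrightarrow> p x = 0"
  shows "\<exists>q\<in>poly_space (m - int (4 - card I)). \<forall>x\<in>face_simplex I. p x = (\<Prod>j\<in>{..<4} - I. lam j x) * q x"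
proof -
  have finI: "finite I" using I finite_subset by blast
  have "\<exists>q\<in>poly_space (m - int (card J)). \<forall>x\<in>face_simplex I. p x = (\<Prod>j\<in>J. lam j x) * q x"
    if "J \<subseteq> {..<4} - I" for J
    using finite_subset[OF that finite_Diff[OF finite_lessThan]] that
  proof (induction J rule: finite_induct)
    case empty
    then show ?case using p by auto
  next
    case (insert j J)
    then obtain q where q: "q \<in> poly_space (m - int (card J))"
      "\<And>x. x \<in> face_simplex I \<Longrightarrow> p x = (\<Prod>j\<in>J. lam j x) * q x" by auto
    have j: "j < 4" "j \<notin> I" "J \<subseteq> {..<4} - I" "j \<notin> J" "finite J" using insert.hyps insert.prems by auto
    have "card (insert j I) \<noteq> card {..<4::nat}" using I(2) finI j(2) by simp
    then have ne: "insert j I \<noteq> {..<4}" by metis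
    have sub: "insert j I \<subseteq> {..<4}" using I(1) j(1) by simp
    then obtain k where k: "k < 4" "k \<notin> insert j I" using ne by blast
    have "q x = 0" if x: "x \<in> face_simplex (insert j I)" for x
    proof (rule face_simplex_cancel[OF sub ne _ poly_space_polynomials[OF q(1)] _ x])
      show "J \<subseteq> {..<4} - insert j I" using j(3,4) by blast
      fix y assume y: "y \<in> face_simplex (insert j I)"
      then have "p y = 0" using z[of j y] j(1,2) by blast
      moreover have "y \<in> face_simplex I" using y face_simplex_antimono[of I "insert j I"] by blast
      ultimately show "(\<Prod>l\<in>J. lam l y) * q y = 0" using q(2)[of y] by simp
    qed
    then obtain q' where q': "q' \<in> poly_space (m - int (card J) - 1)" "\<And>x. x \<in> face_simplex I \<Longrightarrow> q x = lam j x * q' x"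
      using face_simplex_division[OF q(1), of j k I] k j(1,2) I(1) by blast
    have "p x = (\<Prod>l\<in>insert j J. lam l x) * q' x" if "x \<in> face_simplex I" for x
      using q(2)[OF that] q'(2)[OF that] j(4,5) by (simp add: mult_ac)
    moreover have "q' \<in> poly_space (m - int (card (insert j J)))" using q'(1) j(4,5) by (simp add: algebra_simps)
    ultimately show ?case by blast
  qed
  from this[of "{..<4} - I"] show ?thesis using I finI by (simp add: card_Diff_subset)
qed

end

section \<open>Dimensions of polynomial spaces on subsimplices\<close>

lemma finite_bounded_exponents: "finite {\<alpha> :: 3 \<Rightarrow> nat. int (\<Sum>i\<in>UNIV. \<alpha> i) \<le> m}"
proof (rule finite_subset)
  show "{\<alpha> :: 3 \<Rightarrow> nat. int (\<Sum>i\<in>UNIV. \<alpha> i) \<le> m} \<subseteq> PiE UNIV (\<lambda>_. {..nat m})"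
  proof
    fix \<alpha> :: "3 \<Rightarrow> nat" assume "\<alpha> \<in> {\<alpha>. int (\<Sum>i\<in>UNIV. \<alpha> i) \<le> m}"
    then have s: "(\<Sum>i\<in>UNIV. \<alpha> i) \<le> nat m" by (simp del: of_nat_sum)
    have "\<alpha> j \<le> (\<Sum>i\<in>UNIV. \<alpha> i)" for j by (rule member_le_sum) auto
    then show "\<alpha> \<in> PiE UNIV (\<lambda>_. {..nat m})" using s order_trans by (auto simp: PiE_def extensional_def)
  qed
qed (simp add: finite_PiE)

lemma fin_dim_poly_space: "fin_dim (poly_space m)"
  unfolding poly_space_def setcompr_eq_image
  by (intro fin_dim_span finite_imageI finite_bounded_exponents)

definition restrict_field :: "(real^3) set \<Rightarrow> scalar_field \<Rightarrow> scalar_field" where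
  "restrict_field T p = (\<lambda>x. if x \<in> T then p x else 0)"

lemma poly_on_eq: "poly_on m T = restrict_field T ` poly_space m"
  by (simp add: poly_on_def restrict_field_def)

lemma linear_on_space_restrict_field: "linear_on_space S (restrict_field T)"
  by (simp add: linear_on_space_def restrict_field_def fun_eq_iff)

lemma subspace_poly_on: "subspace (poly_on m T)"
  unfolding poly_on_eq
  by (rule subspace_linear_on_space_image[OF subspace_poly_space linear_on_space_restrict_field])

lemma fin_dim_poly_on: "fin_dim (poly_on m T)"
  unfolding poly_on_eq
  by (rule fin_dim_image[OF subspace_poly_space linear_on_space_restrict_field fin_dim_poly_space])

lemma dim_zero_space: "dim {0::'a::real_vector} = 0"
  using dim_span_eq_card_independent[of "{} :: 'a set"] by (simp add: independent_empty)

lemma dim_poly_on_neg: "m < 0 \<Longrightarrow> dim (poly_on m T) = 0"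
proof -
  assume "m < 0"
  then have "poly_on m T = {0}" by (simp add: poly_on_eq poly_space_neg restrict_field_def zero_fun_def)
  then show ?thesis by (simp only: dim_zero_space)
qed

lemma dim_poly_on_point: "m \<ge> 0 \<Longrightarrow> dim (poly_on m {y}) = 1"
proof -
  assume "m \<ge> 0"
  define e :: scalar_field where "e = restrict_field {y} (\<lambda>_. 1)"
  have "poly_on m {y} = span {e}"
  proof
    show "poly_on m {y} \<subseteq> span {e}"
    proof
      fix f assume "f \<in> poly_on m {y}"
      then obtain p where "f = restrict_field {y} p" by (auto simp: poly_on_eq)
      then have "f = p y *\<^sub>R e" by (auto simp: e_def restrict_field_def fun_eq_iff)
      then show "f \<in> span {e}" by (auto simp: span_scale span_base)
    qed
    have "e \<in> poly_on m {y}"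
      unfolding e_def poly_on_eq using poly_space_one[OF \<open>m \<ge> 0\<close>] by blast
    then show "span {e} \<subseteq> poly_on m {y}" by (intro span_minimal subspace_poly_on) simp
  qed
  moreover have "e \<noteq> 0" by (auto simp: e_def restrict_field_def fun_eq_iff)
  then have "independent {e}" by simp
  then have "dim (span {e}) = card {e}" by (rule dim_span_eq_card_independent)
  ultimately show ?thesis by simp
qed

context tetrahedron
begin

lemma open_tetra_interior: "open {x. \<forall>i<4. lam i x > 0}"
proof -
  have "open (\<Inter>i\<in>{..<4}. {x. 0 < lam i x})"
  proof (rule open_INT[OF finite_lessThan], rule ballI)
    fix i :: nat assume "i \<in> {..<4}"
    then have "continuous_on UNIV (lam i)" by (simp add: polynomials_continuous lam_polynomial)
    then show "open {x. 0 < lam i x}" by (simp add: open_Collect_less continuous_on_const)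
  qed
  moreover have "(\<Inter>i\<in>{..<4}. {x. 0 < lam i x}) = {x. \<forall>i<4. lam i x > 0}" by auto
  ultimately show ?thesis by simp
qed

lemma polynomial_eq_0_on_tetra:
  assumes "p \<in> poly_space m" "\<And>x. x \<in> face_simplex {} \<Longrightarrow> p x = 0"
  shows "p = 0"
proof (rule poly_space_eq_0[OF assms(1) open_tetra_interior])
  show "barycenter {..<4} \<in> {x. \<forall>i<4. lam i x > 0}" by (auto simp: lam_barycenter lessThan_empty_iff)
  fix x assume "x \<in> {x. \<forall>i<4. lam i x > 0}"
  then have "x \<in> face_simplex {}" by (simp add: face_simplex_def less_imp_le)
  then show "p x = 0" by (rule assms(2))
qed

text \<open>Restriction to the facet \<open>lam j = 0\<close> is onto, and its kernel is \<open>lam j\<close> times the polynomials of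
  degree one less.\<close>

lemma dim_poly_on_step:
  assumes I: "I \<subseteq> {..<4}" "j < 4" "j \<notin> I" "k < 4" "k \<notin> insert j I"
  shows "dim (poly_on m (face_simplex I)) =
    dim (poly_on m (face_simplex (insert j I))) + dim (poly_on (m - 1) (face_simplex I))"
proof -
  let ?T = "face_simplex I" and ?T' = "face_simplex (insert j I)"
  define f where "f g = (\<lambda>x. lam j x * g x)" for g :: scalar_field
  have T: "?T' \<subseteq> ?T" using face_simplex_antimono[of I "insert j I"] by blast
  have "restrict_field ?T' (restrict_field ?T p) = restrict_field ?T' p" for p
    using T by (auto simp: restrict_field_def fun_eq_iff)
  then have im: "restrict_field ?T' ` poly_on m ?T = poly_on m ?T'"
    by (simp add: poly_on_eq image_image)
  have ker: "{g \<in> poly_on m ?T. restrict_field ?T' g = 0} = f ` poly_on (m - 1) ?T"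
  proof (intro equalityI subsetI)
    fix g assume "g \<in> {g \<in> poly_on m ?T. restrict_field ?T' g = 0}"
    then obtain p where p: "p \<in> poly_space m" "g = restrict_field ?T p" "restrict_field ?T' g = 0"
      by (auto simp: poly_on_eq)
    have "p x = 0" if "x \<in> ?T'" for x
      using fun_cong[OF p(3), of x] that T by (auto simp: restrict_field_def p(2))
    then obtain q where q: "q \<in> poly_space (m - 1)" "\<And>x. x \<in> ?T \<Longrightarrow> p x = lam j x * q x"
      using face_simplex_division[OF p(1), of j k I] I by blast
    have "g = f (restrict_field ?T q)"
      using q(2) by (auto simp: f_def p(2) restrict_field_def fun_eq_iff)
    then show "g \<in> f ` poly_on (m - 1) ?T" using q(1) by (auto simp: poly_on_eq)
  next
    fix g assume "g \<in> f ` poly_on (m - 1) ?T"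
    then obtain q where q: "q \<in> poly_space (m - 1)" "g = f (restrict_field ?T q)" by (auto simp: poly_on_eq)
    have "g = restrict_field ?T (\<lambda>x. lam j x * q x)" by (auto simp: q(2) f_def restrict_field_def fun_eq_iff)
    moreover have "(\<lambda>x. lam j x * q x) \<in> poly_space m"
      using poly_space_mult[OF lam_poly[OF I(2)] q(1)] by simp
    ultimately have "g \<in> poly_on m ?T" unfolding poly_on_eq by blast
    moreover have "restrict_field ?T' g = 0"
      by (auto simp: q(2) f_def restrict_field_def fun_eq_iff face_simplex_def)
    ultimately show "g \<in> {g \<in> poly_on m ?T. restrict_field ?T' g = 0}" by blast
  qed
  have "dim (f ` poly_on (m - 1) ?T) = dim (poly_on (m - 1) ?T)"
  proof (rule dim_inj_image[OF subspace_poly_on fin_dim_poly_on])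
    show "linear_on_space (poly_on (m - 1) ?T) f"
      by (simp add: linear_on_space_def f_def fun_eq_iff distrib_left)
    fix g assume "g \<in> poly_on (m - 1) ?T" and g0: "f g = 0"
    then obtain q where q: "q \<in> poly_space (m - 1)" "g = restrict_field ?T q" by (auto simp: poly_on_eq)
    have "q x = 0" if x: "x \<in> ?T" for x
    proof (rule face_simplex_cancel[OF I(1) _ _ poly_space_polynomials[OF q(1)] _ x])
      show "I \<noteq> {..<4}" using I by auto
      show "{j} \<subseteq> {..<4} - I" using I by auto
      fix y assume "y \<in> ?T"
      then show "(\<Prod>l\<in>{j}. lam l y) * q y = 0"
        using fun_cong[OF g0, of y] by (simp add: f_def q(2) restrict_field_def)
    qed
    then show "g = 0" by (auto simp: q(2) restrict_field_def fun_eq_iff)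
  qed
  then show ?thesis
    using dim_rank_nullity[OF subspace_poly_on fin_dim_poly_on linear_on_space_restrict_field, of m ?T ?T']
    unfolding im ker by simp
qed

lemma face_simplex_vertex:
  assumes "a < 4"
  shows "face_simplex ({..<4} - {a}) = {v a}"
  using convex_hull_vertices[of "{a}"] assms by simp

text \<open>A facet of an edge is a single point and contributes one dimension per degree. The
  formulas for edges, faces and the tetrahedron start at degrees -1, -2 and -3, where both sides
  vanish; these are the degrees k - 3, k - 4 and k - 5 for k = 2.\<close>

lemma dim_poly_on_edge:
  assumes I: "I \<subseteq> {..<4}" "card I = 2" and m: "m \<ge> -1"
  shows "int (dim (poly_on m (face_simplex I))) = m + 1"
proof -
  have fI: "finite I" using I finite_subset by blast
  then have "card ({..<4} - I) = 2" using I by (simp add: card_Diff_subset)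
  then obtain a b where ab: "{..<4} - I = {a, b}" "a \<noteq> b" by (auto simp: card_2_iff)
  then have "insert b I = {..<4} - {a}" using I by auto
  then have S: "face_simplex (insert b I) = {v a}" using face_simplex_vertex[of a] ab by auto
  have step: "dim (poly_on n (face_simplex I)) = dim (poly_on n {v a}) + dim (poly_on (n - 1) (face_simplex I))" for n
    using dim_poly_on_step[of I b a n] ab I S by auto
  show ?thesis using m
  proof (induction m rule: int_ge_induct)
    case base
    then show ?case by (simp add: dim_poly_on_neg)
  next
    case (step i)
    then show ?case using \<open>\<And>n. dim (poly_on n (face_simplex I)) = _\<close>[of "i + 1"] by (simp add: dim_poly_on_point)
  qed
qed

text \<open>The increments are the dimensions on an edge, so they sum to a triangular number; the
  factor 2 avoids division.\<close>

lemma dim_poly_on_face: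
  assumes I: "I \<subseteq> {..<4}" "card I = 1" and m: "m \<ge> -2"
  shows "2 * int (dim (poly_on m (face_simplex I))) = (m + 1) * (m + 2)"
proof -
  have fI: "finite I" using I finite_subset by blast
  then have "card ({..<4} - I) = 3" using I by (simp add: card_Diff_subset)
  then obtain a b c where ab: "{..<4} - I = {a, b, c}" "a \<noteq> b" by (auto simp: card_3_iff)
  have E: "int (dim (poly_on n (face_simplex (insert b I)))) = n + 1" if "n \<ge> -1" for n
    by (rule dim_poly_on_edge) (use ab I fI that in \<open>auto simp: card_insert_if\<close>)
  have step: "dim (poly_on n (face_simplex I)) = dim (poly_on n (face_simplex (insert b I))) + dim (poly_on (n - 1) (face_simplex I))" for n
    using dim_poly_on_step[of I b a n] ab I by auto
  show ?thesis using m
  proof (induction m rule: int_ge_induct)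
    case base
    then show ?case by (simp add: dim_poly_on_neg)
  next
    case (step i)
    then show ?case using \<open>\<And>n. dim (poly_on n (face_simplex I)) = _\<close>[of "i + 1"] E[of "i + 1"]
      by (simp add: algebra_simps)
  qed
qed

lemma dim_poly_space:
  assumes m: "m \<ge> -3"
  shows "6 * int (dim (poly_space m)) = (m + 1) * (m + 2) * (m + 3)"
proof -
  have eq: "dim (poly_on n (face_simplex {})) = dim (poly_space n)" for n
    unfolding poly_on_eq
  proof (rule dim_inj_image[OF subspace_poly_space fin_dim_poly_space linear_on_space_restrict_field])
    fix p assume p: "p \<in> poly_space n" "restrict_field (face_simplex {}) p = 0"
    show "p = 0"
    proof (rule polynomial_eq_0_on_tetra[OF p(1)])
      fix x assume "x \<in> face_simplex {}"
      then show "p x = 0" using fun_cong[OF p(2), of x] by (simp add: restrict_field_def)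
    qed
  qed
  have F: "2 * int (dim (poly_on n (face_simplex {0}))) = (n + 1) * (n + 2)" if "n \<ge> -2" for n
    by (rule dim_poly_on_face) (use that in auto)
  have step: "dim (poly_space n) = dim (poly_on n (face_simplex {0})) + dim (poly_space (n - 1))" for n
    using dim_poly_on_step[of "{}" 0 1 n] by (simp add: eq)
  show ?thesis using m
  proof (induction m rule: int_ge_induct)
    case base
    then show ?case by (simp add: poly_space_neg dim_zero_space)
  next
    case (step i)
    have "6 * int (dim (poly_space (i + 1))) = 3 * (2 * int (dim (poly_on (i + 1) (face_simplex {0})))) + 6 * int (dim (poly_space i))"
      using \<open>\<And>n. dim (poly_space n) = _\<close>[of "i + 1"] by simp
    then show ?case using step F[of "i + 1"] by (simp add: algebra_simps)
  qed
qed

end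

section \<open>Integration and the divergence theorem on a tetrahedron\<close>

lemma compact_continuous_integrable:
  fixes f :: "'a::euclidean_space \<Rightarrow> real"
  assumes "compact S" "continuous_on S f"
  shows "set_integrable lborel S f" "f integrable_on S"
    "integral S f = (\<integral>x. indicator S x * f x \<partial>lborel)"
proof -
  show 1: "set_integrable lborel S f"
    using borel_integrable_compact[OF assms] by (simp add: set_integrable_def)
  show "f integrable_on S" by (rule set_borel_integral_eq_integral(1)[OF 1])
  show "integral S f = (\<integral>x. indicator S x * f x \<partial>lborel)"
    using set_borel_integral_eq_integral(2)[OF 1] by (simp add: set_lebesgue_integral_def)
qed

text \<open>The integral over every box inside is also zero, so the function vanishes in the
  interior by continuity; a closed convex set with interior points is the closure of its
  interior.\<close>

lemma integral_0_imp_0: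
  fixes f :: "'a::euclidean_space \<Rightarrow> real"
  assumes S: "compact S" "convex S" "interior S \<noteq> {}" and f: "continuous_on S f"
    and nn: "\<And>x. x \<in> S \<Longrightarrow> 0 \<le> f x" and I: "integral S f = 0" and x: "x \<in> S"
  shows "f x = 0"
proof -
  have int: "f integrable_on S" using compact_continuous_integrable(2)[OF S(1) f] .
  have "f y = 0" if y: "y \<in> interior S" for y
  proof -
    have "open (interior S)" by simp
    then obtain a b where ab: "y \<in> box a b" "cbox a b \<subseteq> interior S"
      using open_contains_cbox[of "interior S" y] y by metis
    then have sub: "cbox a b \<subseteq> S" using interior_subset by blast
    have c: "continuous_on (cbox a b) f" using f sub continuous_on_subset by blast
    then have i: "f integrable_on cbox a b" by (rule integrable_continuous)
    have "integral (cbox a b) f \<le> integral S f"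
      by (rule integral_subset_le[OF sub i int]) (use nn in auto)
    moreover have "0 \<le> integral (cbox a b) f" by (rule integral_nonneg[OF i]) (use nn sub in auto)
    ultimately have "(f has_integral 0) (cbox a b)"
      using I i by (metis antisym integrable_integral)
    then show "f y = 0"
      using has_integral_0_cbox_imp_0[OF c] nn sub ab(1) box_subset_cbox by blast
  qed
  moreover have cl: "closure (interior S) = S"
    using convex_closure_interior[OF S(2,3)] S(1) by (simp add: compact_imp_closed)
  ultimately show ?thesis
    using continuous_constant_on_closure[of "interior S" f 0 x] f x by simp
qed

section \<open>Reference triangle and reference tetrahedron\<close>

definition unit_triangle :: "(real \<times> real) set" where
  "unit_triangle = {(s, t). 0 \<le> s \<and> 0 \<le> t \<and> s + t \<le> 1}"

text \<open>Nested pairs instead of \<open>real^3\<close>, so that Fubini's theorem for product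
  measures can integrate out one variable.\<close>

definition unit_tetra :: "(real \<times> real \<times> real) set" where
  "unit_tetra = {(s, t, u). 0 \<le> s \<and> 0 \<le> t \<and> 0 \<le> u \<and> s + t + u \<le> 1}"

lemma unit_triangle: "compact unit_triangle" "convex unit_triangle" "interior unit_triangle \<noteq> {}"
proof -
  have eq: "unit_triangle = {p. 0 \<le> fst p} \<inter> {p. 0 \<le> snd p} \<inter> {p. fst p + snd p \<le> 1}"
    by (auto simp: unit_triangle_def)
  have "closed unit_triangle" unfolding eq
    by (intro closed_Int closed_Collect_le continuous_intros)
  moreover have "unit_triangle \<subseteq> cbox (0, 0) (1, 1)" by (auto simp: unit_triangle_def cbox_Pair_eq)
  ultimately show "compact unit_triangle"
    by (metis bounded_cbox bounded_subset compact_eq_bounded_closed)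
  show "convex unit_triangle"
  proof (rule convexI)
    fix p q :: "real \<times> real" and u w :: real
    assume a: "p \<in> unit_triangle" "q \<in> unit_triangle" "0 \<le> u" "0 \<le> w" "u + w = 1"
    have "u * (fst p + snd p) + w * (fst q + snd q) \<le> u * 1 + w * 1"
      using a by (intro add_mono mult_left_mono) (auto simp: eq)
    then show "u *\<^sub>R p + w *\<^sub>R q \<in> unit_triangle"
      using a by (auto simp: eq algebra_simps)
  qed
  have "open ({p. 0 < fst p} \<inter> {p. 0 < snd p} \<inter> {p. fst p + snd p < (1::real)})"
    by (intro open_Int open_Collect_less continuous_intros)
  moreover have "{p. 0 < fst p} \<inter> {p. 0 < snd p} \<inter> {p. fst p + snd p < 1} \<subseteq> unit_triangle"
    by (auto simp: eq)
  ultimately have "{p. 0 < fst p} \<inter> {p. 0 < snd p} \<inter> {p. fst p + snd p < 1} \<subseteq> interior unit_triangle"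
    by (rule interior_maximal[rotated])
  moreover have "(1/4, 1/4) \<in> {p. 0 < fst p} \<inter> {p. 0 < snd p} \<inter> {p. fst p + snd p < (1::real)}" by simp
  ultimately show "interior unit_triangle \<noteq> {}" by blast
qed

lemma unit_tetra: "compact unit_tetra" "convex unit_tetra" "interior unit_tetra \<noteq> {}"
proof -
  let ?sum = "\<lambda>p::real \<times> real \<times> real. fst p + fst (snd p) + snd (snd p)"
  have eq: "unit_tetra = {p. 0 \<le> fst p} \<inter> {p. 0 \<le> fst (snd p)} \<inter> {p. 0 \<le> snd (snd p)} \<inter> {p. ?sum p \<le> 1}"
    by (auto simp: unit_tetra_def)
  have "closed unit_tetra" unfolding eq
    by (intro closed_Int closed_Collect_le continuous_intros)
  moreover have "unit_tetra \<subseteq> cbox (0, 0, 0) (1, 1, 1)" by (auto simp: unit_tetra_def cbox_Pair_eq)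
  ultimately show "compact unit_tetra"
    by (metis bounded_cbox bounded_subset compact_eq_bounded_closed)
  show "convex unit_tetra"
  proof (rule convexI)
    fix p q :: "real \<times> real \<times> real" and u w :: real
    assume a: "p \<in> unit_tetra" "q \<in> unit_tetra" "0 \<le> u" "0 \<le> w" "u + w = 1"
    have "u * ?sum p + w * ?sum q \<le> u * 1 + w * 1"
      using a by (intro add_mono mult_left_mono) (auto simp: eq)
    then show "u *\<^sub>R p + w *\<^sub>R q \<in> unit_tetra"
      using a by (auto simp: eq algebra_simps)
  qed
  have "open ({p. 0 < fst p} \<inter> {p. 0 < fst (snd p)} \<inter> {p. 0 < snd (snd p)} \<inter> {p. ?sum p < 1})"
    by (intro open_Int open_Collect_less continuous_intros)
  moreover have "{p. 0 < fst p} \<inter> {p. 0 < fst (snd p)} \<inter> {p. 0 < snd (snd p)} \<inter> {p. ?sum p < 1} \<subseteq> unit_tetra"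
    by (auto simp: eq)
  ultimately have "{p. 0 < fst p} \<inter> {p. 0 < fst (snd p)} \<inter> {p. 0 < snd (snd p)} \<inter> {p. ?sum p < 1} \<subseteq> interior unit_tetra"
    by (rule interior_maximal[rotated])
  moreover have "(1/8, 1/8, 1/8) \<in> {p. 0 < fst p} \<inter> {p. 0 < fst (snd p)} \<inter> {p. 0 < snd (snd p)} \<inter> {p. ?sum p < 1}" by simp
  ultimately show "interior unit_tetra \<noteq> {}" by blast
qed

text \<open>The substitution of 1 - s - t for s exchanges the vertices (0, 0) and (1, 0). Together
  with the exchange of s and t it generates all permutations of the vertices, which makes face
  integrals independent of the vertex order.\<close>

lemma triangle_integral_reflect:
  fixes g :: "real \<times> real \<Rightarrow> real"
  assumes g: "continuous_on UNIV g"
  shows "integral unit_triangle (\<lambda>(s, t). g (1 - s - t, t)) = integral unit_triangle g"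
proof -
  define h where "h = (\<lambda>p. indicator unit_triangle p * g p)"
  define h' where "h' = (\<lambda>p. indicator unit_triangle p * g (1 - fst p - snd p, snd p))"
  have c: "continuous_on unit_triangle (\<lambda>(s, t). g (1 - s - t, t))"
    unfolding case_prod_beta
    by (rule continuous_on_compose2[OF g]) (auto intro!: continuous_intros)
  have 1: "integrable lborel h"
    using compact_continuous_integrable(1)[OF unit_triangle(1) continuous_on_subset[OF g]]
    by (simp add: h_def set_integrable_def)
  have 2: "integrable lborel h'"
    using compact_continuous_integrable(1)[OF unit_triangle(1) c]
    by (simp add: h'_def set_integrable_def case_prod_unfold)
  have inner: "(\<integral>s. h' (s, t) \<partial>lborel) = (\<integral>s. h (s, t) \<partial>lborel)" for t
    using lborel_integral_real_affine[of "-1" "\<lambda>s. h (s, t)" "1 - t"]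
    by (simp add: h_def h'_def unit_triangle_def indicator_def algebra_simps conj_ac)
  have "integral unit_triangle (\<lambda>(s, t). g (1 - s - t, t)) = integral\<^sup>L lborel h'"
    using compact_continuous_integrable(3)[OF unit_triangle(1) c]
    by (simp add: h'_def case_prod_unfold)
  also have "\<dots> = (\<integral>t. (\<integral>s. h' (s, t) \<partial>lborel) \<partial>lborel)"
    using lborel_pair.integral_snd[of "\<lambda>s t. h' (s, t)"] 2 by (simp add: lborel_prod)
  also have "\<dots> = (\<integral>t. (\<integral>s. h (s, t) \<partial>lborel) \<partial>lborel)"
    by (simp only: inner)
  also have "\<dots> = integral\<^sup>L lborel h"
    using lborel_pair.integral_snd[of "\<lambda>s t. h (s, t)"] 1 by (simp add: lborel_prod)
  also have "\<dots> = integral unit_triangle g"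
    using compact_continuous_integrable(3)[OF unit_triangle(1) continuous_on_subset[OF g]]
    by (simp add: h_def)
  finally show ?thesis .
qed

lemma triangle_integral_swap:
  fixes g :: "real \<times> real \<Rightarrow> real"
  assumes g: "continuous_on UNIV g"
  shows "integral unit_triangle (\<lambda>(s, t). g (t, s)) = integral unit_triangle g"
proof -
  define h where "h = (\<lambda>p. indicator unit_triangle p * g p)"
  have c: "continuous_on unit_triangle (\<lambda>(s, t). g (t, s))"
    unfolding case_prod_unfold
    by (rule continuous_on_compose2[OF g]) (auto intro!: continuous_intros)
  have 1: "integrable lborel h"
    using compact_continuous_integrable(1)[OF unit_triangle(1) continuous_on_subset[OF g]]
    by (simp add: h_def set_integrable_def)
  have "integral unit_triangle (\<lambda>(s, t). g (t, s)) = (\<integral>(s, t). h (t, s) \<partial>lborel)"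
    using compact_continuous_integrable(3)[OF unit_triangle(1) c]
    by (simp add: h_def case_prod_unfold unit_triangle_def indicator_def add.commute conj_ac)
  also have "\<dots> = integral\<^sup>L lborel h"
    using lborel_pair.integral_product_swap[of h] 1 by (simp add: lborel_prod)
  also have "\<dots> = integral unit_triangle g"
    using compact_continuous_integrable(3)[OF unit_triangle(1) continuous_on_subset[OF g]]
    by (simp add: h_def)
  finally show ?thesis .
qed

text \<open>Fubini and the fundamental theorem of calculus in the first variable leave integrals
  over two facets, the slanted one s = 1 - t - u and the one with s = 0.\<close>

lemma unit_tetra_derivative:
  fixes g g' :: "real \<times> real \<times> real \<Rightarrow> real"
  assumes g: "continuous_on UNIV g" "continuous_on UNIV g'"
    and d: "\<And>s p. ((\<lambda>s. g (s, p)) has_real_derivative g' (s, p)) (at s)"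
  shows "integral unit_tetra g' =
    integral unit_triangle (\<lambda>(t, u). g (1 - t - u, t, u)) - integral unit_triangle (\<lambda>(t, u). g (0, t, u))"
proof -
  define h where "h = (\<lambda>z. indicator unit_tetra z * g' z)"
  have 1: "integrable lborel h"
    using compact_continuous_integrable(1)[OF unit_tetra(1) continuous_on_subset[OF g(2)]]
    by (simp add: h_def set_integrable_def)
  have c: "continuous_on unit_triangle (\<lambda>(t, u). g (1 - t - u, t, u))"
    "continuous_on unit_triangle (\<lambda>(t, u). g (0, t, u))"
    unfolding case_prod_unfold
    by (rule continuous_on_compose2[OF g(1)]; auto intro!: continuous_intros)+
  have c': "continuous_on unit_triangle (\<lambda>(t, u). g (1 - t - u, t, u) - g (0, t, u))"
    using continuous_on_diff[OF c] by (simp add: case_prod_unfold)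
  have "integral unit_tetra g' = integral\<^sup>L lborel h"
    using compact_continuous_integrable(3)[OF unit_tetra(1) continuous_on_subset[OF g(2)]]
    by (simp add: h_def)
  also have "\<dots> = (\<integral>p. (\<integral>s. h (s, p) \<partial>lborel) \<partial>lborel)"
    using lborel_pair.integral_snd[of "\<lambda>s p. h (s, p)"] 1 by (simp add: lborel_prod)
  also have "\<dots> = (\<integral>p. indicator unit_triangle p * (case p of (t, u) \<Rightarrow> g (1 - t - u, t, u) - g (0, t, u)) \<partial>lborel)"
  proof (rule Bochner_Integration.integral_cong[OF refl])
    fix p :: "real \<times> real"
    obtain t u where p: "p = (t, u)" by (cases p)
    show "(\<integral>s. h (s, p) \<partial>lborel) = indicator unit_triangle p * (case p of (t, u) \<Rightarrow> g (1 - t - u, t, u) - g (0, t, u))"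
    proof (cases "p \<in> unit_triangle")
      case True
      then have tu: "0 \<le> t" "0 \<le> u" "t + u \<le> 1" by (auto simp: p unit_triangle_def)
      have "(\<integral>s. h (s, p) \<partial>lborel) = (\<integral>s. indicator {0..1 - t - u} s *\<^sub>R g' (s, p) \<partial>lborel)"
        using tu by (intro Bochner_Integration.integral_cong)
          (auto simp: h_def unit_tetra_def p indicator_def)
      also have "\<dots> = g (1 - t - u, p) - g (0, p)"
      proof (rule integral_FTC_atLeastAtMost)
        show "0 \<le> 1 - t - u" using tu by simp
        show "((\<lambda>s. g (s, p)) has_vector_derivative g' (x, p)) (at x within {0..1 - t - u})" for x
          using d[of p x] has_real_derivative_iff_has_vector_derivative has_vector_derivative_at_within by blast
        show "continuous_on {0..1 - t - u} (\<lambda>s. g' (s, p))"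
          by (rule continuous_on_compose2[OF g(2)]) (auto intro!: continuous_intros)
      qed
      finally show ?thesis using True by (simp add: p)
    next
      case False
      then have "h (s, p) = 0" for s by (auto simp: h_def unit_tetra_def unit_triangle_def p indicator_def)
      then show ?thesis using False by simp
    qed
  qed
  also have "\<dots> = integral unit_triangle (\<lambda>(t, u). g (1 - t - u, t, u) - g (0, t, u))"
    using compact_continuous_integrable(3)[OF unit_triangle(1) c'] by (simp add: case_prod_unfold)
  also have "\<dots> = integral unit_triangle (\<lambda>(t, u). g (1 - t - u, t, u)) - integral unit_triangle (\<lambda>(t, u). g (0, t, u))"
    using integral_diff[OF compact_continuous_integrable(2)[OF unit_triangle(1) c(1)]
        compact_continuous_integrable(2)[OF unit_triangle(1) c(2)]] by (simp add: case_prod_unfold)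
  finally show ?thesis .
qed

lemma emeasure_lborel_Times:
  fixes A :: "'a::euclidean_space set" and B :: "'b::euclidean_space set"
  shows "A \<in> sets borel \<Longrightarrow> B \<in> sets borel \<Longrightarrow>
    emeasure lborel (A \<times> B) = emeasure lborel A * emeasure lborel B"
  using lborel.emeasure_pair_measure_Times[of A "lborel :: 'a measure" B] by (simp add: lborel_prod)

section \<open>Transport of Lebesgue measure from nested pairs to \<open>real^3\<close>\<close>

definition vec3 :: "real \<times> real \<times> real \<Rightarrow> real^3" where
  "vec3 = (\<lambda>(x, y, z). vector [x, y, z])"

lemma vec3_component [simp]:
  "vec3 p $ 1 = fst p" "vec3 p $ 2 = fst (snd p)" "vec3 p $ 3 = snd (snd p)"
  by (simp_all add: vec3_def case_prod_beta)

lemma continuous_vec3: "continuous_on S vec3"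
proof (subst continuous_on_componentwise, intro ballI)
  fix b :: "real^3" assume "b \<in> Basis"
  then obtain i where b: "b = axis i 1" by (auto simp: Basis_vec_def)
  have "continuous_on S (\<lambda>p. vec3 p $ i)"
    using exhaust_3[of i] by (elim disjE; simp only: vec3_component; intro continuous_intros)
  then show "continuous_on S (\<lambda>p. vec3 p \<bullet> b)" by (simp add: b inner_axis)
qed

lemma inj_vec3: "inj vec3"
  by (rule injI) (metis vec3_component prod_eqI)

text \<open>Lebesgue measure is characterised by its values on boxes, and under \<open>vec3\<close>
  boxes correspond to products of intervals.\<close>

lemma lborel_vec3: "(lborel :: (real^3) measure) = distr lborel borel vec3"
proof -
  have meas: "vec3 \<in> borel_measurable lborel" by (simp add: borel_measurable_continuous_onI continuous_vec3)
  show ?thesis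
  proof (rule lborel_eqI)
    fix l u :: "real^3" assume lu: "\<And>b. b \<in> Basis \<Longrightarrow> l \<bullet> b \<le> u \<bullet> b"
    have le: "l $ i \<le> u $ i" for i using lu[of "axis i 1"] by (simp add: inner_axis axis_in_Basis_iff)
    have "vec3 -` box l u = {l $ 1<..<u $ 1} \<times> {l $ 2<..<u $ 2} \<times> {l $ 3<..<u $ 3}"
      by (force simp: mem_box_cart forall_3)
    then have "emeasure (distr lborel borel vec3) (box l u) =
        emeasure lborel ({l $ 1<..<u $ 1} \<times> {l $ 2<..<u $ 2} \<times> {l $ 3<..<u $ 3})"
      by (subst emeasure_distr[OF meas]) simp_all
    also have "\<dots> = ennreal (u $ 1 - l $ 1) * (ennreal (u $ 2 - l $ 2) * ennreal (u $ 3 - l $ 3))"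
      using le by (simp add: emeasure_lborel_Times borel_Times)
    also have "\<dots> = ennreal ((u $ 1 - l $ 1) * ((u $ 2 - l $ 2) * (u $ 3 - l $ 3)))"
      using le by (simp add: ennreal_mult)
    also have "(u $ 1 - l $ 1) * ((u $ 2 - l $ 2) * (u $ 3 - l $ 3)) = (\<Prod>b\<in>Basis. (u - l) \<bullet> b)"
    proof -
      have B: "(Basis :: (real^3) set) = (\<lambda>i. axis i 1) ` UNIV" by (auto simp: Basis_vec_def)
      have "inj (\<lambda>i::3. axis i (1::real))" by (auto simp: inj_on_def axis_eq_axis)
      then have "(\<Prod>b\<in>Basis. (u - l) \<bullet> b) = (\<Prod>i\<in>UNIV. (u - l) \<bullet> axis i 1)"
        unfolding B by (simp add: prod.reindex)
      also have "\<dots> = (\<Prod>i\<in>{1, 2, 3}. (u - l) $ i)" by (simp add: inner_axis flip: UNIV_3)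
      finally show ?thesis by simp
    qed
    finally show "emeasure (distr lborel borel vec3) (box l u) = ennreal (\<Prod>b\<in>Basis. (u - l) \<bullet> b)" .
  qed simp
qed

lemma compact_continuous_absolutely_integrable:
  fixes f :: "'a::euclidean_space \<Rightarrow> 'b::euclidean_space"
  assumes "compact S" "continuous_on S f"
  shows "f absolutely_integrable_on S"
proof -
  have 1: "integrable lborel (\<lambda>x. indicator S x *\<^sub>R f x)" using borel_integrable_compact[OF assms] .
  then have "(\<lambda>x. indicator S x *\<^sub>R f x) \<in> borel_measurable lborel" by simp
  then show ?thesis using 1 unfolding set_integrable_def by (simp add: integrable_completion)
qed

lemma integral_vec3:
  fixes k :: "real^3 \<Rightarrow> real"
  assumes k: "continuous_on UNIV k"
  shows "integral (vec3 ` unit_tetra) k = integral unit_tetra (\<lambda>p. k (vec3 p))"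
proof -
  have com: "compact (vec3 ` unit_tetra)"
    by (rule compact_continuous_image[OF continuous_vec3 unit_tetra(1)])
  have "integral (vec3 ` unit_tetra) k = (\<integral>x. indicator (vec3 ` unit_tetra) x * k x \<partial>lborel)"
    by (rule compact_continuous_integrable(3)[OF com continuous_on_subset[OF k]]) simp
  also have "\<dots> = (\<integral>p. indicator (vec3 ` unit_tetra) (vec3 p) * k (vec3 p) \<partial>lborel)"
  proof (subst lborel_vec3, rule integral_distr)
    show "vec3 \<in> lborel \<rightarrow>\<^sub>M borel" by (simp add: borel_measurable_continuous_onI continuous_vec3)
    have "vec3 ` unit_tetra \<in> sets borel" using com by (simp add: borel_compact)
    moreover have "k \<in> borel_measurable borel" using k by (rule borel_measurable_continuous_onI)
    ultimately show "(\<lambda>x. indicator (vec3 ` unit_tetra) x * k x) \<in> borel_measurable borel" by measurable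
  qed
  also have "\<dots> = (\<integral>p. indicator unit_tetra p * k (vec3 p) \<partial>lborel)"
    using inj_vec3 by (simp add: indicator_def inj_image_mem_iff)
  also have "\<dots> = integral unit_tetra (\<lambda>p. k (vec3 p))"
    by (rule compact_continuous_integrable(3)[symmetric, OF unit_tetra(1)])
      (rule continuous_on_compose2[OF k continuous_vec3], simp)
  finally show ?thesis .
qed

text \<open>The change of variables theorem of the library is stated for vector-valued integrands only,
  hence the detour through \<open>real^1\<close>.\<close>

lemma integral_affine_image:
  fixes h :: "real^3 \<Rightarrow> real" and F :: "real^3 \<Rightarrow> real^3"
  assumes h: "continuous_on UNIV h" and S: "compact S" and F: "inj F" "linear L" "\<And>x. F x = a + L x"
  shows "integral (F ` S) h = \<bar>det (matrix L)\<bar> * integral S (\<lambda>x. h (F x))"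
proof -
  define H :: "real^3 \<Rightarrow> real^1" where "H x = (\<chi> i. h x)" for x
  have cF: "continuous_on S F"
    unfolding F(3) using F(2) by (intro continuous_intros linear_continuous_on) (simp add: linear_conv_bounded_linear)
  have cH: "continuous_on UNIV H" unfolding H_def by (intro continuous_intros h)
  have cHF: "continuous_on S (\<lambda>x. \<bar>det (matrix L)\<bar> *\<^sub>R H (F x))"
    by (intro continuous_intros continuous_on_compose2[OF cH cF]) auto
  have ai: "(\<lambda>x. \<bar>det (matrix L)\<bar> *\<^sub>R H (F x)) absolutely_integrable_on S"
    by (rule compact_continuous_absolutely_integrable[OF S cHF])
  have "(F has_derivative L) (at x within S)" for x
    unfolding F(3) using linear_imp_has_derivative[OF F(2)] by (auto intro!: derivative_eq_intros)
  from has_absolute_integral_change_of_variables_compact[OF S this inj_on_subset[OF F(1) subset_UNIV], of H]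
  have *: "H absolutely_integrable_on (F ` S)"
    "integral (F ` S) H = integral S (\<lambda>x. \<bar>det (matrix L)\<bar> *\<^sub>R H (F x))"
    using ai by blast+
  have "integral (F ` S) h = integral (F ` S) (\<lambda>x. H x $ 1)" by (simp add: H_def)
  also have "\<dots> = integral (F ` S) H $ 1"
    by (rule integral_component_eq_cart) (use *(1) set_lebesgue_integral_eq_integral(1) in blast)
  also have "\<dots> = integral S (\<lambda>x. (\<bar>det (matrix L)\<bar> *\<^sub>R H (F x)) $ 1)"
    unfolding *(2) by (rule integral_component_eq_cart[symmetric]) (use ai set_lebesgue_integral_eq_integral(1) in blast)
  also have "\<dots> = \<bar>det (matrix L)\<bar> * integral S (\<lambda>x. h (F x))"
    by (simp add: H_def)
  finally show ?thesis .
qed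

section \<open>Face integrals and the divergence theorem\<close>

context tetrahedron
begin

definition triangle_param :: "nat \<Rightarrow> nat \<Rightarrow> nat \<Rightarrow> real \<times> real \<Rightarrow> real^3" where
  "triangle_param a b c = (\<lambda>(s, t). v a + s *\<^sub>R (v b - v a) + t *\<^sub>R (v c - v a))"

text \<open>There is no area factor: the gradients of the coordinates are unnormalised normals, and
  with both conventions all faces enter the divergence theorem with the same constant.\<close>

definition triangle_integral :: "nat \<Rightarrow> nat \<Rightarrow> nat \<Rightarrow> scalar_field \<Rightarrow> real" where
  "triangle_integral a b c g = integral unit_triangle (\<lambda>p. g (triangle_param a b c p))"

lemma continuous_triangle_param: "continuous_on S (triangle_param a b c)"
  unfolding triangle_param_def case_prod_unfold by (intro continuous_intros)

lemma triangle_integral_swap12: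
  assumes "g \<in> polynomials"
  shows "triangle_integral b a c g = triangle_integral a b c g"
proof -
  have c: "continuous_on UNIV (\<lambda>p. g (triangle_param a b c p))"
    by (rule continuous_on_compose2[OF polynomials_continuous[OF assms, of UNIV] continuous_triangle_param]) simp
  have "triangle_param b a c p = triangle_param a b c (1 - fst p - snd p, snd p)" for p
    by (simp add: triangle_param_def case_prod_unfold algebra_simps)
  then show ?thesis
    using triangle_integral_reflect[OF c] unfolding triangle_integral_def by (simp add: case_prod_unfold)
qed

lemma triangle_integral_swap23:
  assumes "g \<in> polynomials"
  shows "triangle_integral a c b g = triangle_integral a b c g"
proof -
  have c: "continuous_on UNIV (\<lambda>p. g (triangle_param a b c p))"
    by (rule continuous_on_compose2[OF polynomials_continuous[OF assms, of UNIV] continuous_triangle_param]) simp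
  have "triangle_param a c b p = triangle_param a b c (snd p, fst p)" for p
    by (simp add: triangle_param_def case_prod_unfold algebra_simps)
  then show ?thesis
    using triangle_integral_swap[OF c] unfolding triangle_integral_def by (simp add: case_prod_unfold)
qed

text \<open>\<open>D\<close> is the Jacobian of the affine parametrization. Only its independence of
  the integrand is exported; a comparison with the constant integrand eliminates it later.\<close>

lemma tetra_integral_param:
  assumes abcd: "{..<4} = {a, b, c, d}" "distinct [a, b, c, d]"
  obtains D where "\<And>h :: scalar_field. continuous_on UNIV h \<Longrightarrow> integral (tetra v) h =
    D * integral unit_tetra (\<lambda>(s, t, u). h (v a + s *\<^sub>R (v b - v a) + t *\<^sub>R (v c - v a) + u *\<^sub>R (v d - v a)))"
proof -
  define L where "L y = y $ 1 *\<^sub>R (v b - v a) + y $ 2 *\<^sub>R (v c - v a) + y $ 3 *\<^sub>R (v d - v a)" for y :: "real^3"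
  define F where "F y = v a + L y" for y
  have linL: "linear L" unfolding L_def by (intro linearI) (simp_all add: algebra_simps)
  have lt: "a < 4" "b < 4" "c < 4" "d < 4" using abcd(1) by (auto simp: set_eq_iff)
  \<comment> \<open>Expressed in barycentric coordinates the parametrization is the identity, which
    yields both injectivity and the image.\<close>
  have lamF: "lam i (F y) = (if i = a then 1 - y $ 1 - y $ 2 - y $ 3 else if i = b then y $ 1
    else if i = c then y $ 2 else y $ 3)" if "i < 4" for i y
  proof -
    have "i \<in> {a, b, c, d}" using that abcd(1) by auto
    moreover have "lam i (F y) = lam i (v a) + y $ 1 * (lam i (v b) - lam i (v a))
        + y $ 2 * (lam i (v c) - lam i (v a)) + y $ 3 * (lam i (v d) - lam i (v a))"
      by (simp add: F_def L_def add.assoc[symmetric] lam_affine_line[OF that])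
    ultimately show ?thesis using abcd(2) by (auto simp: lam_vertex[OF that] lt)
  qed
  have inj: "inj F"
  proof (rule injI)
    fix x y assume "F x = F y"
    then have "x $ 1 = y $ 1" "x $ 2 = y $ 2" "x $ 3 = y $ 3"
      using lamF[OF lt(2), of x] lamF[OF lt(2), of y] lamF[OF lt(3), of x] lamF[OF lt(3), of y]
        lamF[OF lt(4), of x] lamF[OF lt(4), of y] abcd(2) by auto
    then show "x = y" by (simp add: vec_eq_iff forall_3)
  qed
  have img: "F ` vec3 ` unit_tetra = tetra v"
  proof
    show "F ` vec3 ` unit_tetra \<subseteq> tetra v"
      unfolding tetra_eq by (auto simp: face_simplex_def lamF unit_tetra_def)
    show "tetra v \<subseteq> F ` vec3 ` unit_tetra"
    proof
      fix x assume x: "x \<in> tetra v"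
      have sum: "(\<Sum>i<4. k i) = k a + k b + k c + k d" for k :: "nat \<Rightarrow> 'z::comm_monoid_add"
        using abcd by (simp add: add.assoc)
      have 1: "lam a x = 1 - lam b x - lam c x - lam d x" using lam_sum[of x] by (simp add: sum)
      have "x = lam a x *\<^sub>R v a + lam b x *\<^sub>R v b + lam c x *\<^sub>R v c + lam d x *\<^sub>R v d"
        using lam_point[of x] by (simp only: sum)
      then have "x = F (vec3 (lam b x, lam c x, lam d x))"
        by (simp add: F_def L_def 1 algebra_simps)
      moreover have "(lam b x, lam c x, lam d x) \<in> unit_tetra"
        using x lt 1 unfolding tetra_eq face_simplex_def unit_tetra_def
        by (auto simp: algebra_simps dest: spec[of _ a])
      ultimately show "x \<in> F ` vec3 ` unit_tetra" by blast
    qed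
  qed
  show ?thesis
  proof (rule that[of "\<bar>det (matrix L)\<bar>"])
    fix h :: scalar_field assume h: "continuous_on UNIV h"
    have cF: "continuous_on UNIV F"
      unfolding F_def using linL by (intro continuous_intros linear_continuous_on) (simp add: linear_conv_bounded_linear)
    then have hF: "continuous_on UNIV (\<lambda>y. h (F y))" by (rule continuous_on_compose2[OF h]) simp
    have com: "compact (vec3 ` unit_tetra)"
      by (rule compact_continuous_image[OF continuous_vec3 unit_tetra(1)])
    have "integral (tetra v) h = \<bar>det (matrix L)\<bar> * integral (vec3 ` unit_tetra) (\<lambda>y. h (F y))"
      using integral_affine_image[OF h com inj linL F_def] by (simp only: img)
    moreover have "integral (vec3 ` unit_tetra) (\<lambda>y. h (F y)) = integral unit_tetra (\<lambda>p. h (F (vec3 p)))"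
      by (rule integral_vec3[OF hF])
    moreover have "\<dots> = integral unit_tetra
        (\<lambda>(s, t, u). h (v a + s *\<^sub>R (v b - v a) + t *\<^sub>R (v c - v a) + u *\<^sub>R (v d - v a)))"
      by (rule Henstock_Kurzweil_Integration.integral_cong) (auto simp: F_def L_def add.assoc)
    ultimately show "integral (tetra v) h = \<bar>det (matrix L)\<bar> * integral unit_tetra
        (\<lambda>(s, t, u). h (v a + s *\<^sub>R (v b - v a) + t *\<^sub>R (v c - v a) + u *\<^sub>R (v d - v a)))"
      by (simp only:)
  qed
qed

text \<open>The derivative along the edge from \<open>v a\<close> to \<open>v b\<close> integrates
  to the difference of the facets opposite its two endpoints. Multiplying crosswise by the two
  volumes removes the unspecified Jacobian.\<close>

lemma directional_derivative_integral:
  assumes abcd: "{..<4} = {a, b, c, d}" "distinct [a, b, c, d]" and g: "g \<in> polynomials"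
  shows "integral (tetra v) (\<lambda>x. (v b - v a) \<bullet> grad g x) * integral unit_tetra (\<lambda>_. 1) =
    integral (tetra v) (\<lambda>_. 1) * (triangle_integral b c d g - triangle_integral a c d g)"
proof -
  obtain D where D: "\<And>h :: scalar_field. continuous_on UNIV h \<Longrightarrow> integral (tetra v) h =
    D * integral unit_tetra (\<lambda>(s, t, u). h (v a + s *\<^sub>R (v b - v a) + t *\<^sub>R (v c - v a) + u *\<^sub>R (v d - v a)))"
    using tetra_integral_param[OF abcd] by blast
  define P where "P = (\<lambda>p. v a + fst p *\<^sub>R (v b - v a) + fst (snd p) *\<^sub>R (v c - v a) + snd (snd p) *\<^sub>R (v d - v a))"
  have cP: "continuous_on UNIV P" unfolding P_def by (intro continuous_intros)
  have cg: "continuous_on UNIV (\<lambda>x. (v b - v a) \<bullet> grad g x)"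
    unfolding inner_vec_def by (intro continuous_intros polynomials_continuous polynomials_grad g)
  have "integral unit_tetra (\<lambda>p. (v b - v a) \<bullet> grad g (P p)) =
      integral unit_triangle (\<lambda>(t, u). g (P (1 - t - u, t, u))) - integral unit_triangle (\<lambda>(t, u). g (P (0, t, u)))"
  proof (rule unit_tetra_derivative)
    show "continuous_on UNIV (\<lambda>p. g (P p))"
      by (rule continuous_on_compose2[OF polynomials_continuous[OF g, of UNIV] cP]) simp
    show "continuous_on UNIV (\<lambda>p. (v b - v a) \<bullet> grad g (P p))"
      by (rule continuous_on_compose2[OF cg cP]) simp
    fix s and p :: "real \<times> real"
    have "((\<lambda>s. P (s, p)) has_derivative (\<lambda>h. h *\<^sub>R (v b - v a))) (at s)"
      unfolding P_def by (auto intro!: derivative_eq_intros)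
    from has_derivative_compose[OF this polynomials_has_derivative[OF g]]
    have "((\<lambda>s. g (P (s, p))) has_derivative (\<lambda>h. grad g (P (s, p)) \<bullet> (h *\<^sub>R (v b - v a)))) (at s)" .
    moreover have "(\<lambda>h. grad g (P (s, p)) \<bullet> (h *\<^sub>R (v b - v a))) = (*) ((v b - v a) \<bullet> grad g (P (s, p)))"
      by (simp add: fun_eq_iff inner_commute)
    ultimately show "((\<lambda>s. g (P (s, p))) has_real_derivative (v b - v a) \<bullet> grad g (P (s, p))) (at s)"
      unfolding has_field_derivative_def by (simp only:)
  qed
  moreover have "P (1 - t - u, t, u) = triangle_param b c d (t, u)" "P (0, t, u) = triangle_param a c d (t, u)" for t u
    by (simp_all add: P_def triangle_param_def algebra_simps)
  ultimately have "integral unit_tetra (\<lambda>p. (v b - v a) \<bullet> grad g (P p)) = triangle_integral b c d g - triangle_integral a c d g"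
    by (simp add: triangle_integral_def case_prod_unfold)
  moreover have "integral (tetra v) (\<lambda>x. (v b - v a) \<bullet> grad g x) = D * integral unit_tetra (\<lambda>p. (v b - v a) \<bullet> grad g (P p))"
    using D[OF cg] by (simp add: P_def case_prod_unfold)
  moreover have "integral (tetra v) (\<lambda>_. 1) = D * integral unit_tetra (\<lambda>_. 1)"
    using D[of "\<lambda>_. 1"] by (simp add: case_prod_unfold)
  ultimately show ?thesis by simp
qed

text \<open>The coordinates are affine, so the gradient at the origin is the gradient at every
  point.\<close>

definition lam_grad :: "nat \<Rightarrow> real^3" where
  "lam_grad i = grad (lam i) 0"

lemma lam_eq: 
  assumes "i < 4"
  shows "lam i x = lam_grad i \<bullet> x + lam i 0"
proof -
  obtain a c where ac: "\<And>x. lam i x = a \<bullet> x + c" using poly_space_1_affine[OF lam_poly[OF assms]] by blast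
  have "(lam i has_derivative (\<lambda>h. a \<bullet> h)) (at 0)"
    unfolding ac by (auto intro!: derivative_eq_intros)
  then have "lam_grad i = a" unfolding lam_grad_def by (rule grad_eqI)
  then show ?thesis by (simp add: ac)
qed

lemma lam_grad_sum: "(\<Sum>i<4. lam_grad i \<bullet> y) = 0"
proof -
  have "(\<Sum>i<4. lam_grad i \<bullet> y) = (\<Sum>i<4. lam i y - lam i 0)" by (rule sum.cong) (auto simp: lam_eq[of _ y])
  then show ?thesis by (simp add: sum_subtractf lam_sum)
qed

text \<open>Linear part of the reproduction of points by their coordinates. Since the coefficients
  sum to zero, it amounts to an expansion of \<open>y\<close> along edge directions.\<close>

lemma lam_grad_point: "(\<Sum>i<4. (lam_grad i \<bullet> y) *\<^sub>R v i) = y"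
proof -
  have "(\<Sum>i<4. (lam_grad i \<bullet> y) *\<^sub>R v i) = (\<Sum>i<4. lam i y *\<^sub>R v i - lam i 0 *\<^sub>R v i)"
    by (rule sum.cong) (auto simp: lam_eq[of _ y] algebra_simps)
  then show ?thesis by (simp add: sum_subtractf lam_point)
qed

lemma sum_4: "(\<Sum>i<4. f i) = f 0 + f 1 + f 2 + f (3::nat)" for f :: "nat \<Rightarrow> 'z::comm_monoid_add"
  by (simp add: lessThan_4 add.assoc)

lemma vec_polynomials_inner: "w \<in> vec_polynomials \<Longrightarrow> (\<lambda>x. w x \<bullet> c) \<in> polynomials"
  unfolding inner_vec_def inner_real_def vec_polynomials_def
  by (intro polynomials_sum polynomials_mult polynomials_const) blast

text \<open>The field is expanded along the three edges from \<open>v 0\<close>, and each component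
  is integrated along its own edge. On the face opposite \<open>v 0\<close> three terms are left
  over; they combine to the flux against \<open>lam_grad 0\<close>, because the gradients of the
  coordinates sum to zero.\<close>

lemma divergence_theorem:
  assumes w: "w \<in> vec_polynomials"
    and f: "triangle_integral 1 2 3 (\<lambda>x. w x \<bullet> lam_grad 0) = 0"
      "triangle_integral 0 2 3 (\<lambda>x. w x \<bullet> lam_grad 1) = 0"
      "triangle_integral 0 1 3 (\<lambda>x. w x \<bullet> lam_grad 2) = 0"
      "triangle_integral 0 1 2 (\<lambda>x. w x \<bullet> lam_grad 3) = 0"
  shows "integral (tetra v) (divergence w) = 0"
proof -
  define W where "W i = (\<lambda>x. w x \<bullet> lam_grad i)" for i
  have W: "W i \<in> polynomials" for i unfolding W_def using w by (rule vec_polynomials_inner)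
  have com: "compact (tetra v)" unfolding tetra_def by (rule finite_imp_compact_convex_hull) simp
  have W0: "W 0 x = - (W 1 x + W 2 x + W 3 x)" for x
    using lam_grad_sum[of "w x"] by (simp add: W_def sum_4 inner_commute)
  have "w x = W 1 x *\<^sub>R (v 1 - v 0) + W 2 x *\<^sub>R (v 2 - v 0) + W 3 x *\<^sub>R (v 3 - v 0)" for x
  proof -
    have "w x = W 0 x *\<^sub>R v 0 + W 1 x *\<^sub>R v 1 + W 2 x *\<^sub>R v 2 + W 3 x *\<^sub>R v 3"
      using lam_grad_point[of "w x"] by (simp add: W_def sum_4 inner_commute)
    then show ?thesis by (simp add: W0 algebra_simps)
  qed
  then have "w = (\<lambda>x. W 1 x *\<^sub>R (v 1 - v 0) + W 2 x *\<^sub>R (v 2 - v 0) + W 3 x *\<^sub>R (v 3 - v 0))" by blast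
  then have div: "divergence w x = (v 1 - v 0) \<bullet> grad (W 1) x + (v 2 - v 0) \<bullet> grad (W 2) x + (v 3 - v 0) \<bullet> grad (W 3) x" for x
    by (simp add: divergence_add divergence_scale vec_polynomials_add vec_polynomials_scale W
        vec_polynomials_const divergence_const)
  have int: "(\<lambda>x. c \<bullet> grad (W i) x) integrable_on tetra v" for c i
    by (rule compact_continuous_integrable(2)[OF com])
      (unfold inner_vec_def, intro continuous_intros polynomials_continuous polynomials_grad W)
  let ?T = "triangle_integral" and ?V = "integral unit_tetra (\<lambda>_. 1 :: real)" and ?K = "integral (tetra v) (\<lambda>_. 1 :: real)"
  have "integral (tetra v) (divergence w) = integral (tetra v) (\<lambda>x. (v 1 - v 0) \<bullet> grad (W 1) x)
      + integral (tetra v) (\<lambda>x. (v 2 - v 0) \<bullet> grad (W 2) x) + integral (tetra v) (\<lambda>x. (v 3 - v 0) \<bullet> grad (W 3) x)"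
    unfolding div[abs_def] by (simp add: integral_add integrable_add int)
  then have "integral (tetra v) (divergence w) * ?V =
     ?K * (?T 1 2 3 (W 1) - ?T 0 2 3 (W 1)) + ?K * (?T 2 1 3 (W 2) - ?T 0 1 3 (W 2)) + ?K * (?T 3 1 2 (W 3) - ?T 0 1 2 (W 3))"
    by (simp add: distrib_right directional_derivative_integral[of 0 1 2 3] directional_derivative_integral[of 0 2 1 3]
        directional_derivative_integral[of 0 3 1 2] W lessThan_4 insert_commute del: One_nat_def)
  \<comment> \<open>The faces through \<open>v 0\<close> drop out by assumption, and reordering the
    vertices brings the remaining terms to one parametrization.\<close>
  also have "\<dots> = ?K * (?T 1 2 3 (W 1) + ?T 1 2 3 (W 2) + ?T 1 2 3 (W 3))"
    using f unfolding W_def[symmetric]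
    by (simp add: triangle_integral_swap12[OF W, of 2 1] triangle_integral_swap12[OF W, of 3 1]
        triangle_integral_swap23[OF W, of 1 3 2] algebra_simps del: One_nat_def)
  also have "?T 1 2 3 (W 1) + ?T 1 2 3 (W 2) + ?T 1 2 3 (W 3) = - ?T 1 2 3 (W 0)"
  proof -
    have i: "(\<lambda>p. W i (triangle_param 1 2 3 p)) integrable_on unit_triangle" for i
      by (rule compact_continuous_integrable(2)[OF unit_triangle(1)])
        (rule continuous_on_compose2[OF polynomials_continuous[OF W, of UNIV] continuous_triangle_param], simp)
    show ?thesis unfolding triangle_integral_def W0
      by (simp only: integral_neg integral_add integrable_add i minus_minus)
  qed
  also have "?T 1 2 3 (W 0) = 0" using f by (simp add: W_def)
  finally have "integral (tetra v) (divergence w) * ?V = 0" by simp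
  moreover have "?V \<noteq> 0"
  proof
    assume "?V = 0"
    moreover obtain x where "x \<in> unit_tetra" using unit_tetra(3) interior_subset by blast
    ultimately have "(1::real) = 0" 
      using integral_0_imp_0[OF unit_tetra, of "\<lambda>_. 1" x] by simp
    then show False by simp
  qed
  ultimately show ?thesis by simp
qed

end

section \<open>Polynomials determined by moments\<close>

lemma linear_on_space_basis_0:
  assumes "linear_on_space S L" "subspace S" "is_basis Q S" "\<And>q. q \<in> Q \<Longrightarrow> L q = 0" "x \<in> S"
  shows "L x = 0"
proof -
  obtain g where g: "linear g" "\<And>y. y \<in> S \<Longrightarrow> g y = L y"
    using linear_on_space_extend[OF assms(2,1)] by blast
  have Q: "Q \<subseteq> S" "S \<subseteq> span Q" using assms(3) by (auto simp: is_basis_def)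
  have "g x = 0"
    by (rule linear_eq_0_on_span[OF g(1), of Q]) (use Q g(2) assms(4,5) in auto)
  then show ?thesis using g(2) assms(5) by simp
qed

lemma linear_on_space_integral:
  fixes L :: "'a::real_vector \<Rightarrow> 'b::euclidean_space \<Rightarrow> real"
  assumes "compact S" and c: "\<And>u. u \<in> V \<Longrightarrow> continuous_on S (L u)"
    and add: "\<And>u w z. u \<in> V \<Longrightarrow> w \<in> V \<Longrightarrow> z \<in> S \<Longrightarrow> L (u + w) z = L u z + L w z"
    and scale: "\<And>u c z. u \<in> V \<Longrightarrow> z \<in> S \<Longrightarrow> L (c *\<^sub>R u) z = c * L u z"
  shows "linear_on_space V (\<lambda>u. integral S (L u))"
  unfolding linear_on_space_def
proof (intro conjI ballI allI)
  have i: "L u integrable_on S" if "u \<in> V" for u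
    by (rule compact_continuous_integrable(2)[OF assms(1) c[OF that]])
  fix u w assume "u \<in> V" "w \<in> V"
  have "integral S (L (u + w)) = integral S (\<lambda>z. L u z + L w z)"
    by (rule Henstock_Kurzweil_Integration.integral_cong) (rule add[OF \<open>u \<in> V\<close> \<open>w \<in> V\<close>])
  then show "integral S (L (u + w)) = integral S (L u) + integral S (L w)"
    using integral_add[OF i[OF \<open>u \<in> V\<close>] i[OF \<open>w \<in> V\<close>]] by simp
next
  fix c u assume "u \<in> V"
  have "integral S (L (c *\<^sub>R u)) = integral S (\<lambda>z. c * L u z)"
    by (rule Henstock_Kurzweil_Integration.integral_cong) (rule scale[OF \<open>u \<in> V\<close>])
  then show "integral S (L (c *\<^sub>R u)) = c *\<^sub>R integral S (L u)" by simp
qed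

text \<open>Members of \<open>poly_on\<close> may be discontinuous on the whole space, being zero
  off \<open>T\<close>. On the parametrized set they agree with a polynomial, which gives
  integrability.\<close>

lemma linear_on_space_poly_on_pairing:
  fixes \<phi> :: "'b::euclidean_space \<Rightarrow> real^3"
  assumes S: "compact S" and \<phi>: "continuous_on S \<phi>" "\<phi> ` S \<subseteq> T" and h: "continuous_on UNIV h"
  shows "linear_on_space (poly_on m T) (\<lambda>q. integral S (\<lambda>z. h (\<phi> z) * q (\<phi> z)))"
proof (rule linear_on_space_integral[OF S])
  fix q assume "q \<in> poly_on m T"
  then obtain p where p: "p \<in> poly_space m" "q = restrict_field T p" by (auto simp: poly_on_eq)
  have "continuous_on S (\<lambda>z. h (\<phi> z) * p (\<phi> z))"
    by (intro continuous_on_mult continuous_on_compose2[OF h \<phi>(1)]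
        continuous_on_compose2[OF polynomials_continuous[OF poly_space_polynomials[OF p(1)], of UNIV] \<phi>(1)]) auto
  moreover have "h (\<phi> z) * q (\<phi> z) = h (\<phi> z) * p (\<phi> z)" if "z \<in> S" for z
    using that \<phi>(2) by (auto simp: p(2) restrict_field_def)
  ultimately show "continuous_on S (\<lambda>z. h (\<phi> z) * q (\<phi> z))"
    using continuous_on_cong by (metis (no_types, lifting))
qed (simp_all add: algebra_simps)

text \<open>The degrees of freedom test against a basis of restrictions, whereas the arguments below
  test against arbitrary polynomials; this is the passage between the two.\<close>

lemma pairing_vanishes:
  fixes \<phi> :: "'b::euclidean_space \<Rightarrow> real^3"
  assumes S: "compact S" and \<phi>: "continuous_on S \<phi>" "\<phi> ` S \<subseteq> T" and h: "continuous_on UNIV h"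
    and Q: "is_basis Q (poly_on m T)" "\<And>q. q \<in> Q \<Longrightarrow> integral S (\<lambda>z. h (\<phi> z) * q (\<phi> z)) = 0"
    and p: "p \<in> poly_space m"
  shows "integral S (\<lambda>z. h (\<phi> z) * p (\<phi> z)) = 0"
proof -
  have "integral S (\<lambda>z. h (\<phi> z) * restrict_field T p (\<phi> z)) = 0"
    by (rule linear_on_space_basis_0[OF linear_on_space_poly_on_pairing[OF S \<phi> h] subspace_poly_on Q])
      (use p in \<open>simp_all add: poly_on_eq\<close>)
  moreover have "integral S (\<lambda>z. h (\<phi> z) * restrict_field T p (\<phi> z)) = integral S (\<lambda>z. h (\<phi> z) * p (\<phi> z))"
    by (rule Henstock_Kurzweil_Integration.integral_cong) (use \<phi>(2) in \<open>auto simp: restrict_field_def\<close>)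
  ultimately show ?thesis by simp
qed

text \<open>With \<open>q\<close> as test function the integrand is w q^2 \<ge> 0, so it vanishes
  pointwise, and then so does \<open>p\<close>. The parametrization \<open>\<phi>\<close> lets the
  same argument serve edges, faces and the tetrahedron.\<close>

lemma weighted_square_pairing:
  fixes \<phi> :: "'b::euclidean_space \<Rightarrow> real^3"
  assumes S: "compact S" "convex S" "interior S \<noteq> {}" and \<phi>: "continuous_on S \<phi>"
    and cont: "continuous_on UNIV p" "continuous_on UNIV q"
    and b: "\<And>z. z \<in> S \<Longrightarrow> 0 \<le> w (\<phi> z)" "\<And>z. z \<in> S \<Longrightarrow> p (\<phi> z) = w (\<phi> z) * q (\<phi> z)"
    and I: "integral S (\<lambda>z. p (\<phi> z) * q (\<phi> z)) = 0" and z: "z \<in> S"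
  shows "p (\<phi> z) = (0::real)"
proof -
  have "p (\<phi> z) * q (\<phi> z) = 0"
  proof (rule integral_0_imp_0[OF S _ _ I z])
    show "continuous_on S (\<lambda>z. p (\<phi> z) * q (\<phi> z))"
      by (intro continuous_on_mult continuous_on_compose2[OF cont(1) \<phi>] continuous_on_compose2[OF cont(2) \<phi>]) auto
    fix y assume "y \<in> S"
    then have "p (\<phi> y) * q (\<phi> y) = w (\<phi> y) * (q (\<phi> y))\<^sup>2" "0 \<le> w (\<phi> y)" using b by (simp_all add: power2_eq_square)
    then show "0 \<le> p (\<phi> y) * q (\<phi> y)" by simp
  qed
  then show ?thesis using b(2)[OF z] by auto
qed

section \<open>Parametrized edges and faces\<close>

definition edge_param :: "(nat \<Rightarrow> real^3) \<Rightarrow> nat \<times> nat \<Rightarrow> real \<Rightarrow> real^3" where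
  "edge_param v = (\<lambda>(a, b) s. v a + s *\<^sub>R (v b - v a))"

definition face_param :: "(nat \<Rightarrow> real^3) \<Rightarrow> nat \<times> nat \<times> nat \<Rightarrow> real \<times> real \<Rightarrow> real^3" where
  "face_param v = (\<lambda>(a, b, c) (s, t). v a + s *\<^sub>R (v b - v a) + t *\<^sub>R (v c - v a))"

lemma continuous_edge_param: "continuous_on S (edge_param v e)"
  unfolding edge_param_def case_prod_unfold by (intro continuous_intros)

lemma continuous_face_param: "continuous_on S (face_param v f)"
  unfolding face_param_def case_prod_unfold by (intro continuous_intros)

lemma edge_integral_eq:
  "edge_integral v e g = norm (v (snd e) - v (fst e)) * integral {0..1} (\<lambda>s. g (edge_param v e s))"
  by (simp add: edge_integral_def edge_param_def case_prod_unfold mult.commute)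

lemma face_integral_eq:
  "face_integral v f g = norm (cross3 (v (fst (snd f)) - v (fst f)) (v (snd (snd f)) - v (fst f)))
     * integral unit_triangle (\<lambda>p. g (face_param v f p))"
proof -
  have "unit_triangle = {(s, t). 0 \<le> s \<and> 0 \<le> t \<and> s + t \<le> 1}" by (simp add: unit_triangle_def)
  then show ?thesis
    by (simp add: face_integral_def face_param_def case_prod_unfold mult.commute)
qed

lemma tetra_edges_eq: "tetra_edges = {(0, 1), (0, 2), (0, 3), (1, 2), (1, 3), (2, 3)}"
  unfolding tetra_edges_def by (auto simp: less_Suc_eq numeral_eq_Suc)

lemma tetra_faces_eq: "tetra_faces = {(0, 1, 2), (0, 1, 3), (0, 2, 3), (1, 2, 3)}"
  unfolding tetra_faces_def by (auto simp: less_Suc_eq numeral_eq_Suc)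

context tetrahedron
begin

lemma lam_edge_param: "i < 4 \<Longrightarrow> lam i (edge_param v e s) = lam i (v (fst e)) + s * (lam i (v (snd e)) - lam i (v (fst e)))"
  by (simp add: edge_param_def case_prod_unfold lam_affine_line)

lemma lam_face_param: "i < 4 \<Longrightarrow> lam i (face_param v f p) = lam i (v (fst f))
    + fst p * (lam i (v (fst (snd f))) - lam i (v (fst f))) + snd p * (lam i (v (snd (snd f))) - lam i (v (fst f)))"
  by (simp add: face_param_def case_prod_unfold lam_affine_line)

lemma edge_simplex:
  assumes "e \<in> tetra_edges"
  shows "edge_set v e = face_simplex ({..<4} - {fst e, snd e})"
    and "edge_param v e ` {0..1} = edge_set v e"
proof -
  obtain a b where e: "e = (a, b)" "a < b" "b < 4" using assms by (auto simp: tetra_edges_def)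
  show "edge_set v e = face_simplex ({..<4} - {fst e, snd e})"
    using convex_hull_vertices[of "{a, b}"] e by (simp add: edge_set_def)
  have "edge_param v e ` {0..1} = closed_segment (v a) (v b)"
    unfolding closed_segment_def by (auto simp: e edge_param_def image_def algebra_simps)
  then show "edge_param v e ` {0..1} = edge_set v e"
    by (simp add: e edge_set_def segment_convex_hull)
qed

lemma face_simplex_face:
  assumes "f \<in> tetra_faces" "i < 4" "i \<notin> {fst f, fst (snd f), snd (snd f)}"
  shows "face_set v f = face_simplex {i}"
    and "face_param v f ` unit_triangle = face_set v f"
proof -
  obtain a b c where f: "f = (a, b, c)" "a < b" "b < c" "c < 4" using assms by (auto simp: tetra_faces_def)
  have sub: "{a, b, c} \<subseteq> {..<4}" using f assms by auto
  have "card ({..<4} - {a, b, c}) = 1" using f by (simp add: card_Diff_subset)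
  moreover have "i \<in> {..<4} - {a, b, c}" using assms f by simp
  ultimately have i: "{..<4} - {a, b, c} = {i}" by (metis card_1_singletonE singletonD)
  show fs: "face_set v f = face_simplex {i}"
    using convex_hull_vertices[of "{a, b, c}"] f i by (simp add: face_set_def)
  have sum: "(\<Sum>j<4. k j) = k i + k a + k b + k c" for k :: "nat \<Rightarrow> 'z::comm_monoid_add"
  proof -
    have "{..<4} = {i, a, b, c}" using i sub by blast
    moreover have "i \<notin> {a, b, c}" "a \<noteq> b" "a \<noteq> c" "b \<noteq> c" using f assms by simp_all
    ultimately show ?thesis by (simp add: add.assoc)
  qed
  show "face_param v f ` unit_triangle = face_set v f"
  proof
    show "face_param v f ` unit_triangle \<subseteq> face_set v f"
      using f assms unfolding fs by (auto simp: face_simplex_def lam_face_param lam_vertex unit_triangle_def)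
    show "face_set v f \<subseteq> face_param v f ` unit_triangle"
    proof
      fix x assume "x \<in> face_set v f"
      then have x: "lam i x = 0" "\<And>j. j < 4 \<Longrightarrow> 0 \<le> lam j x" by (auto simp: fs face_simplex_def)
      have 1: "lam a x = 1 - lam b x - lam c x" using lam_sum[of x] x by (simp add: sum)
      have "x = lam a x *\<^sub>R v a + lam b x *\<^sub>R v b + lam c x *\<^sub>R v c"
        using lam_point[of x] x(1) by (simp add: sum)
      then have "x = face_param v f (lam b x, lam c x)"
        by (simp add: f face_param_def 1 algebra_simps)
      moreover have "0 \<le> lam a x" "0 \<le> lam b x" "0 \<le> lam c x" using x(2) f by auto
      then have "(lam b x, lam c x) \<in> unit_triangle" by (simp add: unit_triangle_def 1)
      ultimately show "x \<in> face_param v f ` unit_triangle" by blast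
    qed
  qed
qed

text \<open>The degrees m - 2, m - 3 and m - 4 are those of the cofactors on edges, faces and the
  tetrahedron, where two, three and four coordinates are split off. The hypotheses thus admit
  exactly the test functions that the argument produces.\<close>

lemma bubble_division:
  assumes p: "p \<in> poly_space m"
    and V: "\<And>i. i < 4 \<Longrightarrow> p (v i) = 0"
    and E: "\<And>e q. e \<in> tetra_edges \<Longrightarrow> q \<in> poly_space (m - 2) \<Longrightarrow>
      integral {0..1} (\<lambda>s. p (edge_param v e s) * q (edge_param v e s)) = 0"
    and F: "\<And>f q. f \<in> tetra_faces \<Longrightarrow> q \<in> poly_space (m - 3) \<Longrightarrow>
      integral unit_triangle (\<lambda>z. p (face_param v f z) * q (face_param v f z)) = 0"
  shows "\<exists>q\<in>poly_space (m - 4). \<forall>x\<in>tetra v. p x = (\<Prod>i<4. lam i x) * q x"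
proof -
  have cont: "continuous_on UNIV q" if "q \<in> poly_space j" for q j
    using polynomials_continuous poly_space_polynomials that by blast
  have nonneg: "0 \<le> (\<Prod>j\<in>{..<4} - I. lam j x)" if "x \<in> face_simplex I" for I x
    using that by (intro prod_nonneg) (auto simp: face_simplex_def)
  have edge0: "p x = 0" if e: "e \<in> tetra_edges" and x: "x \<in> edge_set v e" for e x
  proof -
    obtain a b where ab: "e = (a, b)" "a < b" "b < 4" using e by (auto simp: tetra_edges_def)
    let ?I = "{..<4} - {a, b}"
    have S: "edge_set v e = face_simplex ?I" using edge_simplex(1)[OF e] by (simp add: ab)
    have cI: "card ?I = 2" using ab by (simp add: card_Diff_subset)
    have "\<exists>q\<in>poly_space (m - int (4 - card ?I)). \<forall>x\<in>face_simplex ?I. p x = (\<Prod>j\<in>{..<4} - ?I. lam j x) * q x"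
    proof (rule face_simplex_bubble_division[OF p])
      fix j x assume j: "j \<in> {..<4} - ?I" and x: "x \<in> face_simplex (insert j ?I)"
      \<comment> \<open>On an edge, the vanishing of one of its two coordinates leaves only the
        other endpoint.\<close>
      define d where "d = (if j = a then b else a)"
      have "insert j ?I = {..<4} - {d}" "d < 4" using j ab by (auto simp: d_def)
      then have "x = v d" using x face_simplex_vertex[of d] by simp
      then show "p x = 0" using V \<open>d < 4\<close> by simp
    qed (use cI in auto)
    then obtain q where q: "q \<in> poly_space (m - 2)"
      "\<And>x. x \<in> face_simplex ?I \<Longrightarrow> p x = (\<Prod>j\<in>{..<4} - ?I. lam j x) * q x" by (auto simp: cI)
    obtain s where s: "s \<in> {0..1}" "x = edge_param v e s" using x edge_simplex(2)[OF e] by blast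
    have mem: "edge_param v e s \<in> face_simplex ?I" if "s \<in> {0..1}" for s
      using that edge_simplex(2)[OF e] S by blast
    show ?thesis unfolding s(2)
      by (rule weighted_square_pairing[OF _ _ _ continuous_edge_param cont[OF p] cont[OF q(1)] _ _ E[OF e q(1)] s(1),
            where w = "\<lambda>x. \<Prod>j\<in>{..<4} - ?I. lam j x"])
        (use mem q(2) nonneg in auto)
  qed
  have face0: "p x = 0" if f: "f \<in> tetra_faces" and i: "i < 4" "i \<notin> {fst f, fst (snd f), snd (snd f)}"
    and x: "x \<in> face_simplex {i}" for f i x
  proof -
    have S: "face_set v f = face_simplex {i}" "face_param v f ` unit_triangle = face_set v f"
      using face_simplex_face[OF f i] by auto
    have "\<exists>q\<in>poly_space (m - int (4 - card {i})). \<forall>x\<in>face_simplex {i}. p x = (\<Prod>j\<in>{..<4} - {i}. lam j x) * q x"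
    proof (rule face_simplex_bubble_division[OF p])
      fix j x assume j: "j \<in> {..<4} - {i}" and x: "x \<in> face_simplex (insert j {i})"
      have "card ({..<4} - {i, j}) = 2" using i j by (simp add: card_Diff_subset)
      then obtain a b where ab: "{..<4} - {i, j} = {a, b}" "a < b"
        by (metis card_2_iff insert_commute linorder_neqE_nat)
      then have "b < 4" by (metis Diff_iff insertI1 insertI2 lessThan_iff)
      then have e: "(a, b) \<in> tetra_edges" using ab by (simp add: tetra_edges_def)
      \<comment> \<open>Two vanishing coordinates single out the edge that joins the other two
        vertices.\<close>
      have "insert j {i} = {..<4} - {a, b}" using ab i j by auto
      then have "x \<in> edge_set v (a, b)" using x edge_simplex(1)[OF e] by simp
      then show "p x = 0" using edge0[OF e] by blast
    qed (use i in auto)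
    then obtain q where q: "q \<in> poly_space (m - 3)"
      "\<And>x. x \<in> face_simplex {i} \<Longrightarrow> p x = (\<Prod>j\<in>{..<4} - {i}. lam j x) * q x" by auto
    obtain z where z: "z \<in> unit_triangle" "x = face_param v f z" using x S by blast
    have mem: "face_param v f z \<in> face_simplex {i}" if "z \<in> unit_triangle" for z
      using that S by blast
    show ?thesis unfolding z(2)
      by (rule weighted_square_pairing[OF unit_triangle continuous_face_param cont[OF p] cont[OF q(1)] _ _ F[OF f q(1)] z(1),
            where w = "\<lambda>x. \<Prod>j\<in>{..<4} - {i}. lam j x"])
        (use mem q(2) nonneg in auto)
  qed
  have "\<exists>q\<in>poly_space (m - int (4 - card ({} :: nat set))). \<forall>x\<in>face_simplex {}. p x = (\<Prod>j\<in>{..<4} - {}. lam j x) * q x"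
  proof (rule face_simplex_bubble_division[OF p])
    fix j x assume j: "j \<in> {..<4} - {}" and x: "x \<in> face_simplex (insert j {})"
    define f :: "nat \<times> nat \<times> nat" where "f = (if j = 0 then (1, 2, 3) else if j = 1 then (0, 2, 3) else if j = 2 then (0, 1, 3) else (0, 1, 2 :: nat))"
    have "f \<in> tetra_faces" "j \<notin> {fst f, fst (snd f), snd (snd f)}"
      using j by (auto simp: f_def tetra_faces_eq)
    then show "p x = 0" using face0[of f j x] j x by simp
  qed auto
  then show ?thesis by (simp add: tetra_eq)
qed

end

section \<open>Dimension counts and change of variables\<close>

lemma poincare_linear:
  assumes "S \<subseteq> polynomials"
  shows "linear_on_space S poincare"
proof -
  have int: "(\<lambda>t. (t\<^sup>2 * p (t *\<^sub>R x)) *\<^sub>R x) integrable_on {0..1}" if "p \<in> S" for p and x :: "real^3"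
  proof -
    have "continuous_on {0..1} (\<lambda>t. p (t *\<^sub>R x))"
      by (rule continuous_on_compose2[OF polynomials_continuous[of p UNIV]])
        (use that assms in \<open>auto intro!: continuous_intros\<close>)
    then show ?thesis by (intro integrable_continuous_interval continuous_intros)
  qed
  show ?thesis
    unfolding linear_on_space_def
  proof (intro conjI ballI allI ext)
    fix p q x assume "p \<in> S" "q \<in> S"
    then show "poincare (p + q) x = (poincare p + poincare q) x"
      using integral_add[OF int[of p x] int[of q x]] by (simp add: poincare_def algebra_simps)
  next
    fix c p and x :: "real^3" assume p: "p \<in> S"
    have "poincare (c *\<^sub>R p) x = integral {0..1} (\<lambda>t. c *\<^sub>R (t\<^sup>2 * p (t *\<^sub>R x)) *\<^sub>R x)"
      by (simp add: poincare_def mult.left_commute)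
    also have "\<dots> = c *\<^sub>R integral {0..1} (\<lambda>t. (t\<^sup>2 * p (t *\<^sub>R x)) *\<^sub>R x)" by (rule integral_cmul)
    finally show "poincare (c *\<^sub>R p) x = (c *\<^sub>R poincare p) x" by (simp only: poincare_def scaleR_fun_apply)
  qed
qed

lemma poincare_polynomials:
  assumes "p \<in> polynomials"
  shows "poincare p \<in> vec_polynomials" "divergence (poincare p) = p"
proof -
  obtain m where "p \<in> poly_space m" using assms by (auto simp: polynomials_def)
  then obtain g where g: "g \<in> poly_space m" "poincare p = (\<lambda>x. g x *\<^sub>R x)" "divergence (poincare p) = p"
    using poincare_space by blast
  show "poincare p \<in> vec_polynomials"
    unfolding g(2) by (intro vec_polynomials_scale vec_polynomials_id poly_space_polynomials[OF g(1)])
  show "divergence (poincare p) = p" by (rule g(3))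
qed

lemma vec_poly_space_image:
  "vec_poly_space m = (\<lambda>(p, q, r). (\<lambda>x. vector [p x, q x, r x] :: real^3)) ` (poly_space m \<times> poly_space m \<times> poly_space m)"
proof (intro equalityI subsetI)
  fix u assume u: "u \<in> vec_poly_space m"
  have "u = (\<lambda>x. vector [u x $ 1, u x $ 2, u x $ 3])" by (simp add: fun_eq_iff vec_eq_iff forall_3)
  then show "u \<in> (\<lambda>(p, q, r). (\<lambda>x. vector [p x, q x, r x])) ` (poly_space m \<times> poly_space m \<times> poly_space m)"
    using u unfolding vec_poly_space_def
    by (intro image_eqI[of _ _ "(\<lambda>x. u x $ 1, \<lambda>x. u x $ 2, \<lambda>x. u x $ 3)"]) auto
qed (auto simp: vec_poly_space_def forall_3)

lemma fin_dim_vec_poly_space: "fin_dim (vec_poly_space m)"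
  and dim_vec_poly_space: "dim (vec_poly_space m) = 3 * dim (poly_space m)"
proof -
  let ?P = "poly_space m" and ?f = "\<lambda>(p, q, r). (\<lambda>x. vector [p x, q x, r x] :: real^3)"
  have lin: "linear_on_space (?P \<times> ?P \<times> ?P) ?f"
    by (auto simp: linear_on_space_def fun_eq_iff vec_eq_iff forall_3)
  have s: "subspace (?P \<times> ?P \<times> ?P)" "fin_dim (?P \<times> ?P \<times> ?P)" "dim (?P \<times> ?P \<times> ?P) = 3 * dim ?P"
    by (simp_all add: subspace_Times dim_Times_real_vector subspace_poly_space fin_dim_poly_space)
  show "fin_dim (vec_poly_space m)"
    unfolding vec_poly_space_image by (rule fin_dim_image[OF s(1) lin s(2)])
  have "dim (?f ` (?P \<times> ?P \<times> ?P)) = dim (?P \<times> ?P \<times> ?P)"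
  proof (rule dim_inj_image[OF s(1,2) lin])
    fix z assume z: "?f z = 0"
    have "vector [fst z x, fst (snd z) x, snd (snd z) x] = (0 :: real^3)" for x
      using fun_cong[OF z, of x] by (simp add: case_prod_unfold)
    then have "fst z x = 0 \<and> fst (snd z) x = 0 \<and> snd (snd z) x = 0" for x
      by (simp add: vec_eq_iff forall_3)
    then show "z = 0" by (simp add: prod_eq_iff fun_eq_iff)
  qed
  then show "dim (vec_poly_space m) = 3 * dim ?P" unfolding vec_poly_space_image s(3) .
qed

lemma subspace_div_free: "subspace (div_free m)"
  unfolding div_free_def
  by (rule subspace_linear_on_space_kernel[OF subspace_vec_poly_space linear_on_space_divergence])
    (use vec_poly_space_polynomials in blast)

text \<open>Rank-nullity for the divergence, which is onto by the Poincare operator: this raises the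
  degree by the same one that the divergence lowers it.\<close>

lemma dim_div_free: "dim (div_free m) + dim (poly_space (m - 1)) = 3 * dim (poly_space m)"
proof -
  have "divergence ` vec_poly_space m = poly_space (m - 1)"
  proof
    show "divergence ` vec_poly_space m \<subseteq> poly_space (m - 1)" using divergence_space by blast
    show "poly_space (m - 1) \<subseteq> divergence ` vec_poly_space m"
    proof
      fix p assume "p \<in> poly_space (m - 1)"
      then obtain g where g: "g \<in> poly_space (m - 1)" "poincare p = (\<lambda>x. g x *\<^sub>R x)" "divergence (poincare p) = p"
        using poincare_space by blast
      have "(\<lambda>x. g x * x $ i) \<in> poly_space m" for i
        using poly_space_coordinate_mult[OF g(1), of i] by (simp add: mult.commute)
      then have "poincare p \<in> vec_poly_space m" by (simp add: vec_poly_space_def g(2))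
      then show "p \<in> divergence ` vec_poly_space m" using g(3) by (metis imageI)
    qed
  qed
  moreover have "linear_on_space (vec_poly_space m) divergence"
    by (rule linear_on_space_divergence) (use vec_poly_space_polynomials in blast)
  ultimately show ?thesis
    using dim_rank_nullity[OF subspace_vec_poly_space fin_dim_vec_poly_space, of m divergence]
    by (simp add: dim_vec_poly_space div_free_def)
qed

text \<open>The kernel of the gradient consists of the constants; this is the source of the
  corrections by one in the final count.\<close>

lemma dim_grad_poly_space:
  assumes "m \<ge> 0"
  shows "dim (grad ` poly_space m) + 1 = dim (poly_space m)"
proof -
  have "{p \<in> poly_space m. grad p = 0} = span {\<lambda>_. 1}"
  proof (intro equalityI subsetI)
    fix p assume "p \<in> {p \<in> poly_space m. grad p = 0}"
    then have p: "p \<in> polynomials" "grad p = 0" using poly_space_polynomials by auto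
    have "\<exists>c. \<forall>x\<in>UNIV. p x = c"
      by (rule has_derivative_zero_constant[OF convex_UNIV])
        (use polynomials_has_derivative[OF p(1)] p(2) in simp)
    then obtain c where "p = c *\<^sub>R (\<lambda>_. 1)" by (auto simp: scaleR_fun_def)
    then show "p \<in> span {\<lambda>_. 1}" by (simp add: span_scale span_base)
  next
    fix p assume "p \<in> span {\<lambda>_::real^3. 1::real}"
    then obtain c where p: "p = (\<lambda>_. c)" by (auto simp: span_singleton scaleR_fun_def)
    show "p \<in> {p \<in> poly_space m. grad p = 0}"
      using poly_space_const[OF assms, of c] by (simp add: p fun_eq_iff grad_const)
  qed
  moreover have "dim (span {\<lambda>_::real^3. 1::real}) = 1"
  proof -
    have "(\<lambda>_::real^3. 1::real) \<noteq> 0" by (simp add: fun_eq_iff)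
    then have "independent {\<lambda>_::real^3. 1::real}" by simp
    from dim_span_eq_card_independent[OF this] show ?thesis by simp
  qed
  ultimately show ?thesis
    using dim_rank_nullity[OF subspace_poly_space fin_dim_poly_space linear_on_space_grad, of m] by simp
qed

lemma subspace_grad_image: "subspace (grad ` poly_space m)"
  by (rule subspace_linear_on_space_image[OF subspace_poly_space linear_on_space_grad])

lemma fin_dim_grad_image: "fin_dim (grad ` poly_space m)"
  by (rule fin_dim_image[OF subspace_poly_space linear_on_space_grad fin_dim_poly_space])

lemma is_basis_card:
  assumes "is_basis Q S" "fin_dim S"
  shows "finite Q" "card Q = dim S"
proof -
  have Q: "Q \<subseteq> S" "independent Q" "S \<subseteq> span Q" using assms(1) by (auto simp: is_basis_def)
  show "finite Q" using fin_dim_finite_independent[OF assms(2) Q(1,2)] .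
  show "card Q = dim S" using basis_card_eq_dim[OF Q(1,3,2)] .
qed

lemma complement_space:
  assumes "is_complement C (grad ` poly_space (r - 1)) (vec_poly_space (r - 2))" "r \<ge> 1"
  shows "C \<subseteq> vec_poly_space (r - 2)" "subspace C" "fin_dim C"
    "dim C + dim (poly_space (r - 1)) = 3 * dim (poly_space (r - 2)) + 1"
proof -
  let ?G = "grad ` poly_space (r - 1)"
  have C: "subspace C" "C \<inter> ?G = {0}" "C \<oplus>\<^sub>s ?G = vec_poly_space (r - 2)"
    using assms(1) by (auto simp: is_complement_def)
  show "subspace C" by (rule C(1))
  show sub: "C \<subseteq> vec_poly_space (r - 2)"
  proof
    fix x assume "x \<in> C"
    then have "x + 0 \<in> C \<oplus>\<^sub>s ?G" using subspace_0[OF subspace_grad_image] unfolding set_sum_def by blast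
    then show "x \<in> vec_poly_space (r - 2)" using C(3) by simp
  qed
  show fd: "fin_dim C" using fin_dim_subset[OF fin_dim_vec_poly_space sub] .
  have "dim (C \<oplus>\<^sub>s ?G) = dim C + dim ?G"
    by (rule dim_set_sum[OF C(1) subspace_grad_image fd fin_dim_grad_image]) (use C(2) in simp)
  then show "dim C + dim (poly_space (r - 1)) = 3 * dim (poly_space (r - 2)) + 1"
    using dim_grad_poly_space[of "r - 1"] assms(2) by (simp add: C(3) dim_vec_poly_space)
qed

section \<open>Reference map and push-forward of test fields\<close>

context tetrahedron
begin

text \<open>A singular \<open>B\<close> leaves a nonzero \<open>x\<close> orthogonal to its range,
  so all vertices lie in one plane orthogonal to \<open>x\<close>. Expanding \<open>x\<close> along
  the vertices with coefficients of sum zero then shows that \<open>x\<close> is orthogonal to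
  itself.\<close>

lemma reference_map_invertible:
  assumes "reference_map v B b"
  shows "invertible B"
proof (rule ccontr)
  assume "\<not> invertible B"
  have "L ** transpose B \<noteq> mat 1" for L
  proof
    assume "L ** transpose B = mat 1"
    then have "transpose (L ** transpose B) = mat 1" by simp
    then have "B ** transpose L = mat 1" by (simp add: matrix_transpose_mul)
    then show False using \<open>\<not> invertible B\<close> invertible_right_inverse by blast
  qed
  then obtain x where x: "x \<noteq> 0" "transpose B *v x = 0"
    using matrix_left_invertible_ker by blast
  have "v i \<bullet> x = b \<bullet> x" if "i < 4" for i
  proof -
    have "v i \<in> tetra v" unfolding tetra_def using that by (intro hull_inc) simp
    then obtain y where "v i = B *v y + b" using assms unfolding reference_map_def by blast
    moreover have "(B *v y) \<bullet> x = 0"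
      using x(2) by (simp add: inner_commute[of _ x] flip: dot_lmul_matrix)
    ultimately show ?thesis by (simp add: inner_add_left)
  qed
  then have "x \<bullet> x = (\<Sum>i<4. (lam_grad i \<bullet> x) * (b \<bullet> x))"
    by (subst (1) lam_grad_point[of x, symmetric]) (simp add: inner_sum_left)
  also have "\<dots> = 0" by (simp add: lam_grad_sum flip: sum_distrib_right)
  finally show False using x(1) by simp
qed

end

lemma push_forward_linear:
  "push_forward B b (q + q') x = push_forward B b q x + push_forward B b q' x"
  "push_forward B b (c *\<^sub>R q) x = c *\<^sub>R push_forward B b q x"
  by (simp_all only: push_forward_def plus_fun_apply scaleR_fun_apply
      linear_add[OF matrix_vector_mul_linear] linear_scale[OF matrix_vector_mul_linear])

lemma poly_space_matrix_affine: "(\<lambda>x. (A *v x + c) $ i) \<in> poly_space 1"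
  unfolding matrix_vector_mult_def
  by (simp, intro poly_space_add poly_space_sum poly_space_cmult poly_space_coordinate poly_space_const) auto

lemma vec_poly_space_matrix:
  assumes "q \<in> vec_poly_space m"
  shows "(\<lambda>x. A *v q (M *v x + c)) \<in> vec_poly_space m"
proof -
  have "(\<lambda>x. q (M *v x + c) $ j) \<in> poly_space m" for j
    by (rule poly_space_compose_affine[OF _ poly_space_matrix_affine])
      (use assms in \<open>simp add: vec_poly_space_def\<close>)
  then show ?thesis
    by (simp add: vec_poly_space_def matrix_vector_mult_def poly_space_sum poly_space_cmult)
qed

lemma push_forward_eq:
  "push_forward B b q = (\<lambda>x. transpose (matrix_inv B) *v q (matrix_inv B *v x + - (matrix_inv B *v b)))"
  by (simp add: push_forward_def matrix_vector_mult_diff_distrib)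

lemma push_forward_space: "q \<in> vec_poly_space m \<Longrightarrow> push_forward B b q \<in> vec_poly_space m"
  unfolding push_forward_eq by (rule vec_poly_space_matrix)

text \<open>The preimage is the pull-back with \<open>transpose B\<close>.\<close>

lemma push_forward_onto:
  assumes "invertible B" "u \<in> vec_poly_space m"
  shows "\<exists>q\<in>vec_poly_space m. push_forward B b q = u"
proof
  show "(\<lambda>y. transpose B *v u (B *v y + b)) \<in> vec_poly_space m"
    by (rule vec_poly_space_matrix[OF assms(2)])
  have "B ** matrix_inv B = mat 1"
    using someI_ex[OF assms(1)[unfolded invertible_def]] unfolding matrix_inv_def by blast
  moreover from this have "transpose (matrix_inv B) ** transpose B = mat 1"
    by (simp flip: matrix_transpose_mul)
  ultimately show "push_forward B b (\<lambda>y. transpose B *v u (B *v y + b)) = u"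
    by (simp add: push_forward_def fun_eq_iff matrix_vector_mul_assoc del: transpose_matrix_vector)
qed

text \<open>The inverse transpose is the transformation law of covectors: by the chain rule,
  gradients on the reference tetrahedron become gradients on the actual one.\<close>

lemma push_forward_grad_eq:
  assumes p: "p \<in> poly_space m"
  shows "push_forward B b (grad p) = grad (\<lambda>x. p (matrix_inv B *v x + - (matrix_inv B *v b)))"
proof
  fix x
  let ?N = "matrix_inv B"
  let ?p = "\<lambda>x. p (?N *v x + - (?N *v b))"
  have "((\<lambda>x. ?N *v x + - (?N *v b)) has_derivative (\<lambda>h. ?N *v h)) (at x)"
    by (auto intro!: derivative_eq_intros bounded_linear_imp_has_derivative matrix_vector_mul_bounded_linear)
  from has_derivative_compose[OF this polynomials_has_derivative[OF poly_space_polynomials[OF p]]]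
  have "(?p has_derivative (\<lambda>h. grad p (?N *v x + - (?N *v b)) \<bullet> (?N *v h))) (at x)" .
  then have "(?p has_derivative (\<lambda>h. (transpose ?N *v grad p (?N *v x + - (?N *v b))) \<bullet> h)) (at x)"
    by (simp add: dot_lmul_matrix)
  from grad_eqI[OF this] show "push_forward B b (grad p) x = grad ?p x"
    unfolding push_forward_eq by simp
qed

lemma push_forward_grad:
  assumes p: "p \<in> poly_space m"
  shows "\<exists>p'\<in>poly_space m. push_forward B b (grad p) = grad p'"
  using push_forward_grad_eq[OF p] poly_space_compose_affine[OF p poly_space_matrix_affine] by blast

lemma push_forward_grad_onto:
  assumes B: "invertible B" and p: "p \<in> poly_space m"
  shows "\<exists>p'\<in>poly_space m. push_forward B b (grad p') = grad p"
proof
  show p': "(\<lambda>y. p (B *v y + b)) \<in> poly_space m"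
    by (rule poly_space_compose_affine[OF p poly_space_matrix_affine])
  have "B ** matrix_inv B = mat 1"
    using someI_ex[OF B[unfolded invertible_def]] unfolding matrix_inv_def by blast
  then have "B *v (matrix_inv B *v x + - (matrix_inv B *v b)) + b = x" for x
    by (simp add: matrix_vector_mult_diff_distrib matrix_vector_mul_assoc)
  then show "push_forward B b (grad (\<lambda>y. p (B *v y + b))) = grad p"
    unfolding push_forward_grad_eq[OF p'] by (simp only:)
qed

section \<open>Injectivity of the degrees of freedom\<close>

context tetrahedron
begin

definition bubble :: scalar_field where
  "bubble = (\<lambda>x. \<Prod>i<4. lam i x)"

lemma bubble_poly_space: "bubble \<in> poly_space 4"
proof -
  have "(\<lambda>x. \<Prod>i\<in>A. lam i x) \<in> poly_space (int (card A))" if "finite A" "A \<subseteq> {..<4}" for A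
    using that
  proof (induction A rule: finite_induct)
    case empty
    then show ?case by (simp add: poly_space_one)
  next
    case (insert i A)
    then have "(\<lambda>x. lam i x * (\<Prod>i\<in>A. lam i x)) \<in> poly_space (1 + int (card A))"
      by (intro poly_space_mult lam_poly) auto
    then show ?case using insert by simp
  qed
  from this[of "{..<4}"] show ?thesis by (simp add: bubble_def)
qed

lemma bubble_eq_0: "i < 4 \<Longrightarrow> lam i x = 0 \<Longrightarrow> bubble x = 0"
  by (auto simp: bubble_def)

lemma bubble_nonneg: "x \<in> tetra v \<Longrightarrow> 0 \<le> bubble x"
  unfolding bubble_def tetra_eq by (intro prod_nonneg) (auto simp: face_simplex_def)

text \<open>Splitting off all four coordinates would leave a cofactor of negative degree, hence
  zero; but the bubble does not vanish at the barycenter.\<close>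

lemma bubble_notin_poly_space:
  assumes "m < 4"
  shows "bubble \<notin> poly_space m"
proof
  assume b: "bubble \<in> poly_space m"
  have "\<exists>q\<in>poly_space (m - int (4 - card ({} :: nat set))). \<forall>x\<in>face_simplex {}. bubble x = (\<Prod>j\<in>{..<4} - {}. lam j x) * q x"
    by (rule face_simplex_bubble_division[OF b]) (auto simp: face_simplex_def bubble_eq_0)
  then have "\<forall>x\<in>face_simplex {}. bubble x = 0" using assms by (simp add: poly_space_neg)
  moreover have "barycenter {..<4} \<in> face_simplex {}"
    by (auto simp: face_simplex_def lam_barycenter lessThan_empty_iff)
  moreover have "bubble (barycenter {..<4}) \<noteq> 0"
    by (auto simp: bubble_def lam_barycenter lessThan_empty_iff)
  ultimately show False by blast
qed

text \<open>\<open>Sigma_space\<close> in terms of the coordinates of the locale.\<close>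

definition Sigma :: "int \<Rightarrow> scalar_field set" where
  "Sigma k = (if k \<ge> 5 then poly_space (k - 1) else poly_space (k - 1) \<oplus>\<^sub>s span {bubble})"

lemma Sigma_decompose:
  assumes "s \<in> Sigma k"
  obtains p c where "p \<in> poly_space (k - 1)" "s = (\<lambda>x. p x + c * bubble x)" "k \<ge> 5 \<Longrightarrow> c = 0"
proof (cases "k \<ge> 5")
  case True
  then show ?thesis using that[of s 0] assms by (simp add: Sigma_def)
next
  case False
  then obtain p q where "p \<in> poly_space (k - 1)" "q \<in> span {bubble}" "s = p + q"
    using assms by (auto simp: Sigma_def set_sum_def)
  then show ?thesis using that[of p] False by (auto simp: span_singleton plus_fun_def scaleR_fun_def)
qed

lemma Sigma_polynomials: "Sigma k \<subseteq> polynomials"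
proof
  fix s assume "s \<in> Sigma k"
  then obtain p c where "p \<in> poly_space (k - 1)" "s = (\<lambda>x. p x + c * bubble x)"
    using Sigma_decompose by metis
  then show "s \<in> polynomials"
    using polynomials_add[OF poly_space_polynomials polynomials_mult[OF polynomials_const
      poly_space_polynomials[OF bubble_poly_space]]] by simp
qed

lemma subspace_Sigma: "subspace (Sigma k)"
  by (simp add: Sigma_def subspace_poly_space subspace_set_sum subspace_span)

lemma fin_dim_Sigma: "fin_dim (Sigma k)"
  by (simp add: Sigma_def fin_dim_poly_space fin_dim_set_sum subspace_poly_space fin_dim_span subspace_span)

lemma dim_Sigma: "dim (Sigma k) = dim (poly_space (k - 1)) + (if k \<ge> 5 then 0 else 1)"
proof (cases "k \<ge> 5")
  case False
  \<comment> \<open>For k < 5 the degree k - 1 is below that of the bubble, so the sum is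
    direct.\<close>
  have "poly_space (k - 1) \<inter> span {bubble} \<subseteq> {0}"
  proof
    fix p assume p: "p \<in> poly_space (k - 1) \<inter> span {bubble}"
    then obtain c where c: "p = c *\<^sub>R bubble" by (auto simp: span_singleton)
    have "c = 0"
    proof (rule ccontr)
      assume "c \<noteq> 0"
      then have "bubble = (1 / c) *\<^sub>R p" by (simp add: c)
      then have "bubble \<in> poly_space (k - 1)"
        using p subspace_scale[OF subspace_poly_space] by auto
      then show False using bubble_notin_poly_space[of "k - 1"] False by simp
    qed
    then show "p \<in> {0}" by (simp add: c)
  qed
  then have "dim (poly_space (k - 1) \<oplus>\<^sub>s span {bubble}) = dim (poly_space (k - 1)) + dim (span {bubble})"
    by (intro dim_set_sum) (simp_all add: subspace_poly_space fin_dim_poly_space fin_dim_span subspace_span)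
  moreover have "bubble \<noteq> 0" using bubble_notin_poly_space[of 0] poly_space_zero(1)[of 0] by auto
  then have "dim (span {bubble}) = card {bubble}" by (intro dim_span_eq_card_independent) simp
  ultimately show ?thesis using False by (simp add: Sigma_def)
qed (simp add: Sigma_def)

lemma tetra_body: "compact (tetra v)" "convex (tetra v)" "interior (tetra v) \<noteq> {}"
proof -
  show "compact (tetra v)" unfolding tetra_def by (rule finite_imp_compact_convex_hull) simp
  show "convex (tetra v)" unfolding tetra_def by (rule convex_convex_hull)
  have "{x. \<forall>i<4. lam i x > 0} \<subseteq> interior (tetra v)"
    by (rule interior_maximal[OF _ open_tetra_interior]) (auto simp: tetra_eq face_simplex_def less_imp_le)
  moreover have "barycenter {..<4} \<in> {x. \<forall>i<4. lam i x > 0}"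
    by (auto simp: lam_barycenter lessThan_empty_iff)
  ultimately show "interior (tetra v) \<noteq> {}" by blast
qed

text \<open>The inner product with \<open>n\<close> takes the same value at the three vertices of
  the face. In the expansion of a vector along the vertices, with coefficients of sum zero, only the
  opposite vertex contributes; so \<open>n\<close> is a multiple of \<open>lam_grad i\<close>, and a
  nonzero one because \<open>n\<close> has norm one.\<close>

lemma lam_grad_normal:
  assumes f: "f \<in> tetra_faces" and i: "i < 4" "i \<notin> {fst f, fst (snd f), snd (snd f)}"
    and n: "unit_normal v f n"
  obtains c where "lam_grad i = c *\<^sub>R n"
proof -
  obtain a b c where abc: "f = (a, b, c)" "a < b" "b < c" "c < 4" using f by (auto simp: tetra_faces_def)
  have n: "norm n = 1" "n \<bullet> v b = n \<bullet> v a" "n \<bullet> v c = n \<bullet> v a"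
    using n by (auto simp: unit_normal_def abc inner_diff_right)
  have "{a, b, c, i} = {..<4}"
    by (rule card_subset_eq) (use abc i in auto)
  then have all: "j \<in> {a, b, c, i}" if "j < 4" for j using that by blast
  define k where "k = n \<bullet> v i - n \<bullet> v a"
  have "n \<bullet> y = (k *\<^sub>R lam_grad i) \<bullet> y" for y
  proof -
    have "n \<bullet> y = (\<Sum>j<4. (lam_grad j \<bullet> y) * (n \<bullet> v j))"
      by (subst (1) lam_grad_point[of y, symmetric]) (simp add: inner_sum_right)
    also have "\<dots> = (\<Sum>j<4. (lam_grad j \<bullet> y) * (n \<bullet> v a) + (if j = i then (lam_grad i \<bullet> y) * k else 0))"
      by (rule sum.cong) (use all n(2,3) abc i in \<open>auto simp: k_def algebra_simps\<close>)
    also have "\<dots> = (lam_grad i \<bullet> y) * k"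
      using i(1) by (simp add: sum.distrib lam_grad_sum flip: sum_distrib_right)
    finally show ?thesis by simp
  qed
  then have nk: "n = k *\<^sub>R lam_grad i" using vector_eq_rdot by blast
  then have "k \<noteq> 0" using n(1) by auto
  then have "lam_grad i = (1 / k) *\<^sub>R n" using nk by simp
  then show ?thesis using that by blast
qed

text \<open>The divergence theorem for q u: on each face the flux against \<open>lam_grad i\<close>
  is a multiple of the normal moment of \<open>u\<close> against \<open>q\<close>, which vanishes by
  \<open>N\<close>.\<close>

lemma green_formula:
  assumes u: "u \<in> vec_polynomials" and q: "q \<in> polynomials"
    and n: "\<And>f. f \<in> tetra_faces \<Longrightarrow> unit_normal v f (n f)"
    and N: "\<And>f. f \<in> tetra_faces \<Longrightarrow> integral unit_triangle (\<lambda>z. (u (face_param v f z) \<bullet> n f) * q (face_param v f z)) = 0"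
  shows "integral (tetra v) (\<lambda>x. divergence u x * q x) = - integral (tetra v) (\<lambda>x. u x \<bullet> grad q x)"
proof -
  have tri: "triangle_integral a b c (\<lambda>x. (q x *\<^sub>R u x) \<bullet> lam_grad i) = 0"
    if f: "(a, b, c) \<in> tetra_faces" and i: "i < 4" "i \<notin> {a, b, c}" for a b c i
  proof -
    obtain k where k: "lam_grad i = k *\<^sub>R n (a, b, c)"
      using lam_grad_normal[OF f i(1) _ n[OF f]] i(2) by auto
    have "triangle_integral a b c (\<lambda>x. (q x *\<^sub>R u x) \<bullet> lam_grad i) =
        integral unit_triangle (\<lambda>z. k * ((u (face_param v (a, b, c) z) \<bullet> n (a, b, c)) * q (face_param v (a, b, c) z)))"
      unfolding triangle_integral_def triangle_param_def face_param_def k by (simp add: case_prod_unfold mult_ac)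
    then show ?thesis using N[OF f] by simp
  qed
  have "integral (tetra v) (divergence (\<lambda>x. q x *\<^sub>R u x)) = 0"
    by (rule divergence_theorem[OF vec_polynomials_scale[OF q u]])
      (rule tri; simp add: tetra_faces_eq)+
  moreover have "divergence (\<lambda>x. q x *\<^sub>R u x) = (\<lambda>x. divergence u x * q x + u x \<bullet> grad q x)"
    by (simp add: fun_eq_iff divergence_scale[OF q u] mult.commute)
  moreover have "(\<lambda>x. divergence u x * q x) integrable_on tetra v"
    by (rule compact_continuous_integrable(2)[OF tetra_body(1)])
      (intro polynomials_continuous polynomials_mult divergence_polynomials u q)
  moreover have "(\<lambda>x. u x \<bullet> grad q x) integrable_on tetra v"
  proof (rule compact_continuous_integrable(2)[OF tetra_body(1)])
    have "continuous_on (tetra v) (grad q)"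
      by (rule vec_polynomials_continuous) (simp add: vec_polynomials_def polynomials_grad q)
    then show "continuous_on (tetra v) (\<lambda>x. u x \<bullet> grad q x)"
      by (rule continuous_on_inner[OF vec_polynomials_continuous[OF u]])
  qed
  ultimately show ?thesis by (simp add: integral_add eq_neg_iff_add_eq_0)
qed

text \<open>On the tetrahedron \<open>div u\<close> is \<open>bubble * Q\<close>, and \<open>Q\<close> itself is an admissible test function
  after integration by parts; for \<open>k < 5\<close> it is constant.\<close>

lemma divergence_vanishes:
  assumes kr: "k \<ge> 2" "r \<ge> 1" "r \<ge> k - 1"
    and u: "u \<in> vec_polynomials" "divergence u \<in> Sigma k"
    and n: "\<And>f. f \<in> tetra_faces \<Longrightarrow> unit_normal v f (n f)"
    and V: "\<And>i. i < 4 \<Longrightarrow> divergence u (v i) = 0"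
    and E: "\<And>e q. e \<in> tetra_edges \<Longrightarrow> q \<in> poly_space (k - 3) \<Longrightarrow>
      integral {0..1} (\<lambda>s. divergence u (edge_param v e s) * q (edge_param v e s)) = 0"
    and F: "\<And>f q. f \<in> tetra_faces \<Longrightarrow> q \<in> poly_space (k - 4) \<Longrightarrow>
      integral unit_triangle (\<lambda>z. divergence u (face_param v f z) * q (face_param v f z)) = 0"
    and N: "\<And>f q. f \<in> tetra_faces \<Longrightarrow> q \<in> poly_space (r - 1) \<Longrightarrow>
      integral unit_triangle (\<lambda>z. (u (face_param v f z) \<bullet> n f) * q (face_param v f z)) = 0"
    and G: "\<And>p. k \<ge> 5 \<Longrightarrow> p \<in> poly_space (k - 5) \<Longrightarrow> integral (tetra v) (\<lambda>x. u x \<bullet> grad p x) = 0"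
  shows "divergence u = 0"
proof -
  obtain p c where p: "p \<in> poly_space (k - 1)" "divergence u = (\<lambda>x. p x + c * bubble x)" "k \<ge> 5 \<Longrightarrow> c = 0"
    using Sigma_decompose[OF u(2)] by blast
  \<comment> \<open>The bubble vanishes on the whole boundary, so there \<open>p\<close> can stand
    in for the divergence in the degrees of freedom.\<close>
  have b0: "divergence u x = p x" if "i < 4" "lam i x = 0" for i x
    by (simp add: p(2) bubble_eq_0[OF that])
  have "\<exists>q\<in>poly_space (k - 1 - 4). \<forall>x\<in>tetra v. p x = (\<Prod>i<4. lam i x) * q x"
  proof (rule bubble_division[OF p(1)])
    fix i :: nat assume i: "i < 4"
    define j :: nat where "j = (if i = 0 then 1 else 0)"
    have "j < 4" "lam j (v i) = 0" using i by (auto simp: j_def lam_vertex)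
    then show "p (v i) = 0" using b0[of j "v i"] V[OF i] by simp
  next
    fix e q assume e: "e \<in> tetra_edges" and q: "q \<in> poly_space (k - 1 - 2)"
    define j where "j = (if 0 \<notin> {fst e, snd e} then 0 else if 1 \<notin> {fst e, snd e} then 1 else 2 :: nat)"
    have j: "j < 4" "lam j (edge_param v e s) = 0" for s
      using e by (auto simp: j_def lam_edge_param lam_vertex tetra_edges_eq)
    show "integral {0..1} (\<lambda>s. p (edge_param v e s) * q (edge_param v e s)) = 0"
      using E[OF e, of q] q by (simp add: b0[OF j])
  next
    fix f q assume f: "f \<in> tetra_faces" and q: "q \<in> poly_space (k - 1 - 3)"
    define j where "j = (if f = (1, 2, 3) then 0 else if f = (0, 2, 3) then 1 else if f = (0, 1, 3) then 2 else 3 :: nat)"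
    have j: "j < 4" "lam j (face_param v f z) = 0" for z
      using f by (auto simp: j_def lam_face_param lam_vertex tetra_faces_eq)
    show "integral unit_triangle (\<lambda>z. p (face_param v f z) * q (face_param v f z)) = 0"
      using F[OF f, of q] q by (simp add: b0[OF j])
  qed
  then obtain q where q: "q \<in> poly_space (k - 5)" "\<And>x. x \<in> tetra v \<Longrightarrow> p x = bubble x * q x"
    by (auto simp: bubble_def)
  \<comment> \<open>On the tetrahedron the divergence is the bubble times \<open>Q\<close>. Only one
    summand is present at a time: \<open>c\<close> is zero for k \<ge> 5, and \<open>q\<close> has
    negative degree for k < 5.\<close>
  define Q where "Q = (\<lambda>x. q x + c)"
  have qP: "q \<in> polynomials" by (rule poly_space_polynomials[OF q(1)])
  \<comment> \<open>The lower bounds on \<open>r\<close> enter here: \<open>Q\<close> has to be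
    admissible in the normal moments.\<close>
  have "q \<in> poly_space (r - 1)" using q(1) poly_space_mono[of "k - 5" "r - 1"] kr by auto
  then have Q: "Q \<in> poly_space (r - 1)" unfolding Q_def using kr by (intro poly_space_add poly_space_const) auto
  have QP: "Q \<in> polynomials" by (rule poly_space_polynomials[OF Q])
  have gQ: "grad Q x = grad q x" for x unfolding Q_def using qP by (simp add: grad_add polynomials_const grad_const)
  have "integral (tetra v) (\<lambda>x. divergence u x * Q x) = - integral (tetra v) (\<lambda>x. u x \<bullet> grad Q x)"
    by (rule green_formula[OF u(1) QP n N[OF _ Q]])
  also have "integral (tetra v) (\<lambda>x. u x \<bullet> grad Q x) = 0"
  proof (cases "k \<ge> 5")
    case True
    then show ?thesis using G[OF True q(1)] by (simp add: gQ)
  next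
    case False
    then have "q = (\<lambda>_. 0)" using q(1) by (simp add: poly_space_neg zero_fun_def)
    then show ?thesis by (simp add: gQ grad_const)
  qed
  finally have I: "integral (tetra v) (\<lambda>x. divergence u x * Q x) = 0" by simp
  obtain m where "divergence u \<in> poly_space m" using divergence_polynomials[OF u(1)] by (auto simp: polynomials_def)
  then show ?thesis
  proof (rule polynomial_eq_0_on_tetra)
    fix x assume "x \<in> face_simplex {}"
    then have x: "x \<in> tetra v" by (simp add: tetra_eq)
    show "divergence u x = 0"
      by (rule weighted_square_pairing[OF tetra_body continuous_on_id
            polynomials_continuous[OF divergence_polynomials[OF u(1)]] polynomials_continuous[OF QP] _ _ I x, where w = bubble])
        (auto simp: bubble_nonneg p(2) Q_def q(2) algebra_simps)
  qed
qed

text \<open>Here \<open>u \<bullet> lam_grad i = lam i * q\<close>, and the fields \<open>q *\<^sub>R lam_grad i\<close> are admissible test functions,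
  because \<open>u\<close> is orthogonal to all gradients.\<close>

lemma divergence_free_vanishes:
  assumes u: "u \<in> div_free (r - 1)" and r: "r \<ge> 1"
    and n: "\<And>f. f \<in> tetra_faces \<Longrightarrow> unit_normal v f (n f)"
    and N: "\<And>f q. f \<in> tetra_faces \<Longrightarrow> q \<in> poly_space (r - 1) \<Longrightarrow>
      integral unit_triangle (\<lambda>z. (u (face_param v f z) \<bullet> n f) * q (face_param v f z)) = 0"
    and C: "is_complement C (grad ` poly_space (r - 1)) (vec_poly_space (r - 2))"
    and B: "invertible B"
    and IC: "\<And>q. q \<in> C \<Longrightarrow> integral (tetra v) (\<lambda>x. u x \<bullet> push_forward B b q x) = 0"
  shows "u = 0"
proof -
  have uv: "u \<in> vec_poly_space (r - 1)" "divergence u = 0" using u by (auto simp: div_free_def)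
  have up: "u \<in> vec_polynomials" by (rule vec_poly_space_polynomials[OF uv(1)])
  have inner: "(\<lambda>x. u x \<bullet> c) \<in> poly_space (r - 1)" for c
    using uv(1) unfolding inner_vec_def inner_real_def vec_poly_space_def
    by (auto simp: mult.commute[of _ "c $ _"] intro!: poly_space_sum poly_space_cmult)
  have int: "(\<lambda>x. u x \<bullet> w x) integrable_on tetra v" if "w \<in> vec_polynomials" for w
    by (rule compact_continuous_integrable(2)[OF tetra_body(1)])
      (rule continuous_on_inner[OF vec_polynomials_continuous[OF up] vec_polynomials_continuous[OF that]])
  have ortho: "integral (tetra v) (\<lambda>x. u x \<bullet> w x) = 0" if w: "w \<in> vec_poly_space (r - 2)" for w
  proof -
    \<comment> \<open>Every field of degree r - 2 comes from the reference tetrahedron, where it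
      splits into a complement part and a gradient. The first is annihilated by the interior
      moments, the second by Green's formula because \<open>u\<close> is divergence-free.\<close>
    obtain q where q: "q \<in> vec_poly_space (r - 2)" "push_forward B b q = w"
      using push_forward_onto[OF B w] by blast
    then obtain c p where cp: "c \<in> C" "p \<in> poly_space (r - 1)" "q = c + grad p"
      using C unfolding is_complement_def set_sum_def by blast
    obtain p' where p': "p' \<in> poly_space (r - 1)" "push_forward B b (grad p) = grad p'"
      using push_forward_grad[OF cp(2)] by blast
    have "integral (tetra v) (\<lambda>x. u x \<bullet> grad p' x) = 0"
      using green_formula[OF up poly_space_polynomials[OF p'(1)] n N[OF _ p'(1)]] by (simp add: uv(2))
    moreover have "w x = push_forward B b c x + grad p' x" for x
      unfolding q(2)[symmetric] cp(3) push_forward_linear(1) p'(2) ..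
    moreover have "push_forward B b c \<in> vec_polynomials"
      using push_forward_space complement_space(1)[OF C r] cp(1) vec_poly_space_polynomials by blast
    moreover have "grad p' \<in> vec_polynomials"
      by (simp add: vec_polynomials_def polynomials_grad poly_space_polynomials[OF p'(1)])
    ultimately show ?thesis
      using IC[OF cp(1)] by (simp add: inner_add_right integral_add int)
  qed
  have zero: "u x \<bullet> lam_grad i = 0" if i: "i < 4" and x: "x \<in> tetra v" for i x
  proof -
    define f :: "nat \<times> nat \<times> nat" where "f = (if i = 0 then (1, 2, 3) else if i = 1 then (0, 2, 3) else if i = 2 then (0, 1, 3) else (0, 1, 2))"
    have f: "f \<in> tetra_faces" "i \<notin> {fst f, fst (snd f), snd (snd f)}"
      using i by (auto simp: f_def tetra_faces_eq)
    obtain c where c: "lam_grad i = c *\<^sub>R n f" using lam_grad_normal[OF f(1) i f(2) n[OF f(1)]] .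
    have cont: "continuous_on UNIV (\<lambda>x. u x \<bullet> d)" for d
      by (rule polynomials_continuous[OF poly_space_polynomials[OF inner]])
    \<comment> \<open>The normal component has degree r - 1 and is its own test function; the weight
      is the constant 1.\<close>
    have nz: "u (face_param v f z) \<bullet> n f = 0" if "z \<in> unit_triangle" for z
      by (rule weighted_square_pairing[OF unit_triangle continuous_face_param cont cont _ _ N[OF f(1) inner] that, where w = "\<lambda>_. 1"])
        auto
    have "\<exists>q\<in>poly_space (r - 1 - 1). \<forall>x\<in>face_simplex {}. u x \<bullet> lam_grad i = lam i x * q x"
    proof (rule face_simplex_division[OF inner i, of "if i = 0 then 1 else 0"])
      fix y assume "y \<in> face_simplex (insert i {})"
      then obtain z where "z \<in> unit_triangle" "y = face_param v f z"
        using face_simplex_face[OF f(1) i f(2)] by blast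
      then show "u y \<bullet> lam_grad i = 0" using nz by (simp add: c)
    qed auto
    then obtain q where q: "q \<in> poly_space (r - 2)" "\<And>x. x \<in> tetra v \<Longrightarrow> u x \<bullet> lam_grad i = lam i x * q x"
      by (auto simp: tetra_eq)
    \<comment> \<open>Dividing by \<open>lam i\<close> has lowered the degree to r - 2, which is
      what \<open>ortho\<close> covers.\<close>
    have "(\<lambda>x. q x *\<^sub>R lam_grad i) \<in> vec_poly_space (r - 2)"
      using poly_space_mult[OF q(1) poly_space_const[of 0]] by (simp add: vec_poly_space_def)
    from ortho[OF this] have I: "integral (tetra v) (\<lambda>x. (u x \<bullet> lam_grad i) * q x) = 0"
      by (simp add: mult.commute)
    show ?thesis
      by (rule weighted_square_pairing[OF tetra_body continuous_on_id cont
            polynomials_continuous[OF poly_space_polynomials[OF q(1)]] _ _ I x, where w = "lam i"])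
        (use i q(2) in \<open>auto simp: tetra_eq face_simplex_def\<close>)
  qed
  \<comment> \<open>The four components determine the vector: they are its coefficients in the
    expansion along the vertices.\<close>
  have "u x = 0" if "x \<in> tetra v" for x
    using lam_grad_point[of "u x"] zero[OF _ that] by (simp add: inner_commute)
  then have "(\<lambda>x. u x $ i) = 0" for i
    using uv(1) by (intro polynomial_eq_0_on_tetra[of _ "r - 1"]) (auto simp: vec_poly_space_def tetra_eq)
  then show "u = 0" by (simp add: fun_eq_iff vec_eq_iff)
qed

end

section \<open>Unisolvence\<close>

text \<open>The Poincare operator is a right inverse of the divergence, so the divergence of a
  member recovers its component in \<open>S\<close>. Image, kernel and dimension all follow from
  this. Keeping \<open>S\<close> general admits the bubble as well as full polynomial
  spaces.\<close>

lemma curl_poincare_space: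
  fixes m :: int
  assumes S: "subspace S" "fin_dim S" "S \<subseteq> polynomials"
  defines "W \<equiv> div_free m \<oplus>\<^sub>s poincare ` S"
  shows "subspace W" "fin_dim W" "W \<subseteq> vec_polynomials" "divergence ` W = S"
    "{u \<in> W. divergence u = 0} = div_free m" "dim W = dim S + dim (div_free m)"
proof -
  have lin: "linear_on_space S poincare" by (rule poincare_linear[OF S(3)])
  have pS: "subspace (poincare ` S)" "fin_dim (poincare ` S)"
    using subspace_linear_on_space_image[OF S(1) lin] fin_dim_image[OF S(1) lin S(2)] by auto
  have dsub: "div_free m \<subseteq> vec_poly_space m" by (auto simp: div_free_def)
  have fd: "fin_dim (div_free m)" using fin_dim_subset[OF fin_dim_vec_poly_space dsub] .
  show subW: "subspace W" unfolding W_def by (rule subspace_set_sum[OF subspace_div_free pS(1)])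
  show fW: "fin_dim W" unfolding W_def by (rule fin_dim_set_sum[OF subspace_div_free pS(1) fd pS(2)])
  have dec: "w + poincare s \<in> vec_polynomials" "divergence (w + poincare s) = s"
    if w: "w \<in> div_free m" and s: "s \<in> S" for w s
  proof -
    have 1: "w \<in> vec_polynomials" "divergence w = 0" using w vec_poly_space_polynomials by (auto simp: div_free_def)
    have "s \<in> polynomials" using s S(3) by blast
    note 2 = poincare_polynomials[OF this]
    show "w + poincare s \<in> vec_polynomials" using vec_polynomials_add[OF 1(1) 2(1)] by (simp add: plus_fun_def)
    have "divergence (w + poincare s) x = s x" for x
      using divergence_add[OF 1(1) 2(1), of x] by (simp add: plus_fun_def 1(2) 2(2))
    then show "divergence (w + poincare s) = s" by blast
  qed
  have memE: "\<exists>w s. w \<in> div_free m \<and> s \<in> S \<and> u = w + poincare s" if "u \<in> W" for u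
    using that unfolding W_def set_sum_def by blast
  have memI: "w + poincare s \<in> W" if "w \<in> div_free m" "s \<in> S" for w s
    using that unfolding W_def set_sum_def by blast
  show sub: "W \<subseteq> vec_polynomials"
  proof
    fix u assume "u \<in> W"
    from memE[OF this] obtain w t where "w \<in> div_free m" "t \<in> S" "u = w + poincare t" by blast
    then show "u \<in> vec_polynomials" by (simp only: dec(1))
  qed
  have z: "0 \<in> div_free m" by (rule subspace_0[OF subspace_div_free])
  show im: "divergence ` W = S"
  proof (intro equalityI subsetI)
    fix s assume "s \<in> divergence ` W"
    then obtain u where u: "u \<in> W" "s = divergence u" by blast
    from memE[OF u(1)] obtain w t where "w \<in> div_free m" "t \<in> S" "u = w + poincare t" by blast
    then show "s \<in> S" by (simp only: dec(2) u(2))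
  next
    fix s assume s: "s \<in> S"
    show "s \<in> divergence ` W"
      by (rule image_eqI[OF _ memI[OF z s]]) (simp only: dec(2)[OF z s])
  qed
  have p0: "poincare 0 = 0" by (rule linear_on_space_0[OF lin S(1)])
  show ker: "{u \<in> W. divergence u = 0} = div_free m"
  proof (intro equalityI subsetI)
    fix u assume "u \<in> {u \<in> W. divergence u = 0}"
    then have u: "u \<in> W" "divergence u = 0" by simp_all
    from memE[OF u(1)] obtain w s where ws: "w \<in> div_free m" "s \<in> S" "u = w + poincare s" by blast
    then have "s = 0" using dec(2)[OF ws(1,2)] u(2) by simp
    then show "u \<in> div_free m" using ws by (simp add: p0)
  next
    fix u assume u: "u \<in> div_free m"
    then have "u \<in> W" using memI[OF u subspace_0[OF S(1)]] by (simp add: p0)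
    then show "u \<in> {u \<in> W. divergence u = 0}" using u by (simp add: div_free_def)
  qed
  show "dim W = dim S + dim (div_free m)"
    using dim_rank_nullity[OF subW fW linear_on_space_divergence[OF sub]] by (simp add: im ker)
qed

lemma set_sum_superset_left: "subspace B \<Longrightarrow> A \<subseteq> A \<oplus>\<^sub>s B"
proof
  fix a assume "subspace B" "a \<in> A"
  then have "a + 0 \<in> A \<oplus>\<^sub>s B" using subspace_0 unfolding set_sum_def by blast
  then show "a \<in> A \<oplus>\<^sub>s B" by simp
qed

lemma set_sum_superset_right: "subspace A \<Longrightarrow> B \<subseteq> A \<oplus>\<^sub>s B"
proof
  fix b assume "subspace A" "b \<in> B"
  then have "0 + b \<in> A \<oplus>\<^sub>s B" using subspace_0 unfolding set_sum_def by blast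
  then show "b \<in> A \<oplus>\<^sub>s B" by simp
qed

lemma linear_on_space_mult_left:
  fixes f :: "'a::real_vector \<Rightarrow> real"
  shows "linear_on_space S f \<Longrightarrow> linear_on_space S (\<lambda>x. c * f x)"
  by (simp add: linear_on_space_def algebra_simps)

text \<open>Linearity in the field for a fixed test function; \<open>L\<close> stands for the
  divergence or for a normal component.\<close>

lemma linear_on_space_field_pairing:
  fixes \<phi> :: "'b::euclidean_space \<Rightarrow> real^3"
  assumes S: "compact S" and \<phi>: "continuous_on S \<phi>" "\<phi> ` S \<subseteq> T" and q: "q \<in> poly_on m T"
    and W: "\<And>u. u \<in> W \<Longrightarrow> L u \<in> polynomials"
    and add: "\<And>u w x. u \<in> W \<Longrightarrow> w \<in> W \<Longrightarrow> L (u + w) x = L u x + L w x"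
    and scale: "\<And>u c x. u \<in> W \<Longrightarrow> L (c *\<^sub>R u) x = c * L u x"
  shows "linear_on_space W (\<lambda>u. integral S (\<lambda>z. L u (\<phi> z) * q (\<phi> z)))"
proof (rule linear_on_space_integral[OF S])
  obtain p where p: "p \<in> poly_space m" "q = restrict_field T p" using q by (auto simp: poly_on_eq)
  fix u assume u: "u \<in> W"
  have "continuous_on S (\<lambda>z. L u (\<phi> z) * p (\<phi> z))"
    by (intro continuous_on_mult continuous_on_compose2[OF polynomials_continuous[OF W[OF u], of UNIV] \<phi>(1)]
        continuous_on_compose2[OF polynomials_continuous[OF poly_space_polynomials[OF p(1)], of UNIV] \<phi>(1)]) auto
  moreover have "L u (\<phi> z) * q (\<phi> z) = L u (\<phi> z) * p (\<phi> z)" if "z \<in> S" for z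
    using that \<phi>(2) by (auto simp: p(2) restrict_field_def)
  ultimately show "continuous_on S (\<lambda>z. L u (\<phi> z) * q (\<phi> z))"
    using continuous_on_cong by (metis (no_types, lifting))
qed (simp_all add: add scale algebra_simps)

text \<open>Degrees of freedom are counted as labels: the constructors of \<open>dof\<close> keep
  the families disjoint, whatever functionals they denote.\<close>

lemma card_dofs:
  assumes QE: "\<And>e. e \<in> tetra_edges \<Longrightarrow> finite (QE e)"
    and QF: "\<And>f. f \<in> tetra_faces \<Longrightarrow> finite (QF f)" "\<And>f. f \<in> tetra_faces \<Longrightarrow> finite (QN f)"
    and QI: "finite QI"
  shows "finite (dofs QE QF QN QI)"
    "card (dofs QE QF QN QI) = 4 + (\<Sum>e\<in>tetra_edges. card (QE e)) + (\<Sum>f\<in>tetra_faces. card (QF f))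
      + (\<Sum>f\<in>tetra_faces. card (QN f)) + card QI"
proof -
  define A where "A = Vertex ` {..<4}"
  define BE where "BE = (\<lambda>(e, q). Edge e q) ` (SIGMA e:tetra_edges. QE e)"
  define BF where "BF = (\<lambda>(f, q). Face_div f q) ` (SIGMA f:tetra_faces. QF f)"
  define BN where "BN = (\<lambda>(f, q). Face_normal f q) ` (SIGMA f:tetra_faces. QN f)"
  define BI where "BI = Interior ` QI"
  have eq: "dofs QE QF QN QI = A \<union> BE \<union> BF \<union> BN \<union> BI"
    unfolding dofs_def A_def BE_def BF_def BN_def BI_def by (auto simp: image_iff)
  have ft: "finite tetra_edges" "finite tetra_faces" by (simp_all add: tetra_edges_eq tetra_faces_eq)
  have fin: "finite A" "finite BE" "finite BF" "finite BN" "finite BI"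
    unfolding A_def BE_def BF_def BN_def BI_def using assms ft by auto
  then show "finite (dofs QE QF QN QI)" by (simp add: eq)
  have c: "card A = 4" "card BE = (\<Sum>e\<in>tetra_edges. card (QE e))" "card BF = (\<Sum>f\<in>tetra_faces. card (QF f))"
    "card BN = (\<Sum>f\<in>tetra_faces. card (QN f))" "card BI = card QI"
    unfolding A_def BE_def BF_def BN_def BI_def
    by (subst card_image; auto simp: inj_on_def card_SigmaI ft QE QF)+
  have "A \<inter> BE = {}" "(A \<union> BE) \<inter> BF = {}" "(A \<union> BE \<union> BF) \<inter> BN = {}" "(A \<union> BE \<union> BF \<union> BN) \<inter> BI = {}"
    unfolding A_def BE_def BF_def BN_def BI_def by auto
  then show "card (dofs QE QF QN QI) = 4 + (\<Sum>e\<in>tetra_edges. card (QE e)) + (\<Sum>f\<in>tetra_faces. card (QF f))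
      + (\<Sum>f\<in>tetra_faces. card (QN f)) + card QI"
    unfolding eq by (simp add: card_Un_disjoint fin c)
qed

text \<open>Merges the three cases of \<open>D_space\<close> into one count and one consequence.
  When the interior family is empty, the complement is trivial too, so the same formulas
  hold.\<close>

lemma D_space_facts:
  assumes C: "is_complement C (grad ` poly_space (r - 1)) (vec_poly_space (r - 2))"
    and kr: "k \<ge> 2" "r \<ge> 1" "r \<ge> k - 1" and Q: "is_basis QI (D_space k r C)"
  shows "finite QI" "QI \<subseteq> vec_polynomials"
    "int (card QI) + int (dim (poly_space (r - 1))) =
      3 * int (dim (poly_space (r - 2))) + 1 + (if k \<ge> 5 then int (dim (poly_space (k - 5))) - 1 else 0)"
    "\<And>L. linear_on_space vec_polynomials L \<Longrightarrow> (\<And>q. q \<in> QI \<Longrightarrow> L q = 0) \<Longrightarrow>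
      (\<forall>q\<in>C. L q = (0::real)) \<and> (k \<ge> 5 \<longrightarrow> (\<forall>p\<in>poly_space (k - 5). L (grad p) = 0))"
proof -
  note cs = complement_space[OF C kr(2)]
  have Cv: "C \<subseteq> vec_polynomials" using cs(1) vec_poly_space_polynomials by blast
  have Gv: "grad ` poly_space m \<subseteq> vec_polynomials" for m using poly_space_grad vec_poly_space_polynomials by blast
  have QD: "QI \<subseteq> D_space k r C" using Q by (simp add: is_basis_def)
  consider "k \<ge> 5" | "k < 5" "r \<ge> 2" | "k < 5" "r = 1" using kr by linarith
  then have "finite QI \<and> QI \<subseteq> vec_polynomials \<and>
    int (card QI) + int (dim (poly_space (r - 1))) =
      3 * int (dim (poly_space (r - 2))) + 1 + (if k \<ge> 5 then int (dim (poly_space (k - 5))) - 1 else 0)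
    \<and> (\<forall>L. linear_on_space vec_polynomials L \<longrightarrow> (\<forall>q\<in>QI. L q = 0) \<longrightarrow>
      (\<forall>q\<in>C. L q = (0::real)) \<and> (k \<ge> 5 \<longrightarrow> (\<forall>p\<in>poly_space (k - 5). L (grad p) = 0)))"
  proof cases
    case 1
    let ?G = "grad ` poly_space (k - 5)"
    have D: "D_space k r C = ?G \<oplus>\<^sub>s C" using 1 by (simp add: D_space_def)
    have sub: "subspace (?G \<oplus>\<^sub>s C)" "fin_dim (?G \<oplus>\<^sub>s C)"
      using subspace_set_sum[OF subspace_grad_image cs(2)] fin_dim_set_sum[OF subspace_grad_image cs(2) fin_dim_grad_image cs(3)] by auto
    have Dv: "?G \<oplus>\<^sub>s C \<subseteq> vec_polynomials"
      using Gv[of "k - 5"] Cv vec_polynomials_add unfolding set_sum_def plus_fun_def by blast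
    \<comment> \<open>Here k - 5 \<le> r - 1, so these gradients are among those to which
      \<open>C\<close> is complementary.\<close>
    have "?G \<inter> C \<subseteq> {0}"
      using C poly_space_mono[of "k - 5" "r - 1"] kr unfolding is_complement_def by auto
    then have "dim (?G \<oplus>\<^sub>s C) = dim ?G + dim C"
      by (intro dim_set_sum subspace_grad_image cs fin_dim_grad_image)
    then have "int (card QI) = int (dim (poly_space (k - 5))) - 1 + int (dim C)"
      using is_basis_card(2)[OF Q] dim_grad_poly_space[of "k - 5"] 1 sub D by simp
    moreover have "L q = 0" if L: "linear_on_space vec_polynomials L" "\<forall>q\<in>QI. L q = 0" and q: "q \<in> ?G \<oplus>\<^sub>s C"
      for L :: "vector_field \<Rightarrow> real" and q
    proof (rule linear_on_space_basis_0[OF _ sub(1) Q[unfolded D] _ q])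
      show "linear_on_space (?G \<oplus>\<^sub>s C) L" using L(1) Dv unfolding linear_on_space_def by blast
    qed (use L in blast)
    moreover have "?G \<subseteq> ?G \<oplus>\<^sub>s C" "C \<subseteq> ?G \<oplus>\<^sub>s C"
      by (rule set_sum_superset_left[OF cs(2)], rule set_sum_superset_right[OF subspace_grad_image])
    moreover have "finite QI" by (rule is_basis_card(1)[OF Q[unfolded D] sub(2)])
    moreover have "QI \<subseteq> vec_polynomials" using QD Dv unfolding D by (rule order_trans)
    ultimately show ?thesis using 1 cs(4) by (auto simp: subset_iff)
  next
    case 2
    have D: "D_space k r C = C" using 2 by (simp add: D_space_def)
    have "L q = 0" if L: "linear_on_space vec_polynomials L" "\<forall>q\<in>QI. L q = 0" and q: "q \<in> C"
      for L :: "vector_field \<Rightarrow> real" and q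
    proof (rule linear_on_space_basis_0[OF _ cs(2) Q[unfolded D] _ q])
      show "linear_on_space C L" using L(1) Cv unfolding linear_on_space_def by blast
    qed (use L in blast)
    then show ?thesis using 2 QD Cv cs(3,4) is_basis_card[OF Q] D by auto
  next
    case 3
    have D: "QI = {}" using 3 QD by (simp add: D_space_def)
    \<comment> \<open>For r = 1 the fields in question have degree -1.\<close>
    have C0: "C = {0}" using cs(1) subspace_0[OF cs(2)] 3 by (auto simp: vec_poly_space_neg)
    have "L 0 = 0" if "linear_on_space vec_polynomials L" for L :: "vector_field \<Rightarrow> real"
    proof -
      have "linear_on_space {0} L"
        using that Cv unfolding C0 linear_on_space_def by blast
      then show ?thesis using linear_on_space_0[of "{0}" L] subspace_single_0 by blast
    qed
    moreover have "dim C = 0" by (simp only: C0 dim_zero_space)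
    ultimately show ?thesis using 3 cs(4) D C0 by auto
  qed
  then show "finite QI" "QI \<subseteq> vec_polynomials"
    "int (card QI) + int (dim (poly_space (r - 1))) =
      3 * int (dim (poly_space (r - 2))) + 1 + (if k \<ge> 5 then int (dim (poly_space (k - 5))) - 1 else 0)"
    "\<And>L. linear_on_space vec_polynomials L \<Longrightarrow> (\<And>q. q \<in> QI \<Longrightarrow> L q = 0) \<Longrightarrow>
      (\<forall>q\<in>C. L q = (0::real)) \<and> (k \<ge> 5 \<longrightarrow> (\<forall>p\<in>poly_space (k - 5). L (grad p) = 0))"
    by blast+
qed

section \<open>Degrees of freedom as linear functionals\<close>

context tetrahedron
begin

lemma edge_length_pos: "e \<in> tetra_edges \<Longrightarrow> norm (v (snd e) - v (fst e)) > 0"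
proof -
  assume "e \<in> tetra_edges"
  then have "fst e < 4" "snd e < 4" "fst e \<noteq> snd e" by (auto simp: tetra_edges_def)
  then have "lam (fst e) (v (fst e)) \<noteq> lam (fst e) (v (snd e))" by (simp add: lam_vertex)
  then show ?thesis by auto
qed

text \<open>The coordinate \<open>lam c\<close> is zero along the line through \<open>v a\<close>
  and \<open>v b\<close> but one at \<open>v c\<close>, so the two edge vectors cannot be
  parallel.\<close>

lemma face_area_pos:
  assumes "f \<in> tetra_faces"
  shows "norm (cross3 (v (fst (snd f)) - v (fst f)) (v (snd (snd f)) - v (fst f))) > 0"
proof -
  obtain a b c where f: "f = (a, b, c)" "a < b" "b < c" "c < 4" using assms by (auto simp: tetra_faces_def)
  have "cross3 (v b - v a) (v c - v a) \<noteq> 0"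
  proof
    assume "cross3 (v b - v a) (v c - v a) = 0"
    then have col: "collinear {0, v b - v a, v c - v a}" by (simp add: cross_eq_0)
    have lc: "lam c (v a + 1 *\<^sub>R (v c - v a)) = 1" "lam b (v a + 1 *\<^sub>R (v b - v a)) = 1"
      "\<And>t. lam c (v a + t *\<^sub>R (v b - v a)) = 0" "lam c (v a) = 0" "lam b (v a) = 0"
      using f by (simp_all only: lam_affine_line) (simp_all add: lam_vertex)
    from col consider "v b - v a = 0" | "v c - v a = 0" | t where "v c - v a = t *\<^sub>R (v b - v a)"
      by (auto simp: collinear_lemma)
    then show False
    proof cases
      case 1
      then show ?thesis using lc(2,5) by simp
    next
      case 2
      then show ?thesis using lc(1,4) by simp
    next
      case 3
      then show ?thesis using lc(1) lc(3)[of t] by simp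
    qed
  qed
  then show ?thesis by (simp add: f)
qed

lemma face_opposite_vertex:
  assumes "f \<in> tetra_faces"
  obtains i where "i < 4" "i \<notin> {fst f, fst (snd f), snd (snd f)}"
proof -
  have "\<exists>i<4. i \<notin> {fst f, fst (snd f), snd (snd f)}"
    using assms by (auto simp: tetra_faces_eq intro: exI[of _ 0] exI[of _ 1] exI[of _ 2] exI[of _ 3])
  then show ?thesis using that by blast
qed

lemma face_param_image: "f \<in> tetra_faces \<Longrightarrow> face_param v f ` unit_triangle = face_set v f"
  by (rule face_opposite_vertex) (use face_simplex_face(2) in blast)+

lemma dim_poly_on_edge_set:
  assumes "e \<in> tetra_edges" "m \<ge> -1"
  shows "int (dim (poly_on m (edge_set v e))) = m + 1"
  unfolding edge_simplex(1)[OF assms(1)]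
proof (rule dim_poly_on_edge[OF _ _ assms(2)])
  have "fst e < 4" "snd e < 4" "fst e \<noteq> snd e" using assms(1) by (auto simp: tetra_edges_def)
  then show "card ({..<4} - {fst e, snd e}) = 2" by (simp add: card_Diff_subset)
qed auto

lemma dim_poly_on_face_set:
  assumes "f \<in> tetra_faces" "m \<ge> -2"
  shows "2 * int (dim (poly_on m (face_set v f))) = (m + 1) * (m + 2)"
proof -
  obtain i where i: "i < 4" "i \<notin> {fst f, fst (snd f), snd (snd f)}" by (rule face_opposite_vertex[OF assms(1)])
  show ?thesis
    unfolding face_simplex_face(1)[OF assms(1) i] using i by (intro dim_poly_on_face assms(2)) auto
qed

lemma unit_triangle_area: "integral unit_triangle (\<lambda>_. 1 :: real) \<noteq> 0"
proof
  assume 0: "integral unit_triangle (\<lambda>_. 1 :: real) = 0"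
  obtain x where "x \<in> unit_triangle" using unit_triangle(3) interior_subset by blast
  from integral_0_imp_0[OF unit_triangle continuous_on_const _ 0 this] show False by simp
qed

text \<open>The arc length factors of numerator and denominator cancel, and the unit interval has
  length one.\<close>

lemma dof_value_Edge:
  assumes "e \<in> tetra_edges"
  shows "dof_value v B b n (Edge e q) u = integral {0..1} (\<lambda>s. divergence u (edge_param v e s) * q (edge_param v e s))"
  using edge_length_pos[OF assms] by (simp add: edge_length_def edge_integral_eq)

lemma dof_value_Face_div:
  assumes "f \<in> tetra_faces"
  shows "dof_value v B b n (Face_div f q) u = (1 / integral unit_triangle (\<lambda>_. 1)) *
    integral unit_triangle (\<lambda>z. divergence u (face_param v f z) * q (face_param v f z))"
  using face_area_pos[OF assms] by (simp add: face_area_def face_integral_eq)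

lemma dof_value_Face_normal:
  "dof_value v B b n (Face_normal f q) u = norm (cross3 (v (fst (snd f)) - v (fst f)) (v (snd (snd f)) - v (fst f))) *
    integral unit_triangle (\<lambda>z. (u (face_param v f z) \<bullet> n f) * q (face_param v f z))"
  by (simp add: face_integral_eq)

lemma push_forward_vec_polynomials: "q \<in> vec_polynomials \<Longrightarrow> push_forward B b q \<in> vec_polynomials"
proof -
  assume q: "q \<in> vec_polynomials"
  have "(\<lambda>x. q (matrix_inv B *v x + - (matrix_inv B *v b)) $ j) \<in> polynomials" for j
  proof -
    obtain m where "(\<lambda>x. q x $ j) \<in> poly_space m" using q by (auto simp: vec_polynomials_def polynomials_def)
    from poly_space_compose_affine[OF this poly_space_matrix_affine] show ?thesis by (rule poly_space_polynomials)
  qed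
  then show ?thesis
    unfolding push_forward_eq vec_polynomials_def matrix_vector_mult_def
    by (simp add: polynomials_sum polynomials_mult polynomials_const)
qed

lemma continuous_on_field_inner:
  assumes "u \<in> vec_polynomials" "w \<in> vec_polynomials"
  shows "continuous_on (tetra v) (\<lambda>x. u x \<bullet> w x)"
  by (intro continuous_on_inner vec_polynomials_continuous assms)

lemma linear_on_space_dof_value:
  assumes W: "W \<subseteq> vec_polynomials"
    and QE: "\<And>e. e \<in> tetra_edges \<Longrightarrow> QE e \<subseteq> poly_on (k - 3) (edge_set v e)"
    and QF: "\<And>f. f \<in> tetra_faces \<Longrightarrow> QF f \<subseteq> poly_on (k - 4) (face_set v f)"
    and QN: "\<And>f. f \<in> tetra_faces \<Longrightarrow> QN f \<subseteq> poly_on (r - 1) (face_set v f)"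
    and QI: "QI \<subseteq> vec_polynomials"
    and d: "d \<in> dofs QE QF QN QI"
  shows "linear_on_space W (dof_value v B b n d)"
proof -
  have div1: "divergence u \<in> polynomials" if "u \<in> W" for u
    using that W divergence_polynomials by blast
  have div2: "divergence (u + w) x = divergence u x + divergence w x" if "u \<in> W" "w \<in> W" for u w x
    using that linear_on_space_divergence[OF W] by (simp add: linear_on_space_def)
  have div3: "divergence (c *\<^sub>R u) x = c * divergence u x" if "u \<in> W" for u c x
    using that linear_on_space_divergence[OF W] by (simp add: linear_on_space_def)
  have nor: "(\<lambda>x. u x \<bullet> m) \<in> polynomials" if "u \<in> W" for u m
    using that W vec_polynomials_inner by blast
  consider i where "d = Vertex i" | e q where "d = Edge e q" "e \<in> tetra_edges" "q \<in> QE e"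
    | f q where "d = Face_div f q" "f \<in> tetra_faces" "q \<in> QF f"
    | f q where "d = Face_normal f q" "f \<in> tetra_faces" "q \<in> QN f" | q where "d = Interior q" "q \<in> QI"
    using d unfolding dofs_def by blast
  then show ?thesis
  proof cases
    case 1
    then show ?thesis by (simp add: linear_on_space_def div2 div3)
  next
    case (2 e q)
    have "q \<in> poly_on (k - 3) (edge_set v e)" using QE 2 by blast
    then have "linear_on_space W (\<lambda>u. integral {0..1} (\<lambda>s. divergence u (edge_param v e s) * q (edge_param v e s)))"
      by (rule linear_on_space_field_pairing[OF compact_Icc continuous_edge_param eq_refl[OF edge_simplex(2)[OF 2(2)]]])
        (erule div1, erule (1) div2, erule div3)
    then show ?thesis unfolding 2(1) dof_value_Edge[OF 2(2), abs_def] .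
  next
    case (3 f q)
    have "q \<in> poly_on (k - 4) (face_set v f)" using QF 3 by blast
    then have "linear_on_space W (\<lambda>u. integral unit_triangle (\<lambda>z. divergence u (face_param v f z) * q (face_param v f z)))"
      by (rule linear_on_space_field_pairing[OF unit_triangle(1) continuous_face_param eq_refl[OF face_param_image[OF 3(2)]]])
        (erule div1, erule (1) div2, erule div3)
    then show ?thesis unfolding 3(1) dof_value_Face_div[OF 3(2), abs_def] by (rule linear_on_space_mult_left)
  next
    case (4 f q)
    have "q \<in> poly_on (r - 1) (face_set v f)" using QN 4 by blast
    then have "linear_on_space W (\<lambda>u. integral unit_triangle (\<lambda>z. (u (face_param v f z) \<bullet> n f) * q (face_param v f z)))"
      by (rule linear_on_space_field_pairing[OF unit_triangle(1) continuous_face_param eq_refl[OF face_param_image[OF 4(2)]],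
            where L = "\<lambda>u x. u x \<bullet> n f"])
        (simp_all add: nor inner_add_left)
    then show ?thesis unfolding 4(1) dof_value_Face_normal[abs_def] by (rule linear_on_space_mult_left)
  next
    case (5 q)
    have pf: "push_forward B b q \<in> vec_polynomials" using push_forward_vec_polynomials 5 QI by blast
    have "linear_on_space W (\<lambda>u. integral (tetra v) (\<lambda>x. u x \<bullet> push_forward B b q x))"
      by (rule linear_on_space_integral[OF tetra_body(1)])
        (use W pf in \<open>auto intro!: continuous_on_field_inner simp: inner_add_left\<close>)
    moreover have "dof_value v B b n d = (\<lambda>u. integral (tetra v) (\<lambda>x. u x \<bullet> push_forward B b q x))"
      by (simp add: fun_eq_iff 5(1))
    ultimately show ?thesis by (simp only:)
  qed
qed

end

theorem lemma4p2:
  fixes k r :: int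
    and v :: "nat \<Rightarrow> real^3" and B :: "real^3^3" and b :: "real^3"
    and n :: "nat \<times> nat \<times> nat \<Rightarrow> real^3"
    and C :: "vector_field set"
    and QE :: "nat \<times> nat \<Rightarrow> scalar_field set"
    and QF QN :: "nat \<times> nat \<times> nat \<Rightarrow> scalar_field set"
    and QI :: "vector_field set"
  assumes "k \<ge> 2" and "r \<in> {k - 1, k, k + 1}"
    and "tetrahedron_vertices v"
    and "reference_map v B b"
    and "\<And>f. f \<in> tetra_faces \<Longrightarrow> unit_normal v f (n f)"
    and "is_complement C (grad ` poly_space (r - 1)) (vec_poly_space (r - 2))"
    and "\<And>e. e \<in> tetra_edges \<Longrightarrow> is_basis (QE e) (poly_on (k - 3) (edge_set v e))"
    and "\<And>f. f \<in> tetra_faces \<Longrightarrow> is_basis (QF f) (poly_on (k - 4) (face_set v f))"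
    and "\<And>f. f \<in> tetra_faces \<Longrightarrow> is_basis (QN f) (poly_on (r - 1) (face_set v f))"
    and "is_basis QI (D_space k r C)"
  shows "unisolvent (dof_value v B b n) (dofs QE QF QN QI) (W_space r k v)"
proof -
  interpret tetrahedron v "barycentric v"
    by (rule tetrahedron_barycentric[OF assms(3)])
  have kr: "k \<ge> 2" "r \<ge> 1" "r \<ge> k - 1" using assms(1,2) by auto
  have B: "invertible B" by (rule reference_map_invertible[OF assms(4)])
  let ?I = "dofs QE QF QN QI" and ?N = "dof_value v B b n"
  have "Sigma_space k v = Sigma k"
    by (simp add: Sigma_space_def Sigma_def bubble_def)
  then have W: "W_space r k v = div_free (r - 1) \<oplus>\<^sub>s poincare ` Sigma k"
    by (simp add: W_space_def curl_V_space)
  note Wf = curl_poincare_space[OF subspace_Sigma fin_dim_Sigma Sigma_polynomials, of "r - 1" k, folded W]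
  note D = D_space_facts[OF assms(6) kr assms(10)]
  note QE = is_basis_card[OF assms(7) fin_dim_poly_on]
  note QF = is_basis_card[OF assms(8) fin_dim_poly_on]
  note QN = is_basis_card[OF assms(9) fin_dim_poly_on]
  note card = card_dofs[of QE QF QN QI, OF QE(1) QF(1) QN(1) D(1)]
  show ?thesis
  proof (rule unisolventI[OF Wf(1,2)])
    show "finite ?I" by (rule card(1))
    have a: "6 * int (dim (poly_space (r - 1))) = r * (r + 1) * (r + 2)"
      "6 * int (dim (poly_space (r - 2))) = (r - 1) * r * (r + 1)"
      "6 * int (dim (poly_space (k - 1))) = k * (k + 1) * (k + 2)"
      "6 * int (dim (poly_space (k - 5))) = (k - 4) * (k - 3) * (k - 2)"
      using dim_poly_space[of "r - 1"] dim_poly_space[of "r - 2"] dim_poly_space[of "k - 1"] dim_poly_space[of "k - 5"] kr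
      by (simp_all add: algebra_simps)
    have low: "int (dim (poly_space (k - 5))) = 0" if "k < 5"
      using that by (simp add: poly_space_neg dim_zero_space)
    have e: "int (card (QE e)) = k - 2" if "e \<in> tetra_edges" for e
      using QE(2)[OF that] dim_poly_on_edge_set[OF that, of "k - 3"] kr by simp
    have f: "2 * int (card (QF f)) = (k - 3) * (k - 2)" if "f \<in> tetra_faces" for f
      using QF(2)[OF that] dim_poly_on_face_set[OF that, of "k - 4"] kr by simp
    have g: "2 * int (card (QN f)) = r * (r + 1)" if "f \<in> tetra_faces" for f
      using QN(2)[OF that] dim_poly_on_face_set[OF that, of "r - 1"] kr by simp
    have "int (\<Sum>e\<in>tetra_edges. card (QE e)) = (\<Sum>e\<in>tetra_edges. k - 2)"
      unfolding of_nat_sum by (rule sum.cong) (simp_all add: e)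
    then have e': "int (\<Sum>e\<in>tetra_edges. card (QE e)) = 6 * (k - 2)" by (simp add: tetra_edges_eq)
    have "2 * int (\<Sum>f\<in>tetra_faces. card (QF f)) = (\<Sum>f\<in>tetra_faces. (k - 3) * (k - 2))"
      unfolding of_nat_sum sum_distrib_left by (rule sum.cong) (simp_all add: f)
    then have f': "2 * int (\<Sum>f\<in>tetra_faces. card (QF f)) = 4 * ((k - 3) * (k - 2))" by (simp add: tetra_faces_eq)
    have "2 * int (\<Sum>f\<in>tetra_faces. card (QN f)) = (\<Sum>f\<in>tetra_faces. r * (r + 1))"
      unfolding of_nat_sum sum_distrib_left by (rule sum.cong) (simp_all add: g)
    then have g': "2 * int (\<Sum>f\<in>tetra_faces. card (QN f)) = 4 * (r * (r + 1))" by (simp add: tetra_faces_eq)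
    have d: "int (dim (div_free (r - 1))) + int (dim (poly_space (r - 2))) = 3 * int (dim (poly_space (r - 1)))"
      using dim_div_free[of "r - 1"] by simp
    have s: "int (dim (Sigma k)) = int (dim (poly_space (k - 1))) + (if k \<ge> 5 then 0 else 1)"
      using dim_Sigma[of k] by simp
    \<comment> \<open>By \<open>low\<close> the dimension for degree k - 5 can be written in both
      cases; only the correction by one depends on \<open>k\<close>.\<close>
    have i: "int (card QI) + int (dim (poly_space (r - 1))) =
      3 * int (dim (poly_space (r - 2))) + 1 + int (dim (poly_space (k - 5))) - (if k \<ge> 5 then 1 else 0)"
      using D(3) low by (cases "k \<ge> 5") simp_all
    \<comment> \<open>\<open>K\<close> is six times the count of polynomials of degree k - 1 by
      vertices, edges, faces and interior: 4 + 6 (k - 2) + 4 binom(k - 2, 2) + binom(k - 2, 3) =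
      binom(k + 2, 3). \<open>R\<close> is 24 times the Pascal recursion by which the dimensions in
      degrees r - 1 and r - 2 differ by that of degree r - 1 on a face.\<close>
    have K: "6 * (4 + 6 * (k - 2)) + 12 * ((k - 3) * (k - 2)) + (k - 4) * (k - 3) * (k - 2) = k * (k + 1) * (k + 2)"
      and R: "12 * (r * (r + 1)) + 4 * ((r - 1) * r * (r + 1)) = 4 * (r * (r + 1) * (r + 2))"
      by (simp_all add: algebra_simps)
    have "int (card ?I) = 4 + int (\<Sum>e\<in>tetra_edges. card (QE e)) + int (\<Sum>f\<in>tetra_faces. card (QF f))
        + int (\<Sum>f\<in>tetra_faces. card (QN f)) + int (card QI)"
      using card(2) by simp
    moreover have "int (dim (W_space r k v)) = int (dim (Sigma k)) + int (dim (div_free (r - 1)))"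
      using Wf(6) by simp
    ultimately have "6 * int (card ?I) = 6 * int (dim (W_space r k v))"
      using e' f' g' d s i a[folded K] R by (cases "k \<ge> 5") (simp_all add: algebra_simps)
    then have "int (card ?I) = int (dim (W_space r k v))" by simp
    then show "card ?I = dim (W_space r k v)" by simp
  next
    fix d assume d: "d \<in> ?I"
    have sub: "QE e \<subseteq> poly_on (k - 3) (edge_set v e)" if "e \<in> tetra_edges" for e
      using assms(7)[OF that] by (simp add: is_basis_def)
    moreover have "QF f \<subseteq> poly_on (k - 4) (face_set v f)" "QN f \<subseteq> poly_on (r - 1) (face_set v f)"
      if "f \<in> tetra_faces" for f
      using assms(8,9)[OF that] by (simp_all add: is_basis_def)
    ultimately show "linear_on_space (W_space r k v) (?N d)"
      by (rule linear_on_space_dof_value[OF Wf(3) _ _ _ D(2) d])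
  next
    fix u assume u: "u \<in> W_space r k v" and N0: "\<And>d. d \<in> ?I \<Longrightarrow> ?N d u = 0"
    have up: "u \<in> vec_polynomials" using u Wf(3) by blast
    have dS: "divergence u \<in> Sigma k" using u Wf(4) by blast
    have dc: "continuous_on UNIV (divergence u)" by (rule polynomials_continuous[OF divergence_polynomials[OF up]])
    have V: "divergence u (v i) = 0" if "i < 4" for i
      using N0[of "Vertex i"] that by (simp add: dofs_def)
    have E: "integral {0..1} (\<lambda>s. divergence u (edge_param v e s) * q (edge_param v e s)) = 0"
      if e: "e \<in> tetra_edges" and q: "q \<in> poly_space (k - 3)" for e q
    proof (rule pairing_vanishes[OF compact_Icc continuous_edge_param eq_refl[OF edge_simplex(2)[OF e]] dc assms(7)[OF e] _ q])
      fix p assume "p \<in> QE e"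
      then have "Edge e p \<in> ?I" using e unfolding dofs_def by blast
      from N0[OF this] show "integral {0..1} (\<lambda>s. divergence u (edge_param v e s) * p (edge_param v e s)) = 0"
        by (simp only: dof_value_Edge[OF e])
    qed
    have F: "integral unit_triangle (\<lambda>z. divergence u (face_param v f z) * q (face_param v f z)) = 0"
      if f: "f \<in> tetra_faces" and q: "q \<in> poly_space (k - 4)" for f q
    proof (rule pairing_vanishes[OF unit_triangle(1) continuous_face_param eq_refl[OF face_param_image[OF f]] dc assms(8)[OF f] _ q])
      fix p assume "p \<in> QF f"
      then have "Face_div f p \<in> ?I" using f unfolding dofs_def by blast
      from N0[OF this] show "integral unit_triangle (\<lambda>z. divergence u (face_param v f z) * p (face_param v f z)) = 0"
        using unit_triangle_area by (simp only: dof_value_Face_div[OF f]) simp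
    qed
    have N: "integral unit_triangle (\<lambda>z. (u (face_param v f z) \<bullet> n f) * q (face_param v f z)) = 0"
      if f: "f \<in> tetra_faces" and q: "q \<in> poly_space (r - 1)" for f q
    proof (rule pairing_vanishes[OF unit_triangle(1) continuous_face_param eq_refl[OF face_param_image[OF f]]
          polynomials_continuous[OF vec_polynomials_inner[OF up]] assms(9)[OF f] _ q])
      fix p assume "p \<in> QN f"
      then have "Face_normal f p \<in> ?I" using f unfolding dofs_def by blast
      from N0[OF this] show "integral unit_triangle (\<lambda>z. (u (face_param v f z) \<bullet> n f) * p (face_param v f z)) = 0"
        using face_area_pos[OF f] by (simp only: dof_value_Face_normal) simp
    qed
    \<comment> \<open>The interior moment is viewed as a functional of the test field, with
      \<open>u\<close> fixed, in order to pass from the basis \<open>QI\<close> to all admissible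
      test fields.\<close>
    define L where "L q = integral (tetra v) (\<lambda>x. u x \<bullet> push_forward B b q x)" for q
    have linL: "linear_on_space vec_polynomials L"
      unfolding L_def
      by (rule linear_on_space_integral[OF tetra_body(1)])
        (use up in \<open>auto intro!: continuous_on_field_inner push_forward_vec_polynomials
          simp: push_forward_linear inner_add_right\<close>)
    have "L q = 0" if "q \<in> QI" for q
      using N0[of "Interior q"] that by (simp add: dofs_def L_def)
    note L0 = D(4)[OF linL this]
    \<comment> \<open>Every gradient on the tetrahedron is the push-forward of a gradient of the
      same degree on the reference tetrahedron, so the interior degrees of freedom test against all
      of them.\<close>
    have G: "integral (tetra v) (\<lambda>x. u x \<bullet> grad p x) = 0" if k: "k \<ge> 5" and p: "p \<in> poly_space (k - 5)" for p
    proof -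
      obtain p' where p': "p' \<in> poly_space (k - 5)" "push_forward B b (grad p') = grad p"
        using push_forward_grad_onto[OF B p] by blast
      have "L (grad p') = 0" using L0 k p'(1) by blast
      then show ?thesis by (simp add: L_def p'(2))
    qed
    have "divergence u = 0"
      by (rule divergence_vanishes[OF kr up dS assms(5) V E F N G])
    \<comment> \<open>Within the space, a vanishing divergence leaves only the curl summand.\<close>
    then have "u \<in> div_free (r - 1)" using u Wf(5) by blast
    then show "u = 0"
      by (rule divergence_free_vanishes[OF _ kr(2) assms(5) N assms(6) B]) (use L0 in \<open>auto simp: L_def\<close>)
  qed
qed

end
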